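(* Let $\mathcal{A}$ be a properly infinite von Neumann algebra acting on a Hilbert space $H$, let $F\in\mathcal{A}$ and let $\alpha$ be an isolated point of the spectrum $\sigma(F)$. If $F-\alpha I$ is $\mathcal{A}$-Fredholm and $P_0$ is the spectral (Riesz) projection of $F$ corresponding to $\alpha$, then $P_0$ is a finite operator.
   Context: For a closed subspace $L$ of $H$, $P_L$ is the orthogonal projection onto $L$. A projection of $\mathcal{A}$ is finite if it is not Murray–von Neumann equivalent in $\mathcal{A}$ to any of its proper subprojections. An operator $S\in\mathcal{A}$ is a finite operator if $P_{\overline{\operatorname{Im}S}}$ is a finite projection of $\mathcal{A}$. An operator $T\in\mathcal{A}$ is $\mathcal{A}$-Fredholm (in the sense of Breuer) if $P_{\ker T}$ is finite and there is a finite projection $E\in\mathcal{A}$ with $\operatorname{Im}(I-E)\subseteq\operatorname{Im}T$. The spectral projection $P_0$ is in general a (not necessarily self-adjoint) idempotent. *)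

theory Defs
  imports "HOL-Complex_Analysis.Complex_Analysis"
begin

text \<open>The real structure of a complex Hilbert space (norm, topology, completeness) is the one of
  the classes \<^class>\<open>real_inner\<close> and \<^class>\<open>banach\<close>; its real inner product is the real part of the complex
  inner product, which is linear in the first argument.  No separability is assumed.\<close>

class complex_hilbert_space = real_inner + banach +
  fixes scaleC :: "complex \<Rightarrow> 'a \<Rightarrow> 'a"  (infixr "*\<^sub>C" 75)
    and cinner :: "'a \<Rightarrow> 'a \<Rightarrow> complex"
  assumes scaleC_add_right: "c *\<^sub>C (x + y) = c *\<^sub>C x + c *\<^sub>C y"
    and scaleC_add_left: "(c + d) *\<^sub>C x = c *\<^sub>C x + d *\<^sub>C x"
    and scaleC_scaleC: "c *\<^sub>C (d *\<^sub>C x) = (c * d) *\<^sub>C x"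
    and scaleC_of_real: "complex_of_real r *\<^sub>C x = r *\<^sub>R x"
    and cinner_commute: "cinner x y = cnj (cinner y x)"
    and cinner_add_left: "cinner (x + y) z = cinner x z + cinner y z"
    and cinner_scaleC_left: "cinner (c *\<^sub>C x) y = c * cinner x y"
    and inner_eq_Re_cinner: "inner x y = Re (cinner x y)"

lemma norm_scaleC: "norm (c *\<^sub>C x) = cmod c * norm (x :: 'a::complex_hilbert_space)"
proof -
  have im: "Im (cinner x x) = 0"
    using arg_cong[OF cinner_commute[of x x], of Im] by simp
  have r: "cinner (c *\<^sub>C x) (c *\<^sub>C x) = (c * cnj c) * cinner x x"
    by (metis cinner_commute cinner_scaleC_left complex_cnj_mult mult.assoc)
  have n: "(norm y)\<^sup>2 = Re (cinner y y)" for y :: 'a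
    by (simp add: power2_norm_eq_inner inner_eq_Re_cinner)
  have "(norm (c *\<^sub>C x))\<^sup>2 = (cmod c)\<^sup>2 * (norm x)\<^sup>2"
    unfolding n r complex_mult_cnj cmod_power2 by (simp add: im)
  then show ?thesis
    by (metis norm_ge_zero power2_eq_imp_eq power_mult_distrib mult_nonneg_nonneg)
qed

lemma bounded_linear_scaleC: "bounded_linear (\<lambda>x :: 'a::complex_hilbert_space. c *\<^sub>C x)"
proof (rule bounded_linear_intro[where K = "cmod c"])
  fix r :: real and x y :: 'a
  show "c *\<^sub>C (x + y) = c *\<^sub>C x + c *\<^sub>C y" by (rule scaleC_add_right)
  show "c *\<^sub>C (r *\<^sub>R x) = r *\<^sub>R (c *\<^sub>C x)"
    by (metis scaleC_scaleC scaleC_of_real mult.commute)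
  show "norm (c *\<^sub>C x) \<le> norm x * cmod c" by (simp add: norm_scaleC mult.commute)
qed

text \<open>\<open>'a \<Rightarrow>\<^sub>L 'a\<close> consists of the bounded real-linear maps; the bounded operators on the complex
  space are singled out in \<open>bounded_ops\<close>.\<close>

definition bounded_ops :: "('a::complex_hilbert_space \<Rightarrow>\<^sub>L 'a) set" where
  "bounded_ops = {T :: 'a \<Rightarrow>\<^sub>L 'a. \<forall>c x. T (c *\<^sub>C x) = c *\<^sub>C T x}"

lift_definition scalar_op :: "complex \<Rightarrow> 'a::complex_hilbert_space \<Rightarrow>\<^sub>L 'a" is "\<lambda>c x. c *\<^sub>C x"
  by (rule bounded_linear_scaleC)

definition adj :: "('a::complex_hilbert_space \<Rightarrow>\<^sub>L 'a) \<Rightarrow> 'a \<Rightarrow>\<^sub>L 'a" where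
  "adj T = (THE S. S \<in> bounded_ops \<and> (\<forall>x y. cinner (T x) y = cinner x (S y)))"

definition commutant :: "('a::complex_hilbert_space \<Rightarrow>\<^sub>L 'a) set \<Rightarrow> ('a \<Rightarrow>\<^sub>L 'a) set" where
  "commutant A = {T \<in> bounded_ops. \<forall>S\<in>A. T o\<^sub>L S = S o\<^sub>L T}"

definition star_subalgebra :: "('a::complex_hilbert_space \<Rightarrow>\<^sub>L 'a) set \<Rightarrow> bool" where
  "star_subalgebra A \<longleftrightarrow> A \<subseteq> bounded_ops \<and> 0 \<in> A \<and>
     (\<forall>S\<in>A. \<forall>T\<in>A. S + T \<in> A \<and> S o\<^sub>L T \<in> A) \<and>
     (\<forall>c. \<forall>T\<in>A. scalar_op c o\<^sub>L T \<in> A) \<and> (\<forall>T\<in>A. adj T \<in> A)"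

definition von_neumann_algebra :: "('a::complex_hilbert_space \<Rightarrow>\<^sub>L 'a) set \<Rightarrow> bool" where
  "von_neumann_algebra A \<longleftrightarrow> star_subalgebra A \<and> commutant (commutant A) = A"

text \<open>The orthogonal projection onto a closed subspace \<open>L\<close>.\<close>

definition proj_onto :: "'a::complex_hilbert_space set \<Rightarrow> 'a \<Rightarrow>\<^sub>L 'a" where
  "proj_onto L = (THE P :: 'a \<Rightarrow>\<^sub>L 'a. P \<in> bounded_ops \<and>
     (\<forall>x. P x \<in> L \<and> (\<forall>y\<in>L. cinner (x - P x) y = 0)))"

definition projections :: "('a::complex_hilbert_space \<Rightarrow>\<^sub>L 'a) set \<Rightarrow> ('a \<Rightarrow>\<^sub>L 'a) set" where
  "projections A = {P \<in> A. P o\<^sub>L P = P \<and> adj P = P}"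

definition murray_von_neumann_equiv ::
  "('a::complex_hilbert_space \<Rightarrow>\<^sub>L 'a) set \<Rightarrow> ('a \<Rightarrow>\<^sub>L 'a) \<Rightarrow> ('a \<Rightarrow>\<^sub>L 'a) \<Rightarrow> bool" where
  "murray_von_neumann_equiv A P Q \<longleftrightarrow> (\<exists>V\<in>A. adj V o\<^sub>L V = P \<and> V o\<^sub>L adj V = Q)"

definition finite_projection ::
  "('a::complex_hilbert_space \<Rightarrow>\<^sub>L 'a) set \<Rightarrow> ('a \<Rightarrow>\<^sub>L 'a) \<Rightarrow> bool" where
  "finite_projection A P \<longleftrightarrow> P \<in> projections A \<and>
     \<not> (\<exists>Q\<in>projections A.
        range (blinfun_apply Q) \<subset> range P \<and> murray_von_neumann_equiv A P Q)"

definition properly_infinite :: "('a::complex_hilbert_space \<Rightarrow>\<^sub>L 'a) set \<Rightarrow> bool" where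
  "properly_infinite A \<longleftrightarrow>
     (\<forall>Z \<in> projections A \<inter> commutant A. Z \<noteq> 0 \<longrightarrow> \<not> finite_projection A Z)"

definition finite_operator ::
  "('a::complex_hilbert_space \<Rightarrow>\<^sub>L 'a) set \<Rightarrow> ('a \<Rightarrow>\<^sub>L 'a) \<Rightarrow> bool" where
  "finite_operator A S \<longleftrightarrow> S \<in> A \<and> finite_projection A (proj_onto (closure (range S)))"

definition fredholm ::
  "('a::complex_hilbert_space \<Rightarrow>\<^sub>L 'a) set \<Rightarrow> ('a \<Rightarrow>\<^sub>L 'a) \<Rightarrow> bool" where
  "fredholm A T \<longleftrightarrow> T \<in> A \<and> finite_projection A (proj_onto {x. T x = 0}) \<and>
     (\<exists>E :: 'a \<Rightarrow>\<^sub>L 'a. finite_projection A E \<and> range (id_blinfun - E) \<subseteq> range T)"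

definition is_op_inverse ::
  "('a::complex_hilbert_space \<Rightarrow>\<^sub>L 'a) \<Rightarrow> ('a \<Rightarrow>\<^sub>L 'a) \<Rightarrow> bool" where
  "is_op_inverse T S \<longleftrightarrow> S \<in> bounded_ops \<and> S o\<^sub>L T = id_blinfun \<and> T o\<^sub>L S = id_blinfun"

definition op_spectrum :: "('a::complex_hilbert_space \<Rightarrow>\<^sub>L 'a) \<Rightarrow> complex set" where
  "op_spectrum F = {z. \<nexists>S. is_op_inverse (F - scalar_op z) S}"

definition resolvent :: "('a::complex_hilbert_space \<Rightarrow>\<^sub>L 'a) \<Rightarrow> complex \<Rightarrow> 'a \<Rightarrow>\<^sub>L 'a" where
  "resolvent F z = (THE S. is_op_inverse (scalar_op z - F) S)"

text \<open>Operator-valued version of \<^const>\<open>has_contour_integral\<close>.\<close>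

definition has_op_contour_integral ::
  "(complex \<Rightarrow> 'a::complex_hilbert_space \<Rightarrow>\<^sub>L 'a) \<Rightarrow> ('a \<Rightarrow>\<^sub>L 'a) \<Rightarrow> (real \<Rightarrow> complex) \<Rightarrow> bool" where
  "has_op_contour_integral f I g \<longleftrightarrow>
     ((\<lambda>t. scalar_op (vector_derivative g (at t within {0..1})) o\<^sub>L f (g t)) has_integral I) {0..1}"

text \<open>The Riesz projection at an isolated point \<open>\<alpha>\<close> of the spectrum; the choice of the radius \<open>r\<close>
  does not matter.\<close>

definition is_riesz_projection ::
  "('a::complex_hilbert_space \<Rightarrow>\<^sub>L 'a) \<Rightarrow> complex \<Rightarrow> ('a \<Rightarrow>\<^sub>L 'a) \<Rightarrow> bool" where
  "is_riesz_projection F \<alpha> P \<longleftrightarrow> (\<exists>r>0. \<exists>I. op_spectrum F \<inter> cball \<alpha> r = {\<alpha>} \<and>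
     has_op_contour_integral (resolvent F) I (circlepath \<alpha> r) \<and>
     P = scalar_op (1 / (2 * of_real pi * \<i>)) o\<^sub>L I)"

end

theory Submission
  imports Defs
begin

text \<open>Write \<open>T = F - \<alpha>\<close>. Fredholmness gives a finite projection \<open>E\<close> whose complement has its range in
  the range of \<open>T\<close>; by uniform boundedness this means \<open>\<parallel>x - E x\<parallel> \<le> C \<parallel>T\<^sup>* x\<parallel>\<close>. On the range of \<open>P\<^sub>0\<close>
  the operator \<open>T\<close> is quasinilpotent, so \<open>C\<^sup>n \<parallel>(T\<^sup>n P\<^sub>0)\<^sup>*\<parallel> < 1\<close> for some \<open>n\<close>. Hence a vector in the
  range of \<open>P\<^sub>0\<^sup>*\<close> that is annihilated by \<open>E T\<^sup>*\<^sup>k\<close> for all \<open>k < n\<close> vanishes, and the projection onto this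
  range is the supremum of \<open>n\<close> projections that are equivalent to subprojections of \<open>E\<close>. Such a
  supremum is finite, because orthogonal sums of finite projections are, and by polar decomposition the
  projections onto the ranges of \<open>P\<^sub>0\<^sup>*\<close> and \<open>P\<^sub>0\<close> are equivalent.\<close>

section \<open>Complex Hilbert spaces\<close>

text \<open>The range of \<open>T\<close> need not be closed; passing to the adjoint turns the range
  inclusion into an estimate that survives iteration. As long as \<open>E\<close> kills the iterates
  of a vector under \<open>adj T\<close>, each step costs one factor \<open>C\<close>, and a decay
  rate of \<open>1 / (2 * C)\<close> for the powers of \<open>T\<close> on the range of
  \<open>P\<^sub>0\<close> beats this growth whatever the constant in front. The obstacle is
  additivity of finiteness. A general algebra offers no trace or dimension function to appeal to, so
  additivity is derived from comparison of projections: an isometry of the sum onto a proper part of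
  it generates a unilateral shift, whose even and odd halves can be traded between the two summands.
  All equivalences come from one source, sets of pairs of vectors of equal norm that are invariant
  under the commutant. Both polar decomposition and the maximality argument for comparison produce
  such sets, and the invariance puts the resulting partial isometry into the algebra.\<close>

lemma scaleC_one [simp]: "1 *\<^sub>C (x::'a::complex_hilbert_space) = x"
  using scaleC_of_real[of 1 x] by simp

lemma scaleC_zero_right [simp]: "c *\<^sub>C (0::'a::complex_hilbert_space) = 0"
  using linear_0[OF bounded_linear.linear[OF bounded_linear_scaleC]] .

lemma scaleC_minus_right: "c *\<^sub>C (- x) = - (c *\<^sub>C (x::'a::complex_hilbert_space))"
  using linear_neg[OF bounded_linear.linear[OF bounded_linear_scaleC]] .

lemma scaleC_diff_right: "c *\<^sub>C (x - y) = c *\<^sub>C x - c *\<^sub>C (y::'a::complex_hilbert_space)"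
  using linear_diff[OF bounded_linear.linear[OF bounded_linear_scaleC]] .

lemma cinner_add_right: "cinner x (y + z) = cinner x y + cinner x (z::'a::complex_hilbert_space)"
  by (metis cinner_add_left cinner_commute complex_cnj_add)

lemma cinner_scaleC_right: "cinner x (c *\<^sub>C y) = cnj c * cinner x (y::'a::complex_hilbert_space)"
  by (metis cinner_scaleC_left cinner_commute complex_cnj_mult)

lemma cinner_zero_left [simp]: "cinner 0 (y::'a::complex_hilbert_space) = 0"
  using cinner_add_left[of 0 0 y] by simp

lemma cinner_diff_left: "cinner (x - y) z = cinner x z - cinner y (z::'a::complex_hilbert_space)"
  using cinner_add_left[of "x - y" y z] by simp

lemma inner_scaleC_right:
  "inner x (c *\<^sub>C y) = inner (cnj c *\<^sub>C x) (y::'a::complex_hilbert_space)"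
  by (simp add: inner_eq_Re_cinner cinner_scaleC_left cinner_scaleC_right)

text \<open>\<open>cinner x (\<i> *\<^sub>C y)\<close> is \<open>- \<i>\<close> times
  \<open>cinner x y\<close>, so its real part is the missing imaginary part. Hence identities
  between complex inner products can be checked on \<open>inner\<close>, which is used almost
  everywhere below.\<close>

lemma cinner_eq_Complex:
  "cinner x y = Complex (inner x y) (inner x (\<i> *\<^sub>C (y::'a::complex_hilbert_space)))"
  by (simp add: inner_eq_Re_cinner cinner_scaleC_right complex_eq_iff)

lemma cinner_self: "cinner x x = of_real ((norm (x::'a::complex_hilbert_space))\<^sup>2)"
proof -
  have "Im (cinner x x) = 0"
    using arg_cong[OF cinner_commute[of x x], of Im] by simp
  then show ?thesis
    by (simp add: complex_eq_iff power2_norm_eq_inner inner_eq_Re_cinner)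
qed

lemma cinner_norm_le: "cmod (cinner x y) \<le> norm x * norm (y::'a::complex_hilbert_space)"
proof (cases "cinner x y = 0")
  case False
  \<comment> \<open>A number of modulus 1 that rotates the inner product onto the non-negative real
    axis, where the real Cauchy-Schwarz inequality applies.\<close>
  define u where "u = cnj (cinner x y) / cmod (cinner x y)"
  have "norm u = 1"
    using False by (simp add: u_def norm_divide)
  have "u * cinner x y = of_real (cmod (cinner x y))"
    using False complex_norm_square[of "cinner x y"]
    by (simp add: u_def field_simps power2_eq_square)
  then have "cmod (cinner x y) = inner (u *\<^sub>C x) y"
    by (simp add: inner_eq_Re_cinner cinner_scaleC_left)
  also have "\<dots> \<le> norm (u *\<^sub>C x) * norm y"
    by (rule norm_cauchy_schwarz)
  finally show ?thesis
    by (simp add: norm_scaleC \<open>norm u = 1\<close>)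
qed auto

lemma cinner_eqI:
  assumes "\<And>z. cinner x z = cinner y (z::'a::complex_hilbert_space)"
  shows "x = y"
  using assms[of "x - y"] cinner_self[of "x - y"] by (simp add: cinner_diff_left)

lemma inner_eqI:
  assumes "\<And>z. inner x z = inner y (z::'a::real_inner)"
  shows "x = y"
  using assms[of "x - y"] inner_eq_zero_iff[of "x - y"] by (simp add: inner_diff_left)

text \<open>Polarisation; it later yields \<open>adj V o\<^sub>L V = P\<close> from an equality of
  norms.\<close>

lemma inner_eq_if_norm_eq:
  fixes f g :: "'a::real_inner \<Rightarrow> 'b::real_inner"
  assumes "linear f" "linear g" "\<And>x. norm (f x) = norm (g x)"
  shows "inner (f x) (f y) = inner (g x) (g y)"
  using assms(3)[of "x + y"] assms(3)[of x] assms(3)[of y]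
  by (simp add: dot_norm linear_add[OF assms(1)] linear_add[OF assms(2)])

section \<open>Complex subspaces, nearest points and the Riesz representation\<close>

definition csubspace :: "'a::complex_hilbert_space set \<Rightarrow> bool" where
  "csubspace L \<longleftrightarrow> 0 \<in> L \<and> (\<forall>x\<in>L. \<forall>y\<in>L. x + y \<in> L) \<and> (\<forall>c. \<forall>x\<in>L. c *\<^sub>C x \<in> L)"

lemma csubspace_imp_subspace: "csubspace L \<Longrightarrow> subspace L"
  unfolding csubspace_def subspace_def by (metis scaleC_of_real)

lemma csubspace_cinner_zero_iff:
  assumes "csubspace L"
  shows "(\<forall>y\<in>L. cinner x y = 0) \<longleftrightarrow> (\<forall>y\<in>L. inner x y = 0)"
  using assms unfolding csubspace_def by (auto simp: cinner_eq_Complex complex_eq_iff)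

text \<open>The parallelogram law makes a minimising sequence Cauchy, because midpoints stay in
  \<open>L\<close>; minimality of the limit along every line in \<open>L\<close> through it is
  orthogonality.\<close>

lemma closed_subspace_nearest_point:
  fixes L :: "'a::{real_inner,banach} set"
  assumes L: "closed L" "subspace L"
  shows "\<exists>p\<in>L. \<forall>y\<in>L. inner (x - p) y = 0"
proof -
  define d where "d = infdist x L"
  have ne: "L \<noteq> {}" using L(2) subspace_0 by auto
  have lower: "d \<le> dist x y" if "y \<in> L" for y
    unfolding d_def by (rule infdist_le[OF that])
  have d0: "d \<ge> 0" unfolding d_def by (rule infdist_nonneg)
  have "\<exists>y\<in>L. dist x y < d + inverse (real (Suc n))" for n
  proof -
    have "(INF y\<in>L. dist x y) < d + inverse (real (Suc n))"
      using ne by (simp add: d_def infdist_def)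
    from cInf_lessD[OF _ this] ne show ?thesis by blast
  qed
  then obtain y where yL: "\<And>n. y n \<in> L" and yd: "\<And>n. dist x (y n) < d + inverse (real (Suc n))"
    by metis
  have h: "(\<lambda>n. d + inverse (real (Suc n))) \<longlonglongrightarrow> d"
    using tendsto_add[OF tendsto_const[of d] LIMSEQ_inverse_real_of_nat] by simp
  have l: "\<forall>\<^sub>F n in sequentially. d \<le> dist x (y n)"
    by (rule always_eventually) (simp add: lower yL)
  have u: "\<forall>\<^sub>F n in sequentially. dist x (y n) \<le> d + inverse (real (Suc n))"
    by (rule always_eventually) (rule allI, rule less_imp_le, rule yd)
  have "(\<lambda>n. dist x (y n)) \<longlonglongrightarrow> d"
    by (rule tendsto_sandwich[OF l u tendsto_const h])
  then have lim: "(\<lambda>n. (dist x (y n))\<^sup>2) \<longlonglongrightarrow> d\<^sup>2"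
    by (intro tendsto_power)
  have par: "(dist (y m) (y n))\<^sup>2 \<le> 2 * (dist x (y m))\<^sup>2 + 2 * (dist x (y n))\<^sup>2 - 4 * d\<^sup>2" for m n
  proof -
    define c where "c = (1/2) *\<^sub>R (y m + y n)"
    have "c \<in> L" unfolding c_def by (intro subspace_scale subspace_add L yL)
    then have "d\<^sup>2 \<le> (dist x c)\<^sup>2" using lower d0 by (simp add: power_mono)
    moreover have "(dist (y m) (y n))\<^sup>2 + 4 * (dist x c)\<^sup>2 = 2 * (dist x (y m))\<^sup>2 + 2 * (dist x (y n))\<^sup>2"
      unfolding c_def dist_norm power2_norm_eq_inner
      by (simp add: inner_diff_left inner_diff_right inner_add_left inner_add_right inner_commute
          algebra_simps)
    ultimately show ?thesis by linarith
  qed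
  have "Cauchy y"
  proof (rule metric_CauchyI)
    fix e :: real assume "e > 0"
    then have "e\<^sup>2 / 4 > 0" by simp
    from order_tendstoD(2)[OF lim, of "d\<^sup>2 + e\<^sup>2 / 4"] this
    obtain N where N: "\<And>n. n \<ge> N \<Longrightarrow> (dist x (y n))\<^sup>2 < d\<^sup>2 + e\<^sup>2 / 4"
      by (auto simp: eventually_sequentially)
    have "dist (y m) (y n) < e" if "m \<ge> N" "n \<ge> N" for m n
    proof (rule power2_less_imp_less)
      show "(dist (y m) (y n))\<^sup>2 < e\<^sup>2" using par[of m n] N[OF that(1)] N[OF that(2)] by linarith
    qed (use \<open>e > 0\<close> in simp)
    then show "\<exists>M. \<forall>m\<ge>M. \<forall>n\<ge>M. dist (y m) (y n) < e" by blast
  qed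
  then obtain p where p: "y \<longlonglongrightarrow> p"
    using Cauchy_convergent_iff convergent_def by blast
  have pL: "p \<in> L" using closed_sequentially[OF L(1) _ p] yL by auto
  have "(\<lambda>n. (dist x (y n))\<^sup>2) \<longlonglongrightarrow> (dist x p)\<^sup>2"
    by (intro tendsto_intros p)
  then have dp: "(dist x p)\<^sup>2 = d\<^sup>2"
    by (rule LIMSEQ_unique[OF _ lim])
  have "inner (x - p) z = 0" if z: "z \<in> L" for z
  proof (cases "z = 0")
    case False
    \<comment> \<open>The minimiser of the squared distance from \<open>x\<close> to
      \<open>p + t *\<^sub>R z\<close>; its value there would drop below \<open>d\<^sup>2\<close>
      unless the inner product is 0.\<close>
    define t where "t = inner (x - p) z / inner z z"
    have zz: "inner z z > 0" using False by simp
    have "p + t *\<^sub>R z \<in> L" by (intro subspace_scale subspace_add L pL z)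
    then have "d\<^sup>2 \<le> (dist x (p + t *\<^sub>R z))\<^sup>2" using lower d0 by (simp add: power_mono)
    also have "\<dots> = (dist x p)\<^sup>2 - 2 * t * inner (x - p) z + t\<^sup>2 * inner z z"
      unfolding dist_norm power2_norm_eq_inner
      by (simp add: inner_diff_left inner_diff_right inner_add_left inner_add_right inner_commute
          algebra_simps power2_eq_square)
    also have "\<dots> = d\<^sup>2 - (inner (x - p) z)\<^sup>2 / inner z z"
      using zz unfolding dp by (simp add: t_def power2_eq_square field_simps)
    finally have "(inner (x - p) z)\<^sup>2 / inner z z \<le> 0" by simp
    then show ?thesis using zz by (simp add: divide_le_0_iff)
  qed simp
  with pL show ?thesis by blast
qed

text \<open>The kernel of a nonzero functional has codimension one, so a vector \<open>u\<close>
  orthogonal to it represents \<open>f\<close> up to the factor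
  \<open>f u / inner u u\<close>.\<close>

lemma riesz_representation:
  fixes f :: "'a::{real_inner,banach} \<Rightarrow> real"
  assumes f: "bounded_linear f"
  shows "\<exists>z. \<forall>x. f x = inner x z"
proof (cases "\<forall>x. f x = 0")
  case False
  then obtain x0 where x0: "f x0 \<noteq> 0" by blast
  interpret f: bounded_linear f by fact
  define L where "L = {x. f x = 0}"
  have "closed L"
    unfolding L_def by (intro closed_Collect_eq continuous_intros f.continuous_on)
  moreover have "subspace L"
    unfolding L_def subspace_def by (simp add: f.zero f.add f.scaleR)
  ultimately obtain p where p: "p \<in> L" "\<And>y. y \<in> L \<Longrightarrow> inner (x0 - p) y = 0"
    using closed_subspace_nearest_point[of L x0] by blast
  define u where "u = x0 - p"
  have fu: "f u \<noteq> 0" using x0 p(1) by (simp add: u_def f.diff L_def)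
  then have uu: "inner u u \<noteq> 0" using f.zero by auto
  have "f x = inner x ((f u / inner u u) *\<^sub>R u)" for x
  proof -
    have "x - (f x / f u) *\<^sub>R u \<in> L"
      using fu by (simp add: L_def f.diff f.scaleR)
    from p(2)[OF this] have "inner u x = f x / f u * inner u u"
      by (simp add: u_def[symmetric] inner_diff_right)
    then show ?thesis using fu uu by (simp add: inner_commute field_simps)
  qed
  then show ?thesis by blast
qed (auto intro: exI[of _ 0])

section \<open>Bounded complex-linear operators and their adjoints\<close>

lemma bounded_opsI:
  fixes T :: "'a::complex_hilbert_space \<Rightarrow>\<^sub>L 'a"
  assumes "\<And>c x. T (c *\<^sub>C x) = c *\<^sub>C T x"
  shows "T \<in> bounded_ops"
  using assms
  by (simp add: bounded_ops_def)

lemma bounded_opsD: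
  fixes T :: "'a::complex_hilbert_space \<Rightarrow>\<^sub>L 'a"
  assumes "T \<in> bounded_ops"
  shows "T (c *\<^sub>C x) = c *\<^sub>C T x"
  using assms
  by (simp add: bounded_ops_def)

text \<open>The real Riesz representation gives the adjoint for \<open>inner\<close>. Complex
  linearity of \<open>T\<close> passes to it, and with that the relation upgrades to
  \<open>cinner\<close>.\<close>

lemma adjoint_exists:
  fixes T :: "'a::complex_hilbert_space \<Rightarrow>\<^sub>L 'a"
  assumes T: "T \<in> bounded_ops"
  shows "\<exists>S\<in>bounded_ops. \<forall>x y. cinner (T x) y = cinner x (S y)"
proof -
  have "\<exists>z. \<forall>x. inner (T x) y = inner x z" for y
    by (rule riesz_representation) (intro bounded_linear_intros)
  then have "\<exists>s. \<forall>y x. inner (T x) y = inner x (s y)"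
    by (intro choice allI)
  then obtain s where s: "\<And>x y. inner (T x) y = inner x (s y)"
    by blast
  have add: "s (x + y) = s x + s y" for x y
    by (rule inner_eqI) (metis s inner_add_right inner_commute)
  have sC: "s (c *\<^sub>C y) = c *\<^sub>C s y" for c y
  proof (rule inner_eqI)
    fix z
    have "inner z (s (c *\<^sub>C y)) = inner z (c *\<^sub>C s y)"
      by (simp add: s[symmetric] inner_scaleC_right bounded_opsD[OF T, symmetric])
    then show "inner (s (c *\<^sub>C y)) z = inner (c *\<^sub>C s y) z" by (simp add: inner_commute)
  qed
  have "bounded_linear s"
  proof (rule bounded_linear_intro[where K = "norm T"])
    show "s (r *\<^sub>R x) = r *\<^sub>R s x" for r x using sC[of "of_real r"] by (simp add: scaleC_of_real)
    show "norm (s y) \<le> norm y * norm T" for y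
    proof (cases "s y = 0")
      case False
      have "norm (s y) * norm (s y) = inner (T (s y)) y"
        by (simp add: s norm_eq_square flip: power2_eq_square power2_norm_eq_inner)
      also have "\<dots> \<le> norm (T (s y)) * norm y" by (rule norm_cauchy_schwarz)
      also have "\<dots> \<le> (norm T * norm (s y)) * norm y"
        by (intro mult_right_mono norm_blinfun) simp
      finally show ?thesis using False by (simp add: ac_simps)
    qed simp
  qed (rule add)
  then have S: "blinfun_apply (Blinfun s) = s" by (rule bounded_linear_Blinfun_apply)
  have "cinner (T x) y = cinner x (s y)" for x y
    by (simp add: cinner_eq_Complex s sC)
  with S sC show ?thesis
    by (intro bexI[of _ "Blinfun s"] bounded_opsI) auto
qed

lemma adj_unique:
  fixes T :: "'a::complex_hilbert_space \<Rightarrow>\<^sub>L 'a"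
  assumes "S \<in> bounded_ops" "\<And>x y. cinner (T x) y = cinner x (S y)"
  shows "adj T = S"
  unfolding adj_def
proof (rule the_equality)
  fix S' assume S': "S' \<in> bounded_ops \<and> (\<forall>x y. cinner (T x) y = cinner x (S' y))"
  have "S' y = S y" for y
    by (rule cinner_eqI) (metis S' assms(2) cinner_commute)
  then show "S' = S" by (intro blinfun_eqI)
qed (use assms in blast)

lemma
  fixes T :: "'a::complex_hilbert_space \<Rightarrow>\<^sub>L 'a"
  assumes "T \<in> bounded_ops"
  shows adj_bounded_ops [simp]: "adj T \<in> bounded_ops"
    and cinner_adj: "cinner (T x) y = cinner x (adj T y)"
proof -
  obtain S where "S \<in> bounded_ops" "\<forall>x y. cinner (T x) y = cinner x (S y)"
    using adjoint_exists[OF assms] by blast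
  moreover from this have "adj T = S" by (intro adj_unique) auto
  ultimately show "adj T \<in> bounded_ops" "cinner (T x) y = cinner x (adj T y)" by auto
qed

lemma cinner_adj':
  fixes T :: "'a::complex_hilbert_space \<Rightarrow>\<^sub>L 'a"
  assumes "T \<in> bounded_ops"
  shows "cinner (adj T x) y = cinner x (T y)"
  using assms
  by (metis cinner_adj cinner_commute)

lemma inner_adj:
  fixes T :: "'a::complex_hilbert_space \<Rightarrow>\<^sub>L 'a"
  assumes "T \<in> bounded_ops"
  shows "inner (T x) y = inner x (adj T y)"
  using assms
  by (simp add: inner_eq_Re_cinner cinner_adj)

lemma inner_adj':
  fixes T :: "'a::complex_hilbert_space \<Rightarrow>\<^sub>L 'a"
  assumes "T \<in> bounded_ops"
  shows "inner (adj T x) y = inner x (T y)"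
  using assms
  by (simp add: inner_eq_Re_cinner cinner_adj')

text \<open>Real inner products suffice because both operators commute with multiplication by
  \<open>\<i>\<close>.\<close>

lemma adj_eqI:
  fixes T :: "'a::complex_hilbert_space \<Rightarrow>\<^sub>L 'a"
  assumes "S \<in> bounded_ops" "T \<in> bounded_ops" "\<And>x y. inner (T x) y = inner x (S y)"
  shows "adj T = S"
  using assms by (intro adj_unique) (auto simp: cinner_eq_Complex bounded_opsD[symmetric])

lemma bounded_ops_add [simp]: "S \<in> bounded_ops \<Longrightarrow> T \<in> bounded_ops \<Longrightarrow> S + T \<in> bounded_ops"
  by (simp add: bounded_ops_def blinfun.add_left scaleC_add_right)

lemma bounded_ops_diff [simp]: "S \<in> bounded_ops \<Longrightarrow> T \<in> bounded_ops \<Longrightarrow> S - T \<in> bounded_ops"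
  by (simp add: bounded_ops_def blinfun.diff_left scaleC_diff_right)

lemma bounded_ops_compose [simp]: "S \<in> bounded_ops \<Longrightarrow> T \<in> bounded_ops \<Longrightarrow> S o\<^sub>L T \<in> bounded_ops"
  by (simp add: bounded_ops_def)

lemma bounded_ops_id [simp]: "id_blinfun \<in> bounded_ops"
  by (simp add: bounded_ops_def)

lemma bounded_ops_zero [simp]: "0 \<in> bounded_ops"
  by (simp add: bounded_ops_def)

lemma scalar_op_apply [simp]: "scalar_op c x = c *\<^sub>C x"
  by (simp add: scalar_op.rep_eq)

lemma bounded_ops_scalar [simp]: "scalar_op c \<in> bounded_ops"
  by (simp add: bounded_ops_def scaleC_scaleC mult.commute)

lemma adj_adj [simp]: "T \<in> bounded_ops \<Longrightarrow> adj (adj T) = T"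
  by (intro adj_eqI) (auto simp: inner_adj')

lemma adj_id [simp]: "adj id_blinfun = id_blinfun"
  by (intro adj_eqI) auto

lemma adj_add: "S \<in> bounded_ops \<Longrightarrow> T \<in> bounded_ops \<Longrightarrow> adj (S + T) = adj S + adj T"
  by (rule adj_eqI) (simp_all add: blinfun.add_left inner_add_left inner_add_right inner_adj)

lemma adj_diff: "S \<in> bounded_ops \<Longrightarrow> T \<in> bounded_ops \<Longrightarrow> adj (S - T) = adj S - adj T"
  by (rule adj_eqI) (simp_all add: blinfun.diff_left inner_diff_left inner_diff_right inner_adj)

lemma adj_compose: "S \<in> bounded_ops \<Longrightarrow> T \<in> bounded_ops \<Longrightarrow> adj (S o\<^sub>L T) = adj T o\<^sub>L adj S"
  by (rule adj_eqI) (simp_all add: inner_adj)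

lemma norm_adj_le: "T \<in> bounded_ops \<Longrightarrow> norm (adj T) \<le> norm T"
proof (rule norm_blinfun_bound)
  fix y assume T: "T \<in> bounded_ops"
  show "norm (adj T y) \<le> norm T * norm y"
  proof (cases "adj T y = 0")
    case False
    have "norm (adj T y) * norm (adj T y) = inner (T (adj T y)) y"
      by (simp add: inner_adj[OF T] flip: power2_eq_square power2_norm_eq_inner)
    also have "\<dots> \<le> norm (T (adj T y)) * norm y" by (rule norm_cauchy_schwarz)
    also have "\<dots> \<le> (norm T * norm (adj T y)) * norm y"
      by (intro mult_right_mono norm_blinfun) simp
    finally show ?thesis using False by (simp add: ac_simps)
  qed simp
qed simp

section \<open>Orthogonal projections\<close>

text \<open>Separated from \<open>projections A\<close>, so that being a projection and lying in the
  algebra can be argued independently.\<close>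

definition proj_op :: "('a::complex_hilbert_space \<Rightarrow>\<^sub>L 'a) \<Rightarrow> bool" where
  "proj_op P \<longleftrightarrow> P \<in> bounded_ops \<and> P o\<^sub>L P = P \<and> adj P = P"

lemma
  fixes P :: "'a::complex_hilbert_space \<Rightarrow>\<^sub>L 'a"
  assumes "proj_op P"
  shows proj_op_bounded_ops [simp]: "P \<in> bounded_ops"
    and proj_op_idem [simp]: "P (P x) = P x"
    and proj_op_adj [simp]: "adj P = P"
  using assms unfolding proj_op_def by (auto simp flip: blinfun_apply_blinfun_compose)

lemma inner_proj:
  fixes P :: "'a::complex_hilbert_space \<Rightarrow>\<^sub>L 'a"
  assumes "proj_op P"
  shows "inner (P x) y = inner x (P y)"
  using assms
  using inner_adj[of P x y] by simp

lemma proj_opI: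
  fixes P :: "'a::complex_hilbert_space \<Rightarrow>\<^sub>L 'a"
  assumes "P \<in> bounded_ops" "\<And>x. P (P x) = P x" "\<And>x y. inner (P x) y = inner x (P y)"
  shows "proj_op P"
  unfolding proj_op_def using assms(1) adj_eqI[OF assms(1,1,3)]
  by (auto intro: blinfun_eqI simp: assms(2))

lemma norm_proj_split:
  fixes P :: "'a::complex_hilbert_space \<Rightarrow>\<^sub>L 'a"
  assumes "proj_op P"
  shows "(norm x)\<^sup>2 = (norm (P x))\<^sup>2 + (norm (x - P x))\<^sup>2"
  using assms
  unfolding power2_norm_eq_inner
  by (simp add: inner_diff_left inner_diff_right inner_proj inner_commute)

lemma norm_proj_le:
  fixes P :: "'a::complex_hilbert_space \<Rightarrow>\<^sub>L 'a"
  assumes "proj_op P"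
  shows "norm (P x) \<le> norm x"
  by (rule power2_le_imp_le) (simp_all add: norm_proj_split[OF assms, of x])

lemma proj_op_compl: "proj_op P \<Longrightarrow> proj_op (id_blinfun - P)"
  by (intro proj_opI)
    (auto simp: blinfun.diff_left blinfun.diff_right inner_diff_left inner_diff_right inner_proj)

lemma range_proj_op:
  fixes P :: "'a::complex_hilbert_space \<Rightarrow>\<^sub>L 'a"
  assumes "proj_op P"
  shows "range P = {x. P x = x}"
  using assms
  by (auto simp: image_iff) metis

text \<open>The order \<open>Q \<le> P\<close> is expressed by \<open>P Q = Q\<close> throughout;
  this is the adjoint of that relation.\<close>

lemma proj_le_commute:
  fixes P Q :: "'a::complex_hilbert_space \<Rightarrow>\<^sub>L 'a"
  assumes "proj_op P" "proj_op Q" "\<And>x. P (Q x) = Q x"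
  shows "Q (P x) = Q x"
  by (rule inner_eqI) (simp add: inner_proj assms)

lemma proj_orth_commute:
  fixes P Q :: "'a::complex_hilbert_space \<Rightarrow>\<^sub>L 'a"
  assumes "proj_op P" "proj_op Q" "\<And>x. P (Q x) = 0"
  shows "Q (P x) = 0"
  by (rule inner_eqI) (simp add: inner_proj assms)

text \<open>The way to evaluate the definite description \<open>proj_onto\<close>. Two candidates
  differ at \<open>x\<close> by a vector that lies in \<open>L\<close> and is orthogonal to
  \<open>L\<close>.\<close>

lemma proj_ontoI:
  fixes P :: "'a::complex_hilbert_space \<Rightarrow>\<^sub>L 'a"
  assumes P: "proj_op P" and L: "range P = L"
  shows "proj_onto L = P"
  unfolding proj_onto_def
proof (rule the_equality)
  have "cinner (x - P x) (P y) = 0" for x y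
    using cinner_adj[of P "x - P x" y] P by (simp add: blinfun.diff_right)
  then show P': "P \<in> bounded_ops \<and> (\<forall>x. P x \<in> L \<and> (\<forall>y\<in>L. cinner (x - P x) y = 0))"
    using P L by auto
  fix Q :: "'a \<Rightarrow>\<^sub>L 'a"
  assume Q: "Q \<in> bounded_ops \<and> (\<forall>x. Q x \<in> L \<and> (\<forall>y\<in>L. cinner (x - Q x) y = 0))"
  show "Q = P"
  proof (rule blinfun_eqI)
    fix x
    have "Q x - P x = P (Q x - P x)"
      using P L Q by (auto simp: blinfun.diff_right range_proj_op)
    then have "Q x - P x \<in> L" using L by (metis rangeI)
    then have "cinner (x - P x) (Q x - P x) = 0" "cinner (x - Q x) (Q x - P x) = 0"
      using P' Q by blast+
    then have "cinner (Q x - P x) (Q x - P x) = 0"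
      by (simp add: cinner_diff_left)
    then show "Q x = P x" by (simp add: cinner_self)
  qed
qed

lemma
  assumes L: "closed L" "csubspace L"
  shows proj_op_proj_onto: "proj_op (proj_onto L)"
    and range_proj_onto: "range (proj_onto L) = L"
proof -
  note sub = csubspace_imp_subspace[OF L(2)]
  obtain p where pL: "\<And>x. p x \<in> L" and orth: "\<And>x y. y \<in> L \<Longrightarrow> inner (x - p x) y = 0"
    using closed_subspace_nearest_point[OF L(1) sub] by metis
  have corth: "cinner (x - p x) y = 0" if "y \<in> L" for x y
    using csubspace_cinner_zero_iff[OF L(2)] orth that by blast
  \<comment> \<open>The foot of the perpendicular is unique, and this alone makes the nearest-point
    map complex-linear.\<close>
  have uniq: "p x = q" if q: "q \<in> L" "\<And>y. y \<in> L \<Longrightarrow> cinner (x - q) y = 0" for x q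
  proof -
    have "p x - q \<in> L" using subspace_diff[OF sub pL q(1)] .
    then have "cinner (x - q) (p x - q) - cinner (x - p x) (p x - q) = 0" using q(2) corth by simp
    then have "cinner (p x - q) (p x - q) = 0" by (simp add: cinner_diff_left)
    then show ?thesis by (simp add: cinner_self)
  qed
  have add: "p (x + y) = p x + p y" for x y
  proof (rule uniq)
    show "cinner (x + y - (p x + p y)) z = 0" if "z \<in> L" for z
      using corth[OF that, of x] corth[OF that, of y]
      by (simp add: cinner_add_left cinner_diff_left algebra_simps)
  qed (intro subspace_add sub pL)
  have sC: "p (c *\<^sub>C x) = c *\<^sub>C p x" for c x
  proof (rule uniq)
    show "c *\<^sub>C p x \<in> L" using L(2) pL by (auto simp: csubspace_def)
    show "cinner (c *\<^sub>C x - c *\<^sub>C p x) y = 0" if "y \<in> L" for y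
      using corth[OF that, of x] by (simp add: cinner_scaleC_left flip: scaleC_diff_right)
  qed
  have id: "p x = x" if "x \<in> L" for x
    by (rule uniq) (use that in auto)
  have "norm (p x) \<le> norm x" for x
  proof (rule power2_le_imp_le)
    have "inner (x - p x) (p x) = 0" by (rule orth[OF pL])
    then have "(norm x)\<^sup>2 = (norm (p x))\<^sup>2 + (norm (x - p x))\<^sup>2"
      unfolding power2_norm_eq_inner
      by (simp add: inner_diff_left inner_diff_right inner_commute)
    then show "(norm (p x))\<^sup>2 \<le> (norm x)\<^sup>2" by simp
  qed simp
  then have "bounded_linear p"
    using sC[of "of_real _"] by (intro bounded_linear_intro[where K = 1] add) (auto simp: scaleC_of_real)
  then have app: "blinfun_apply (Blinfun p) = p" by (rule bounded_linear_Blinfun_apply)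
  have "inner (p x) y = inner x (p y)" for x y
    using orth[OF pL, of x y] orth[OF pL, of y x] by (simp add: inner_diff_left inner_diff_right inner_commute)
  then have P: "proj_op (Blinfun p)"
    by (intro proj_opI bounded_opsI) (auto simp: app sC id pL)
  have R: "range (Blinfun p) = L"
    unfolding app using pL id by (metis image_subset_iff rangeI subsetI subset_antisym)
  show "proj_op (proj_onto L)" "range (proj_onto L) = L"
    using proj_ontoI[OF P R] P R by auto
qed

lemma proj_onto_id_iff: "closed L \<Longrightarrow> csubspace L \<Longrightarrow> proj_onto L x = x \<longleftrightarrow> x \<in> L"
  by (metis (mono_tags, lifting) mem_Collect_eq range_proj_onto range_proj_op proj_op_proj_onto)

lemma proj_onto_zero_iff:
  assumes "closed L" "csubspace L"
  shows "proj_onto L x = 0 \<longleftrightarrow> (\<forall>y\<in>L. inner x y = 0)"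
proof -
  note P = proj_op_proj_onto[OF assms]
  have "proj_onto L x = 0 \<longleftrightarrow> (\<forall>z. inner (proj_onto L x) z = 0)"
    by (metis inner_eqI inner_zero_left)
  also have "\<dots> \<longleftrightarrow> (\<forall>z. inner x (proj_onto L z) = 0)"
    by (simp add: inner_proj[OF P])
  finally show ?thesis using range_proj_onto[OF assms] by (metis UNIV_I image_iff)
qed

section \<open>Ranges, kernels and partial isometries\<close>

lemma csubspace_range: "T \<in> bounded_ops \<Longrightarrow> csubspace (range (blinfun_apply T))"
  unfolding csubspace_def
  by (auto simp: image_iff) (metis blinfun.zero_right, metis blinfun.add_right, metis bounded_opsD)

lemma csubspace_closure:
  assumes "csubspace L"
  shows "csubspace (closure L)"
proof -
  have "c *\<^sub>C x \<in> closure L" if x: "x \<in> closure L" for c x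
  proof -
    obtain f where f: "\<forall>n::nat. f n \<in> L" "f \<longlonglongrightarrow> x"
      using x unfolding closure_sequential by blast
    have "(\<lambda>n. c *\<^sub>C f n) \<longlonglongrightarrow> c *\<^sub>C x"
      by (rule bounded_linear.tendsto[OF bounded_linear_scaleC f(2)])
    then show ?thesis
      unfolding closure_sequential using f(1) assms by (intro exI[of _ "\<lambda>n. c *\<^sub>C f n"]) (auto simp: csubspace_def)
  qed
  moreover have "x + y \<in> closure L" if x: "x \<in> closure L" and y: "y \<in> closure L" for x y
  proof -
    obtain f g where f: "\<forall>n::nat. f n \<in> L" "f \<longlonglongrightarrow> x" and g: "\<forall>n::nat. g n \<in> L" "g \<longlonglongrightarrow> y"
      using x y unfolding closure_sequential by blast
    then show ?thesis
      using tendsto_add[OF f(2) g(2)] assms unfolding closure_sequential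
      by (intro exI[of _ "\<lambda>n. f n + g n"]) (auto simp: csubspace_def)
  qed
  moreover have "0 \<in> closure L"
    using assms closure_subset unfolding csubspace_def by blast
  ultimately show ?thesis
    unfolding csubspace_def by blast
qed

lemma closed_kernel: "closed {x. blinfun_apply T x = 0}"
  by (intro closed_Collect_eq continuous_intros)

lemma csubspace_kernel: "T \<in> bounded_ops \<Longrightarrow> csubspace {x. blinfun_apply T x = 0}"
  unfolding csubspace_def by (auto simp: blinfun.zero_right blinfun.add_right bounded_opsD)

text \<open>A vector is orthogonal to the range of \<open>adj T\<close> exactly when its image under
  \<open>T\<close> is orthogonal to everything. Facts about range projections thereby transfer to
  kernels.\<close>

lemma proj_onto_kernel:
  fixes T :: "'a::complex_hilbert_space \<Rightarrow>\<^sub>L 'a"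
  assumes T: "T \<in> bounded_ops"
  shows "proj_onto {x. T x = 0} = id_blinfun - proj_onto (closure (range (adj T)))"
proof (rule proj_ontoI)
  let ?L = "closure (range (adj T))"
  have L: "closed ?L" "csubspace ?L"
    using T by (simp_all add: csubspace_closure csubspace_range)
  note P = proj_op_proj_onto[OF L]
  show "proj_op (id_blinfun - proj_onto ?L)"
    by (rule proj_op_compl[OF P])
  have "proj_onto ?L x = 0 \<longleftrightarrow> T x = 0" for x
  proof -
    have "(\<forall>y\<in>?L. inner x y = 0) \<longleftrightarrow> (\<forall>z. inner x (adj T z) = 0)" (is "?l \<longleftrightarrow> ?r")
    proof
      show ?l if ?r
      proof
        fix y assume "y \<in> ?L"
        moreover have "closed {y. inner x y = 0}"
          by (intro closed_Collect_eq continuous_intros)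
        then have "?L \<subseteq> {y. inner x y = 0}"
          using that by (intro closure_minimal) auto
        ultimately show "inner x y = 0" by blast
      qed
      show ?r if ?l
        using that closure_subset[of "range (adj T)"] by blast
    qed
    also have "\<dots> \<longleftrightarrow> (\<forall>z. inner (T x) z = 0)"
      by (simp add: inner_adj[OF T])
    also have "\<dots> \<longleftrightarrow> T x = 0"
      by (metis inner_eqI inner_zero_left)
    finally show ?thesis by (simp add: proj_onto_zero_iff[OF L])
  qed
  then show "range (id_blinfun - proj_onto ?L) = {x. T x = 0}"
    by (subst range_proj_op[OF proj_op_compl[OF P]]) (simp add: blinfun.diff_left)
qed

text \<open>The square of the norm of \<open>V y\<close> is \<open>inner y (P y)\<close>, so
  \<open>V\<close> vanishes on the complement of \<open>P\<close>. The other two facts follow from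
  \<open>V P = V\<close>.\<close>

lemma
  fixes V P :: "'a::complex_hilbert_space \<Rightarrow>\<^sub>L 'a"
  assumes V: "V \<in> bounded_ops" and P: "proj_op P" and VP: "adj V o\<^sub>L V = P"
  shows partial_isometry_initial: "V (P x) = V x"
    and partial_isometry_proj_op: "proj_op (V o\<^sub>L adj V)"
    and partial_isometry_range: "range (V o\<^sub>L adj V) = range V"
proof -
  have VPx: "adj V (V x) = P x" for x
    using VP by (metis blinfun_apply_blinfun_compose)
  have *: "V (P x) = V x" for x
  proof -
    have "inner (V (x - P x)) (V (x - P x)) = inner (x - P x) (P (x - P x))"
      by (simp add: inner_adj[OF V] VPx)
    also have "\<dots> = 0" using P by (simp add: blinfun.diff_right)
    finally show ?thesis by (simp add: blinfun.diff_right)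
  qed
  then show "V (P x) = V x" .
  show "proj_op (V o\<^sub>L adj V)"
    using V by (intro proj_opI) (simp_all add: VPx *, metis inner_adj inner_adj')
  show "range (V o\<^sub>L adj V) = range V"
    using VPx * by (auto simp: image_iff) metis
qed

lemma csubspace_fst_snd_image:
  fixes \<Gamma> :: "('a::complex_hilbert_space \<times> 'b::complex_hilbert_space) set"
  assumes zero: "(0, 0) \<in> \<Gamma>"
    and add: "\<And>p q. p \<in> \<Gamma> \<Longrightarrow> q \<in> \<Gamma> \<Longrightarrow> p + q \<in> \<Gamma>"
    and scale: "\<And>c u w. (u, w) \<in> \<Gamma> \<Longrightarrow> (c *\<^sub>C u, c *\<^sub>C w) \<in> \<Gamma>"
  shows "csubspace (fst ` \<Gamma>)" and "csubspace (snd ` \<Gamma>)"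
proof -
  show "csubspace (fst ` \<Gamma>)"
    unfolding csubspace_def
  proof (intro conjI ballI allI)
    show "0 \<in> fst ` \<Gamma>" using zero by force
    fix x assume "x \<in> fst ` \<Gamma>"
    then obtain w where x: "(x, w) \<in> \<Gamma>" by force
    then show "c *\<^sub>C x \<in> fst ` \<Gamma>" for c using scale[OF x, of c] by force
    fix y assume "y \<in> fst ` \<Gamma>"
    then obtain z where "(y, z) \<in> \<Gamma>" by force
    then show "x + y \<in> fst ` \<Gamma>" using add[OF x] by force
  qed
  show "csubspace (snd ` \<Gamma>)"
    unfolding csubspace_def
  proof (intro conjI ballI allI)
    show "0 \<in> snd ` \<Gamma>" using zero by force
    fix x assume "x \<in> snd ` \<Gamma>"
    then obtain w where x: "(w, x) \<in> \<Gamma>" by force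
    then show "c *\<^sub>C x \<in> snd ` \<Gamma>" for c using scale[OF x, of c] by force
    fix y assume "y \<in> snd ` \<Gamma>"
    then obtain z where "(z, y) \<in> \<Gamma>" by force
    then show "x + y \<in> snd ` \<Gamma>" using add[OF x] by force
  qed
qed

section \<open>Von Neumann algebras\<close>

lemma projections_iff: "A \<subseteq> bounded_ops \<Longrightarrow> P \<in> projections A \<longleftrightarrow> P \<in> A \<and> proj_op P"
  unfolding projections_def proj_op_def by blast

section \<open>Membership in a von Neumann algebra and polar decomposition\<close>

locale vn_algebra =
  fixes A :: "('a::complex_hilbert_space \<Rightarrow>\<^sub>L 'a) set"
  assumes vn: "von_neumann_algebra A"
begin

lemma bicommutant: "commutant (commutant A) = A"
  using vn by (simp add: von_neumann_algebra_def)

lemma star: "star_subalgebra A"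
  using vn by (simp add: von_neumann_algebra_def)

lemma A_bounded_ops [simp]: "T \<in> A \<Longrightarrow> T \<in> bounded_ops"
  using star by (auto simp: star_subalgebra_def)

lemma A_add [simp]: "S \<in> A \<Longrightarrow> T \<in> A \<Longrightarrow> S + T \<in> A"
  and A_compose [simp]: "S \<in> A \<Longrightarrow> T \<in> A \<Longrightarrow> S o\<^sub>L T \<in> A"
  and A_adj [simp]: "T \<in> A \<Longrightarrow> adj T \<in> A"
  using star by (auto simp: star_subalgebra_def)

lemma A_scaleR [simp]: "T \<in> A \<Longrightarrow> r *\<^sub>R T \<in> A"
proof -
  assume "T \<in> A"
  then have "scalar_op (of_real r) o\<^sub>L T \<in> A"
    using star by (auto simp: star_subalgebra_def)
  moreover have "scalar_op (of_real r) o\<^sub>L T = r *\<^sub>R T"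
    by (rule blinfun_eqI) (simp add: scaleC_of_real blinfun.scaleR_left)
  ultimately show ?thesis by simp
qed

lemma A_diff [simp]: "S \<in> A \<Longrightarrow> T \<in> A \<Longrightarrow> S - T \<in> A"
  using A_add[of S "(-1) *\<^sub>R T"] A_scaleR[of T "-1"] by simp

lemma A_commute: "T \<in> A \<Longrightarrow> B \<in> commutant A \<Longrightarrow> B (T x) = T (B x)"
  unfolding commutant_def by (metis (mono_tags, lifting) blinfun_apply_blinfun_compose mem_Collect_eq)

lemma commutant_bounded_ops: "B \<in> commutant A \<Longrightarrow> B \<in> bounded_ops"
  by (simp add: commutant_def)

text \<open>The bicommutant condition as an introduction rule: it admits to \<open>A\<close> the
  operators that arise from limits, closures, choices or contour integrals.\<close>

lemma A_memI:
  assumes "T \<in> bounded_ops" "\<And>B x. B \<in> commutant A \<Longrightarrow> T (B x) = B (T x)"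
  shows "T \<in> A"
proof -
  have "T \<in> commutant (commutant A)"
    unfolding commutant_def[of "commutant A"] using assms by (auto intro: blinfun_eqI)
  then show ?thesis by (simp add: bicommutant)
qed

lemma A_id [simp]: "id_blinfun \<in> A"
  by (rule A_memI) auto

lemma commutant_adj:
  assumes B: "B \<in> commutant A"
  shows "adj B \<in> commutant A"
proof -
  note B' = commutant_bounded_ops[OF B]
  have "adj B (T x) = T (adj B x)" if "T \<in> A" for T x
  proof (rule inner_eqI)
    fix z
    have "inner (adj B (T x)) z = inner x (adj T (B z))"
      using that by (simp add: inner_adj'[OF B'] inner_adj)
    also have "\<dots> = inner (T (adj B x)) z"
      using that A_commute[OF A_adj[OF that] B, symmetric] by (simp add: inner_adj'[OF B'] inner_adj)
    finally show "inner (adj B (T x)) z = inner (T (adj B x)) z" .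
  qed
  then show ?thesis
    unfolding commutant_def using B' by (auto intro: blinfun_eqI)
qed

lemma A_closed:
  assumes "\<And>n. Y n \<in> A" "Y \<longlonglongrightarrow> T"
  shows "T \<in> A"
proof (rule A_memI)
  have lim: "(\<lambda>n. Y n x) \<longlonglongrightarrow> T x" for x
    by (intro blinfun.tendsto assms tendsto_const)
  show "T \<in> bounded_ops"
  proof (rule bounded_opsI)
    fix c x
    have "(\<lambda>n. Y n (c *\<^sub>C x)) \<longlonglongrightarrow> c *\<^sub>C T x"
      using bounded_linear.tendsto[OF bounded_linear_scaleC lim, of c x]
      by (simp add: bounded_opsD[OF A_bounded_ops[OF assms(1)]])
    then show "T (c *\<^sub>C x) = c *\<^sub>C T x" by (rule LIMSEQ_unique[OF lim])
  qed
  fix B x assume B: "B \<in> commutant A"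
  have "(\<lambda>n. Y n (B x)) \<longlonglongrightarrow> B (T x)"
    using blinfun.tendsto[OF tendsto_const lim, of B x] by (simp add: A_commute[OF assms(1) B])
  then show "T (B x) = B (T x)" by (rule LIMSEQ_unique[OF lim])
qed

text \<open>Invariance under \<open>B\<close> says \<open>P B P = B P\<close>; invariance under
  \<open>adj B\<close> says, after taking adjoints, \<open>P B P = P B\<close>.\<close>

lemma proj_commute_if_invariant:
  fixes P B :: "'a \<Rightarrow>\<^sub>L 'a"
  assumes P: "proj_op P" and B: "B \<in> bounded_ops"
    and inv: "\<And>x. P (B (P x)) = B (P x)" "\<And>x. P (adj B (P x)) = adj B (P x)"
  shows "P (B x) = B (P x)"
proof (rule inner_eqI)
  fix z
  have "inner (P (B x)) z = inner x (P (adj B (P z)))"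
    by (simp add: inner_proj[OF P] inner_adj[OF B] inv)
  also have "\<dots> = inner (P (B (P x))) z"
    by (simp add: inner_proj[OF P] inner_adj[OF B])
  finally show "inner (P (B x)) z = inner (B (P x)) z" by (simp add: inv)
qed

lemma proj_onto_in_A:
  assumes L: "closed L" "csubspace L" and inv: "\<And>B x. B \<in> commutant A \<Longrightarrow> x \<in> L \<Longrightarrow> B x \<in> L"
  shows "proj_onto L \<in> A"
proof (rule A_memI)
  note P = proj_op_proj_onto[OF L]
  show "proj_onto L \<in> bounded_ops" using P by simp
  have *: "proj_onto L (B (proj_onto L x)) = B (proj_onto L x)" if "B \<in> commutant A" for B x
    using inv[OF that, of "proj_onto L x"] range_proj_onto[OF L]
    by (simp add: proj_onto_id_iff[OF L]) blast
  show "proj_onto L (B x) = B (proj_onto L x)" if "B \<in> commutant A" for B x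
    by (intro proj_commute_if_invariant P commutant_bounded_ops that * commutant_adj)
qed

lemma closure_invariant:
  fixes B :: "'a \<Rightarrow>\<^sub>L 'a"
  assumes "\<And>x. x \<in> L \<Longrightarrow> B x \<in> L" "x \<in> closure L"
  shows "B x \<in> closure L"
proof -
  have "blinfun_apply B ` closure L \<subseteq> closure L"
    using assms(1) closure_subset[of L]
    by (intro image_closure_subset) (auto intro!: continuous_intros)
  then show ?thesis using assms(2) by blast
qed

lemma proj_onto_closure_range_in_A:
  assumes "T \<in> A"
  shows "proj_onto (closure (range T)) \<in> A"
proof (rule proj_onto_in_A)
  show "csubspace (closure (range T))" using assms by (intro csubspace_closure csubspace_range) simp
  show "B x \<in> closure (range T)" if "B \<in> commutant A" "x \<in> closure (range T)" for B x
    by (rule closure_invariant[OF _ that(2)]) (auto simp: A_commute[OF assms that(1)])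
qed simp

lemma proj_onto_kernel_in_A:
  assumes "T \<in> A"
  shows "proj_onto {x. T x = 0} \<in> A"
  using assms A_diff[OF A_id proj_onto_closure_range_in_A[OF A_adj[OF assms]]]
  by (simp add: proj_onto_kernel)

text \<open>The closure of \<open>\<Gamma>\<close> is the graph of \<open>V\<close> on its initial space.\<close>

lemma partial_isometry_of_graph:
  fixes \<Gamma> :: "('a \<times> 'a) set"
  assumes zero: "(0, 0) \<in> \<Gamma>"
    and add: "\<And>p q. p \<in> \<Gamma> \<Longrightarrow> q \<in> \<Gamma> \<Longrightarrow> p + q \<in> \<Gamma>"
    and scale: "\<And>c u w. (u, w) \<in> \<Gamma> \<Longrightarrow> (c *\<^sub>C u, c *\<^sub>C w) \<in> \<Gamma>"
    and iso: "\<And>u w. (u, w) \<in> \<Gamma> \<Longrightarrow> norm u = norm w"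
    and inv: "\<And>B u w. B \<in> commutant A \<Longrightarrow> (u, w) \<in> \<Gamma> \<Longrightarrow> (B u, B w) \<in> \<Gamma>"
  obtains V where "V \<in> A" "adj V o\<^sub>L V = proj_onto (closure (fst ` \<Gamma>))"
    "V o\<^sub>L adj V = proj_onto (closure (snd ` \<Gamma>))" "\<And>u w. (u, w) \<in> \<Gamma> \<Longrightarrow> V u = w"
proof -
  have map': "(B u, B w) \<in> closure \<Gamma>"
    if "(u, w) \<in> closure \<Gamma>" "\<And>u w. (u, w) \<in> \<Gamma> \<Longrightarrow> (B u, B w) \<in> \<Gamma>" for B :: "'a \<Rightarrow>\<^sub>L 'a" and u w
  proof -
    have "(\<lambda>p. (B (fst p), B (snd p))) ` closure \<Gamma> \<subseteq> closure \<Gamma>"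
      using that(2) closure_subset[of \<Gamma>]
      by (intro image_closure_subset) (auto intro!: continuous_intros)
    then show ?thesis using that(1) by force
  qed
  have add': "p + q \<in> closure \<Gamma>" if "p \<in> closure \<Gamma>" "q \<in> closure \<Gamma>" for p q
  proof -
    have "(\<lambda>z. fst z + snd z) ` closure (\<Gamma> \<times> \<Gamma>) \<subseteq> closure \<Gamma>"
      using add closure_subset[of \<Gamma>]
      by (intro image_closure_subset) (auto intro!: continuous_intros)
    then show ?thesis using that by (force simp: closure_Times)
  qed
  have scale': "(c *\<^sub>C u, c *\<^sub>C w) \<in> closure \<Gamma>" if "(u, w) \<in> closure \<Gamma>" for c u w
    using map'[OF that, of "scalar_op c"] scale by simp
  have neg: "(- u, - w) \<in> \<Gamma>" if "(u, w) \<in> \<Gamma>" for u w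
    using scale[OF that, of "-1"] scaleC_of_real[of "-1" u] scaleC_of_real[of "-1" w] by simp
  have neg': "(- u, - w) \<in> closure \<Gamma>" if "(u, w) \<in> closure \<Gamma>" for u w
    using scale'[OF that, of "-1"] scaleC_of_real[of "-1" u] scaleC_of_real[of "-1" w] by simp
  have diff: "(u - u', w - w') \<in> \<Gamma>" if "(u, w) \<in> \<Gamma>" "(u', w') \<in> \<Gamma>" for u w u' w'
    using add[OF that(1) neg[OF that(2)]] by simp
  have diff': "(u - u', w - w') \<in> closure \<Gamma>" if "(u, w) \<in> closure \<Gamma>" "(u', w') \<in> closure \<Gamma>" for u w u' w'
    using add'[OF that(1) neg'[OF that(2)]] by simp
  have iso': "norm u = norm w" if "(u, w) \<in> closure \<Gamma>" for u w
  proof -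
    have "closed {p :: 'a \<times> 'a. norm (fst p) = norm (snd p)}"
      by (intro closed_Collect_eq continuous_intros)
    then have "closure \<Gamma> \<subseteq> {p. norm (fst p) = norm (snd p)}"
      using iso by (intro closure_minimal) auto
    then show ?thesis using that by auto
  qed
  \<comment> \<open>The closure is still the graph of a function: the difference of the two pairs
    has first component 0, hence also second component 0.\<close>
  have uniq: "w = w'" if "(u, w) \<in> closure \<Gamma>" "(u, w') \<in> closure \<Gamma>" for u w w'
    using iso'[OF diff'[OF that]] by simp
  \<comment> \<open>Pairs have equal norms, so convergence in one component forces it in the other.
    This makes the closed graph project onto the full closures of both sides, in \<open>dom\<close>
    and \<open>ran\<close>.\<close>
  have limit: "\<exists>b. g \<longlonglongrightarrow> b" if "f \<longlonglongrightarrow> a" "\<And>m n. norm (f m - f n) = norm (g m - g n)"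
    for f g :: "nat \<Rightarrow> 'a" and a
  proof -
    have "Cauchy g"
      using LIMSEQ_imp_Cauchy[OF that(1)] that(2) by (simp add: Cauchy_def dist_norm)
    then show ?thesis using Cauchy_convergent_iff convergent_def by blast
  qed
  have dom: "\<exists>w. (u, w) \<in> closure \<Gamma>" if u: "u \<in> closure (fst ` \<Gamma>)" for u
  proof -
    obtain f where f: "\<forall>n::nat. f n \<in> fst ` \<Gamma>" "f \<longlonglongrightarrow> u"
      using u unfolding closure_sequential by blast
    then have "\<forall>n. \<exists>w. (f n, w) \<in> \<Gamma>" by fastforce
    then obtain g where g: "\<And>n. (f n, g n) \<in> \<Gamma>" by metis
    then obtain w where "g \<longlonglongrightarrow> w"
      using limit[OF f(2), of g] iso[OF diff[OF g g]] by blast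
    then have "(\<lambda>n. (f n, g n)) \<longlonglongrightarrow> (u, w)" using f(2) by (intro tendsto_Pair)
    then have "(u, w) \<in> closure \<Gamma>"
      unfolding closure_sequential using g by (intro exI[of _ "\<lambda>n. (f n, g n)"]) simp
    then show ?thesis by blast
  qed
  have ran: "\<exists>u. (u, w) \<in> closure \<Gamma>" if w: "w \<in> closure (snd ` \<Gamma>)" for w
  proof -
    obtain g where g: "\<forall>n::nat. g n \<in> snd ` \<Gamma>" "g \<longlonglongrightarrow> w"
      using w unfolding closure_sequential by blast
    then have "\<forall>n. \<exists>u. (u, g n) \<in> \<Gamma>" by fastforce
    then obtain f where f: "\<And>n. (f n, g n) \<in> \<Gamma>" by metis
    then obtain u where "f \<longlonglongrightarrow> u"
      using limit[OF g(2), of f] iso[OF diff[OF f f], symmetric] by blast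
    then have "(\<lambda>n. (f n, g n)) \<longlonglongrightarrow> (u, w)" using g(2) by (intro tendsto_Pair)
    then have "(u, w) \<in> closure \<Gamma>"
      unfolding closure_sequential using f by (intro exI[of _ "\<lambda>n. (f n, g n)"]) simp
    then show ?thesis by blast
  qed
  have fst': "u \<in> closure (fst ` \<Gamma>)" "w \<in> closure (snd ` \<Gamma>)" if "(u, w) \<in> closure \<Gamma>" for u w
  proof -
    have "fst ` closure \<Gamma> \<subseteq> closure (fst ` \<Gamma>)" "snd ` closure \<Gamma> \<subseteq> closure (snd ` \<Gamma>)"
      by (intro image_closure_subset continuous_intros closed_closure closure_subset)+
    with that show "u \<in> closure (fst ` \<Gamma>)" "w \<in> closure (snd ` \<Gamma>)" by force+
  qed
  note sub = csubspace_fst_snd_image[OF zero add scale]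
  define L where "L = closure (fst ` \<Gamma>)"
  define P where "P = proj_onto L"
  have L: "closed L" "csubspace L" unfolding L_def using sub by (auto intro: csubspace_closure)
  have P: "proj_op P" and rP: "range P = L"
    unfolding P_def by (intro proj_op_proj_onto range_proj_onto L)+
  have PA: "P \<in> A"
    unfolding P_def
  proof (rule proj_onto_in_A[OF L])
    show "B x \<in> L" if "B \<in> commutant A" "x \<in> L" for B x
      unfolding L_def using inv[OF that(1)]
      by (intro closure_invariant[OF _ that(2)[unfolded L_def]]) (force simp: image_iff)
  qed
  \<comment> \<open>Composing with \<open>P\<close> extends the isometry by 0 on the orthogonal
    complement of its domain.\<close>
  have "\<exists>w. (P x, w) \<in> closure \<Gamma>" for x
    using dom rP unfolding L_def by blast
  then obtain v where v: "\<And>x. (P x, v x) \<in> closure \<Gamma>" by metis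
  have nv: "norm (v x) = norm (P x)" for x using iso'[OF v] by simp
  have vadd: "v (x + y) = v x + v y" for x y
    using uniq[OF v[of "x + y"]] add'[OF v[of x] v[of y]] by (simp add: blinfun.add_right)
  have vC: "v (c *\<^sub>C x) = c *\<^sub>C v x" for c x
    using uniq[OF v[of "c *\<^sub>C x"]] scale'[OF v[of x], of c] PA by (simp add: bounded_opsD)
  have vlin: "bounded_linear v"
    using vC[of "of_real _"] nv norm_proj_le[OF P]
    by (intro bounded_linear_intro[where K = 1] vadd) (auto simp: scaleC_of_real)
  have V: "blinfun_apply (Blinfun v) = v" using vlin by (rule bounded_linear_Blinfun_apply)
  define V where "V = Blinfun v"
  have V: "blinfun_apply V = v" using V by (simp add: V_def)
  have VB: "V \<in> bounded_ops" by (intro bounded_opsI) (simp add: V vC)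
  have VA: "V \<in> A"
  proof (rule A_memI[OF VB])
    fix B x assume B: "B \<in> commutant A"
    have "(P (B x), B (v x)) \<in> closure \<Gamma>"
      using map'[OF v[of x], of B] inv[OF B] by (simp add: A_commute[OF PA B])
    then show "V (B x) = B (V x)" unfolding V by (rule uniq[OF v])
  qed
  have VVP: "adj V o\<^sub>L V = P"
  proof (rule blinfun_eqI, rule inner_eqI)
    fix x y
    have "inner (V x) (V y) = inner (P x) (P y)"
      unfolding V
      by (rule inner_eq_if_norm_eq[OF bounded_linear.linear[OF vlin]
            bounded_linear.linear[OF blinfun.bounded_linear_right] nv])
    then show "inner ((adj V o\<^sub>L V) x) y = inner (P x) y"
      using P by (simp add: inner_adj'[OF VB] inner_proj)
  qed
  have Vuw: "V u = w" if "(u, w) \<in> closure \<Gamma>" for u w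
  proof -
    have "P u = u"
      using fst'(1)[OF that] unfolding P_def L_def[symmetric] by (simp add: proj_onto_id_iff[OF L])
    then show ?thesis using uniq[OF v[of u]] that by (simp add: V)
  qed
  have "range (V o\<^sub>L adj V) = closure (snd ` \<Gamma>)"
    unfolding partial_isometry_range[OF VB P VVP]
  proof
    show "range V \<subseteq> closure (snd ` \<Gamma>)" unfolding V using fst'(2)[OF v] by blast
    show "closure (snd ` \<Gamma>) \<subseteq> range V" using ran Vuw by blast
  qed
  then have "V o\<^sub>L adj V = proj_onto (closure (snd ` \<Gamma>))"
    by (rule proj_ontoI[OF partial_isometry_proj_op[OF VB P VVP], symmetric])
  with VA VVP Vuw closure_subset[of \<Gamma>] show ?thesis
    by (intro that[of V]) (auto simp: P_def L_def)
qed

text \<open>The square root of \<open>1 - X\<close> is \<open>1 - Y\<close>, where \<open>Y\<close> is the limit of the iteration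
  \<open>Y \<mapsto> (X + Y\<^sup>2) / 2\<close>; its increments are dominated by those of the scalar iteration with \<open>X = 1\<close>.\<close>

lemma square_root:
  assumes XA: "X \<in> A" and sa: "adj X = X" and X1: "norm X \<le> 1"
  obtains S where "S \<in> A" "adj S = S" "S o\<^sub>L S = id_blinfun - X"
proof -
  define Y where "Y n = ((\<lambda>Y. (1/2) *\<^sub>R (X + (Y o\<^sub>L Y))) ^^ n) 0" for n
  define y where "y n = ((\<lambda>y. (1/2) * (1 + y * y)) ^^ n) (0::real)" for n
  have Y0: "Y 0 = 0" and YS: "Y (Suc n) = (1/2) *\<^sub>R (X + (Y n o\<^sub>L Y n))" for n
    by (simp_all add: Y_def)
  have y0: "y 0 = 0" and yS: "y (Suc n) = (1/2) * (1 + y n * y n)" for n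
    by (simp_all add: y_def)
  have YA: "Y n \<in> A" for n
  proof (induction n)
    case 0
    have "0 *\<^sub>R id_blinfun \<in> A" by (intro A_scaleR A_id)
    then show ?case by (simp add: Y0)
  qed (simp add: YS XA)
  have Ysa: "inner (Y n x) z = inner x (Y n z)" for n x z
  proof (induction n arbitrary: x z)
    case (Suc n)
    have "inner (X x) z = inner x (X z)" using inner_adj[of X x z] XA sa by simp
    then show ?case
      by (simp add: YS blinfun.scaleR_left blinfun.add_left inner_add_left inner_add_right Suc)
  qed (simp add: Y0)
  have comm: "Y n (B x) = B (Y n x)" if "\<And>x. X (B x) = B (X x)" for B :: "'a \<Rightarrow>\<^sub>L 'a" and n x
  proof (induction n arbitrary: x)
    case (Suc n)
    show ?case
      by (simp add: YS blinfun.scaleR_left blinfun.add_left blinfun.scaleR_right blinfun.add_right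
          that Suc)
  qed (simp add: Y0 blinfun.zero_right)
  \<comment> \<open>\<open>Y m\<close> commutes with \<open>X\<close> (take \<open>B = X\<close>),
    hence with every \<open>Y n\<close> (take \<open>B = Y m\<close>).\<close>
  have YY: "Y n (Y m x) = Y m (Y n x)" for m n x
    by (rule comm) (rule comm[symmetric], rule refl)
  have yb: "0 \<le> y n \<and> y n \<le> 1" for n
  proof (induction n)
    case (Suc n)
    then have "y n * y n \<le> 1" by (intro mult_le_one) auto
    then show ?case by (simp add: yS)
  qed (simp add: y0)
  have Yn: "norm (Y n) \<le> y n" for n
  proof (induction n)
    case (Suc n)
    have "norm (Y (Suc n)) \<le> (1/2) * (norm X + norm (Y n o\<^sub>L Y n))"
      by (simp add: YS norm_triangle_ineq)
    also have "norm (Y n o\<^sub>L Y n) \<le> y n * y n"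
      by (rule order_trans[OF norm_blinfun_compose]) (intro mult_mono Suc; simp add: yb)
    finally show ?case using X1 by (simp add: yS)
  qed (simp add: Y0 y0)
  have step: "norm (Y (Suc n) - Y n) \<le> y (Suc n) - y n" for n
  proof (induction n)
    case 0
    show ?case using X1 by (simp add: YS yS Y0 y0)
  next
    case (Suc n)
    \<comment> \<open>A difference of squares, since the iterates commute. The scalar iteration
      factors in the same way, so the domination of increments propagates.\<close>
    have "Y (Suc (Suc n)) - Y (Suc n) = (1/2) *\<^sub>R ((Y (Suc n) + Y n) o\<^sub>L (Y (Suc n) - Y n))"
      (is "?D = (1/2) *\<^sub>R ?E")
    proof (rule blinfun_eqI)
      fix x
      have "?D x = (1/2) *\<^sub>R (X x + Y (Suc n) (Y (Suc n) x)) - (1/2) *\<^sub>R (X x + Y n (Y n x))"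
        unfolding blinfun.diff_left
        by (subst (1) YS, subst (2) YS) (simp add: blinfun.scaleR_left blinfun.add_left)
      then show "?D x = ((1/2) *\<^sub>R ?E) x"
        by (simp add: blinfun.scaleR_left blinfun.add_left blinfun.diff_left blinfun.diff_right
            YY[of n "Suc n"] scaleR_right_diff_distrib scaleR_right_distrib)
    qed
    then have "norm ?D \<le> (1/2) * (norm (Y (Suc n) + Y n) * norm (Y (Suc n) - Y n))"
      by (simp add: norm_blinfun_compose)
    also have "\<dots> \<le> (1/2) * ((y (Suc n) + y n) * (y (Suc n) - y n))"
      by (intro mult_left_mono mult_mono Suc norm_triangle_le add_mono Yn)
        (simp_all add: yb add_nonneg_nonneg)
    also have "\<dots> = y (Suc (Suc n)) - y (Suc n)"
      by (subst (3) yS, subst (4) yS) (simp add: algebra_simps)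
    finally show ?case .
  qed
  have steps: "norm (Y n - Y m) \<le> y n - y m" if "m \<le> n" for m n
    using that
  proof (induction n rule: dec_induct)
    case (step k)
    then show ?case
      using norm_triangle_ineq[of "Y (Suc k) - Y k" "Y k - Y m"] \<open>norm (Y k - Y m) \<le> _\<close>
        \<open>\<And>n. norm (Y (Suc n) - Y n) \<le> _\<close>[of k] by simp
  qed simp
  have "incseq y"
    using step by (intro incseq_SucI) (meson diff_ge_0_iff_ge norm_ge_zero order_trans)
  then have "Cauchy y"
    using yb by (metis incseq_convergent LIMSEQ_imp_Cauchy)
  have "Cauchy Y"
  proof (rule metric_CauchyI)
    fix e :: real assume "e > 0"
    then obtain M where M: "\<And>m n. m \<ge> M \<Longrightarrow> n \<ge> M \<Longrightarrow> norm (y m - y n) < e"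
      using CauchyD[OF \<open>Cauchy y\<close>] by blast
    have "dist (Y m) (Y n) < e" if "m \<ge> M" "n \<ge> M" for m n
      using steps[of m n] steps[of n m] M[OF that]
      by (cases "m \<le> n") (auto simp: dist_norm norm_minus_commute)
    then show "\<exists>M. \<forall>m\<ge>M. \<forall>n\<ge>M. dist (Y m) (Y n) < e" by blast
  qed
  then obtain Z where Z: "Y \<longlonglongrightarrow> Z"
    using Cauchy_convergent_iff convergent_def by blast
  have ZA: "Z \<in> A" by (rule A_closed[OF YA Z])
  have lim: "(\<lambda>n. Y n x) \<longlonglongrightarrow> Z x" for x
    by (intro blinfun.tendsto Z tendsto_const)
  have Zsa: "inner (Z x) z = inner x (Z z)" for x z
  proof (rule LIMSEQ_unique)
    show "(\<lambda>n. inner (Y n x) z) \<longlonglongrightarrow> inner (Z x) z" by (intro tendsto_intros lim)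
    show "(\<lambda>n. inner (Y n x) z) \<longlonglongrightarrow> inner x (Z z)" unfolding Ysa by (intro tendsto_intros lim)
  qed
  have "Z = (1/2) *\<^sub>R (X + (Z o\<^sub>L Z))"
  proof (rule LIMSEQ_unique)
    show "(\<lambda>n. Y (Suc n)) \<longlonglongrightarrow> Z" by (rule LIMSEQ_Suc[OF Z])
    show "(\<lambda>n. Y (Suc n)) \<longlonglongrightarrow> (1/2) *\<^sub>R (X + (Z o\<^sub>L Z))"
      unfolding YS by (intro tendsto_intros Z)
  qed
  then have "Z x = (1/2) *\<^sub>R (X x + Z (Z x))" for x
    by (metis blinfun.add_left blinfun.scaleR_left blinfun_apply_blinfun_compose)
  \<comment> \<open>The fixed point equation \<open>2 Z = X + Z\<^sup>2\<close> rearranges to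
    \<open>(1 - Z)\<^sup>2 = 1 - X\<close>.\<close>
  then have eq: "Z x + Z x = X x + Z (Z x)" for x
    by (metis scaleR_half_double scaleR_right_distrib)
  show ?thesis
  proof (rule that[of "id_blinfun - Z"])
    show "id_blinfun - Z \<in> A" using ZA by simp
    show "adj (id_blinfun - Z) = id_blinfun - Z"
      using ZA by (intro adj_eqI) (auto simp: blinfun.diff_left inner_diff_left inner_diff_right Zsa)
    show "(id_blinfun - Z) o\<^sub>L (id_blinfun - Z) = id_blinfun - X"
    proof (rule blinfun_eqI)
      show "((id_blinfun - Z) o\<^sub>L (id_blinfun - Z)) x = (id_blinfun - X) x" for x
        using eq[of x] by (simp add: blinfun.diff_left blinfun.diff_right algebra_simps)
    qed
  qed
qed

text \<open>Polar decomposition. If \<open>S\<close> is the square root of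
  \<open>adj R o\<^sub>L R\<close> for a rescaled \<open>R\<close>, then \<open>S x\<close> and
  \<open>R x\<close> have equal norms, so the pairs \<open>(S x, R x)\<close> define a partial
  isometry from the closed range of \<open>S\<close>, which is the complement of the kernel, onto
  that of \<open>R\<close>.\<close>

lemma support_equivalence:
  assumes TA: "T \<in> A"
  obtains V where "V \<in> A" "adj V o\<^sub>L V = id_blinfun - proj_onto {x. T x = 0}"
    "V o\<^sub>L adj V = proj_onto (closure (range T))"
proof -
  \<comment> \<open>The added 1 keeps the factor finite for \<open>T = 0\<close>; the scaling brings
    \<open>R\<close> into the unit ball.\<close>
  define c where "c = inverse (norm T + 1)"
  define R where "R = c *\<^sub>R T"
  have c: "c > 0" using norm_ge_zero[of T] by (simp add: c_def add_nonneg_pos)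
  have RA: "R \<in> A" using TA by (simp add: R_def)
  have "norm R \<le> 1"
    using add_nonneg_pos[OF norm_ge_zero[of T], of 1] by (simp add: R_def c_def field_simps)
  then have Rx: "norm (R x) \<le> norm x" for x
    using norm_blinfun[of R x] mult_right_mono[of "norm R" 1 "norm x"] by simp
  then have R'x: "norm (adj R x) \<le> norm x" for x
    using norm_blinfun[of "adj R" x] norm_adj_le[of R] RA \<open>norm R \<le> 1\<close>
      mult_right_mono[of "norm (adj R)" 1 "norm x"] by simp
  \<comment> \<open>Chosen so that the operator whose root is taken is
    \<open>adj R o\<^sub>L R\<close>. The norm of \<open>X\<close> is at most 1 because
    \<open>adj R\<close> is a contraction.\<close>
  define X where "X = id_blinfun - (adj R o\<^sub>L R)"
  have "norm X \<le> 1"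
  proof (rule norm_blinfun_bound)
    fix x
    have "(norm (X x))\<^sup>2 = (norm x)\<^sup>2 - 2 * (norm (R x))\<^sup>2 + (norm (adj R (R x)))\<^sup>2"
      unfolding power2_norm_eq_inner using RA
      by (simp add: X_def blinfun.diff_left inner_diff_left inner_diff_right inner_commute inner_adj)
    also have "\<dots> \<le> (norm x)\<^sup>2"
      using power_mono[OF R'x[of "R x"] norm_ge_zero, of 2] zero_le_power2[of "norm (R x)"] by linarith
    finally have "norm (X x) \<le> norm x"
      by (rule power2_le_imp_le) simp
    then show "norm (X x) \<le> 1 * norm x" by simp
  qed simp
  moreover have "X \<in> A" "adj X = X" using RA by (simp_all add: X_def adj_diff adj_compose)
  ultimately obtain S where S: "S \<in> A" "adj S = S" "S o\<^sub>L S = id_blinfun - X"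
    using square_root[of X thesis] by blast
  have SS: "S (S x) = adj R (R x)" for x
    using arg_cong[OF S(3), of "\<lambda>T. blinfun_apply T x"] by (simp add: X_def blinfun.diff_left)
  have nSR: "norm (S x) = norm (R x)" for x
  proof -
    have "inner (S x) (S x) = inner (R x) (R x)"
      using inner_adj[of S x "S x"] inner_adj[of R x "R x"] S RA by (simp add: SS)
    then show ?thesis by (simp add: norm_eq_sqrt_inner)
  qed
  define \<Gamma> where "\<Gamma> = range (\<lambda>x. (S x, R x))"
  obtain V where V: "V \<in> A" "adj V o\<^sub>L V = proj_onto (closure (fst ` \<Gamma>))"
    "V o\<^sub>L adj V = proj_onto (closure (snd ` \<Gamma>))"
  proof (rule partial_isometry_of_graph[of \<Gamma>])
    show "(0, 0) \<in> \<Gamma>" unfolding \<Gamma>_def by (rule range_eqI[of _ _ 0]) (simp add: blinfun.zero_right)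
    show "p + q \<in> \<Gamma>" if "p \<in> \<Gamma>" "q \<in> \<Gamma>" for p q
    proof -
      obtain x y where "p = (S x, R x)" "q = (S y, R y)" using \<open>p \<in> \<Gamma>\<close> \<open>q \<in> \<Gamma>\<close> by (auto simp: \<Gamma>_def)
      then show ?thesis unfolding \<Gamma>_def by (intro range_eqI[of _ _ "x + y"]) (simp add: blinfun.add_right)
    qed
    show "(c *\<^sub>C u, c *\<^sub>C w) \<in> \<Gamma>" if "(u, w) \<in> \<Gamma>" for c u w
    proof -
      obtain x where "u = S x" "w = R x" using \<open>(u, w) \<in> \<Gamma>\<close> by (auto simp: \<Gamma>_def)
      then show ?thesis unfolding \<Gamma>_def using S RA by (intro range_eqI[of _ _ "c *\<^sub>C x"]) (simp add: bounded_opsD)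
    qed
    show "norm u = norm w" if "(u, w) \<in> \<Gamma>" for u w
      using that nSR by (auto simp: \<Gamma>_def)
    show "(B u, B w) \<in> \<Gamma>" if "B \<in> commutant A" "(u, w) \<in> \<Gamma>" for B u w
    proof -
      obtain x where "u = S x" "w = R x" using \<open>(u, w) \<in> \<Gamma>\<close> by (auto simp: \<Gamma>_def)
      then show ?thesis unfolding \<Gamma>_def using A_commute[OF S(1) \<open>B \<in> commutant A\<close>] A_commute[OF RA \<open>B \<in> commutant A\<close>]
        by (intro range_eqI[of _ _ "B x"]) simp
    qed
  qed blast
  have "fst ` \<Gamma> = range S" by (auto simp: \<Gamma>_def image_image)
  moreover have "proj_onto {x. S x = 0} = id_blinfun - proj_onto (closure (range S))"
    using proj_onto_kernel[of S] S by simp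
  moreover have "S x = 0 \<longleftrightarrow> T x = 0" for x
    using nSR[of x] c norm_eq_zero[of "S x"] norm_eq_zero[of "T x"]
    by (simp add: R_def blinfun.scaleR_left del: norm_eq_zero)
  ultimately have "adj V o\<^sub>L V = id_blinfun - proj_onto {x. T x = 0}"
    using V(2) by simp
  moreover have "snd ` \<Gamma> = range T"
  proof -
    have "T x = R (inverse c *\<^sub>R x)" for x
      using c by (simp add: R_def blinfun.scaleR_left blinfun.scaleR_right)
    moreover have "R x = T (c *\<^sub>R x)" for x
      by (simp add: R_def blinfun.scaleR_left blinfun.scaleR_right)
    ultimately have "range R = range T" by (metis (no_types, lifting) image_subset_iff rangeI subsetI subset_antisym)
    then show ?thesis by (auto simp: \<Gamma>_def image_image)
  qed
  ultimately show ?thesis using V by (intro that[of V]) auto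
qed

end

section \<open>Finite projections\<close>

lemma proj_op_zero [simp]: "proj_op 0"
  by (intro proj_opI) auto

lemma proj_op_eqI:
  assumes "proj_op P" "proj_op Q" "range P = range Q"
  shows "P = Q"
  using proj_ontoI[OF assms(1) assms(3)] proj_ontoI[OF assms(2) refl] by simp

lemma adj_absorb:
  fixes T P :: "'a::complex_hilbert_space \<Rightarrow>\<^sub>L 'a"
  assumes "T \<in> bounded_ops" "proj_op P" "\<And>x. P (T x) = T x"
  shows "adj T (P x) = adj T x"
  by (rule inner_eqI) (simp add: inner_adj'[OF assms(1)] inner_proj[OF assms(2)] assms(3))

lemma proj_op_add:
  assumes "proj_op P" "proj_op Q" "\<And>x. blinfun_apply P (Q x) = 0"
  shows "proj_op (P + Q)"
  using assms proj_orth_commute[OF assms]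
  by (intro proj_opI)
    (simp_all add: blinfun.add_left blinfun.add_right inner_add_left inner_add_right inner_proj)

lemma proj_op_diff:
  assumes "proj_op P" "proj_op Q" "\<And>x. blinfun_apply P (Q x) = Q x"
  shows "proj_op (P - Q)"
  using assms proj_le_commute[OF assms]
  by (intro proj_opI)
    (simp_all add: blinfun.diff_left blinfun.diff_right inner_diff_left inner_diff_right inner_proj)

lemma proj_op_compose:
  assumes "proj_op P" "proj_op Q" "\<And>x. blinfun_apply P (Q x) = Q (P x)"
  shows "proj_op (P o\<^sub>L Q)"
  using assms by (intro proj_opI) (simp_all add: inner_proj)

section \<open>Finite projections, meets and comparison\<close>

context vn_algebra
begin

text \<open>Finiteness as "every isometry of \<open>A\<close> from the range of \<open>P\<close>
  into itself is onto". The pointwise equations serve directly as rewrite rules.\<close>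

definition fin :: "('a \<Rightarrow>\<^sub>L 'a) \<Rightarrow> bool" where
  "fin P \<longleftrightarrow> P \<in> A \<and> proj_op P \<and>
     (\<forall>W\<in>A. (\<forall>x. P (blinfun_apply W x) = W x) \<longrightarrow> (\<forall>x. adj W (W x) = P x) \<longrightarrow> (\<forall>x. W (adj W x) = P x))"

lemma fin_A: "fin P \<Longrightarrow> P \<in> A" and fin_proj_op: "fin P \<Longrightarrow> proj_op P"
  by (auto simp: fin_def)

lemma fin_D:
  fixes P W :: "'a \<Rightarrow>\<^sub>L 'a"
  assumes "fin P" "W \<in> A" "\<And>x. P (blinfun_apply W x) = W x" "\<And>x. adj W (W x) = P x"
  shows "W (adj W x) = P x"
  using assms by (auto simp: fin_def)

lemma projections_eq: "projections A = {P \<in> A. proj_op P}"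
  using projections_iff[of A] A_bounded_ops by blast

text \<open>A subprojection of \<open>P\<close> equivalent to \<open>P\<close> has the form
  \<open>W o\<^sub>L adj W\<close> for an isometry \<open>W\<close> inside \<open>P\<close>; it is
  proper exactly when \<open>W\<close> is not onto.\<close>

lemma finite_projection_iff: "finite_projection A P \<longleftrightarrow> fin P"
proof
  assume P: "finite_projection A P"
  then have PA: "P \<in> A" and pP: "proj_op P" by (auto simp: finite_projection_def projections_eq)
  have "W (adj W x) = P x"
    if W: "(W :: 'a \<Rightarrow>\<^sub>L 'a) \<in> A" "\<forall>x. P (W x) = W x" "\<forall>x. adj W (W x) = P x" for W x
  proof (rule ccontr)
    assume ne: "W (adj W x) \<noteq> P x"
    have VP: "adj W o\<^sub>L W = P" using W by (auto intro: blinfun_eqI)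
    note pi = partial_isometry_proj_op[OF A_bounded_ops[OF W(1)] pP VP]
      partial_isometry_range[OF A_bounded_ops[OF W(1)] pP VP]
    have "range (W o\<^sub>L adj W) \<subseteq> range P"
      unfolding pi(2) using W(2) by (metis image_subset_iff rangeI)
    moreover have "range (W o\<^sub>L adj W) \<noteq> range P"
    proof
      assume "range (W o\<^sub>L adj W) = range P"
      then have "W o\<^sub>L adj W = P" by (rule proj_op_eqI[OF pi(1) pP])
      then show False using ne by auto
    qed
    ultimately have "range (W o\<^sub>L adj W) \<subset> range P" by blast
    moreover have "W o\<^sub>L adj W \<in> projections A" using W(1) pi(1) by (simp add: projections_eq)
    moreover have "murray_von_neumann_equiv A P (W o\<^sub>L adj W)"
      unfolding murray_von_neumann_equiv_def using W(1) VP by blast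
    ultimately show False
      using P unfolding finite_projection_def by blast
  qed
  then show "fin P" using PA pP by (auto simp: fin_def)
next
  assume P: "fin P"
  note pP = fin_proj_op[OF P]
  have False if Q: "range Q \<subset> range P" and V: "V \<in> A" "adj V o\<^sub>L V = P" "V o\<^sub>L adj V = Q"
    for Q V :: "'a \<Rightarrow>\<^sub>L 'a"
  proof -
    have "range V = range Q"
      using partial_isometry_range[OF A_bounded_ops[OF V(1)] pP V(2)] V(3) by simp
    then have "P (V x) = V x" for x
      using Q pP by (metis (no_types, lifting) UNIV_I image_iff proj_op_idem psubsetE rangeI subsetD)
    moreover have "adj V (V x) = P x" for x
      using V(2) by (metis blinfun_apply_blinfun_compose)
    ultimately have "V (adj V x) = P x" for x by (rule fin_D[OF P V(1)])
    then have "Q = P" using V(3) by (metis blinfun_apply_blinfun_compose blinfun_eqI)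
    then show False using Q by simp
  qed
  then show "finite_projection A P"
    using fin_A[OF P] pP
    unfolding finite_projection_def murray_von_neumann_equiv_def projections_eq by blast
qed

text \<open>An isometry \<open>W\<close> inside \<open>Q\<close> is transported by \<open>U\<close>
  to the range of \<open>U\<close> and extended by the identity on the rest of \<open>P\<close>.
  Finiteness of \<open>P\<close> makes this extension onto, hence \<open>W\<close> as well. This
  covers both subprojections and equivalent projections.\<close>

lemma fin_subequivalent:
  fixes U P Q :: "'a \<Rightarrow>\<^sub>L 'a"
  assumes P: "fin P" and U: "U \<in> A" and pQ: "proj_op Q"
    and UU: "\<And>x. adj U (U x) = Q x" and PU: "\<And>x. P (U x) = U x"
  shows "fin Q"
proof -
  note pP = fin_proj_op[OF P] and PA = fin_A[OF P]
  have QA: "Q \<in> A"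
  proof -
    have "Q = adj U o\<^sub>L U" using UU by (auto intro: blinfun_eqI)
    then show ?thesis using U by simp
  qed
  have UQ: "U (Q x) = U x" for x
    by (rule partial_isometry_initial[OF _ pQ]) (use U UU in \<open>auto intro: blinfun_eqI\<close>)
  have QU': "Q (adj U x) = adj U x" for x
    by (rule inner_eqI) (simp add: inner_proj[OF pQ] inner_adj'[OF A_bounded_ops[OF U]] UQ)
  have U'P: "adj U (P x) = adj U x" for x
    by (rule adj_absorb) (use U pP PU in auto)
  have "W (adj W x) = Q x"
    if W: "(W :: 'a \<Rightarrow>\<^sub>L 'a) \<in> A" and QW: "\<And>x. Q (W x) = W x" and WW: "\<And>x. adj W (W x) = Q x" for W x
  proof -
    have WQ: "W (Q x) = W x" for x
      by (rule partial_isometry_initial[OF _ pQ]) (use W WW in \<open>auto intro: blinfun_eqI\<close>)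
    have W'Q: "adj W (Q x) = adj W x" for x
      by (rule adj_absorb) (use W pQ QW in auto)
    have QW': "Q (adj W x) = adj W x" for x
      by (rule inner_eqI) (simp add: inner_proj[OF pQ] inner_adj'[OF A_bounded_ops[OF W]] WQ)
    define X where "X = (U o\<^sub>L (W o\<^sub>L adj U)) + (P - (U o\<^sub>L adj U))"
    have XA: "X \<in> A" unfolding X_def using U W PA by simp
    have X: "X x = U (W (adj U x)) + (P x - U (adj U x))" for x
      by (simp add: X_def blinfun.add_left blinfun.diff_left)
    have X': "adj X x = U (adj W (adj U x)) + (P x - U (adj U x))" for x
      using U W PA pP by (simp add: X_def adj_add adj_diff adj_compose blinfun.add_left blinfun.diff_left)
    note rules = X X' UU PU UQ QU' U'P QW WW WQ W'Q QW' proj_op_idem[OF pP] proj_op_idem[OF pQ]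
    \<comment> \<open>Only vectors in the range of \<open>U\<close> matter; \<open>adj U\<close>
      then carries the identity back to \<open>Q\<close>.\<close>
    have "X (adj X (U x)) = P (U x)"
      by (rule fin_D[OF P XA]) (simp_all add: rules blinfun.add_right blinfun.diff_right)
    then have "adj U (X (adj X (U x))) = adj U (P (U x))" by simp
    then show ?thesis by (simp add: rules blinfun.add_right blinfun.diff_right)
  qed
  then show ?thesis using QA pQ by (auto simp: fin_def)
qed

lemma fin_mono:
  fixes P Q :: "'a \<Rightarrow>\<^sub>L 'a"
  assumes "fin P" "Q \<in> A" "proj_op Q" "\<And>x. P (Q x) = Q x"
  shows "fin Q"
  by (rule fin_subequivalent[OF assms(1,2,3)]) (use assms in simp_all)

lemma fin_zero: "fin P \<Longrightarrow> fin 0"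
  using A_diff[OF fin_A fin_A, of P P] by (intro fin_mono[of P 0]) (auto simp: blinfun.zero_right)

text \<open>The source of lattice operations in \<open>A\<close>: meets are common kernels of
  complements, and joins are complements of common kernels. Infinite families are needed
  too.\<close>

lemma common_kernel:
  fixes S :: "('a \<Rightarrow>\<^sub>L 'a) set"
  assumes S: "S \<subseteq> A"
  obtains K where "K \<in> A" "proj_op K" "\<And>x. blinfun_apply K x = x \<longleftrightarrow> (\<forall>T\<in>S. blinfun_apply T x = 0)"
proof -
  define M where "M = {x. \<forall>T\<in>S. blinfun_apply T x = 0}"
  have "M = (\<Inter>T\<in>S. {x. blinfun_apply T x = 0})" by (auto simp: M_def)
  then have cl: "closed M" by (auto intro: closed_kernel)
  have sub: "csubspace M"
    using S unfolding csubspace_def M_def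
    by (auto simp: blinfun.zero_right blinfun.add_right subset_iff bounded_opsD[OF A_bounded_ops])
  have "B x \<in> M" if "B \<in> commutant A" "x \<in> M" for B :: "'a \<Rightarrow>\<^sub>L 'a" and x
  proof -
    have "T (B x) = 0" if "T \<in> S" for T :: "'a \<Rightarrow>\<^sub>L 'a"
    proof -
      have "T (B x) = B (T x)" using A_commute[of T B x] S \<open>B \<in> commutant A\<close> that by auto
      then show ?thesis using \<open>x \<in> M\<close> that by (simp add: M_def blinfun.zero_right)
    qed
    then show ?thesis by (simp add: M_def)
  qed
  then have "proj_onto M \<in> A" by (rule proj_onto_in_A[OF cl sub])
  moreover have "proj_onto M x = x \<longleftrightarrow> (\<forall>T\<in>S. T x = 0)" for x
    by (simp add: proj_onto_id_iff[OF cl sub]) (simp add: M_def)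
  ultimately show ?thesis using that proj_op_proj_onto[OF cl sub] by blast
qed

text \<open>A maximal partial isometry between subprojections \<open>p\<close> of \<open>e\<close> and \<open>q\<close> of \<open>f\<close> leaves remainders
  \<open>e' = e - p\<close> and \<open>f' = f - q\<close> with \<open>f' A e' = 0\<close>; the projection \<open>Z\<close> onto the common kernel of
  \<open>e' A\<close> is then central, with \<open>Z e' = 0\<close> and \<open>Z f' = f'\<close>.\<close>

lemma comparison:
  fixes e f :: "'a \<Rightarrow>\<^sub>L 'a"
  assumes eA: "e \<in> A" and pe: "proj_op e" and fA: "f \<in> A" and pf: "proj_op f"
  obtains Z U U' where "Z \<in> A" "proj_op Z" "\<And>T x. T \<in> A \<Longrightarrow> blinfun_apply Z (blinfun_apply T x) = T (Z x)"
    "U \<in> A" "\<And>x. adj U (U x) = Z (e x)" "\<And>x. f (blinfun_apply U x) = U x"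
    "U' \<in> A" "\<And>x. adj U' (U' x) = f x - Z (f x)" "\<And>x. e (blinfun_apply U' x) = U' x"
proof -
  \<comment> \<open>Zorn's lemma is applied to graphs of partial isometries that need not be closed.
    For these the union of a chain is again admissible, and the closure is taken only once, for the
    maximal graph.\<close>
  define ok where "ok \<Gamma> \<longleftrightarrow> (0, 0) \<in> \<Gamma> \<and> (\<forall>p\<in>\<Gamma>. \<forall>q\<in>\<Gamma>. p + q \<in> \<Gamma>) \<and>
     (\<forall>c. \<forall>(u, w)\<in>\<Gamma>. (c *\<^sub>C u, c *\<^sub>C w) \<in> \<Gamma>) \<and>
     (\<forall>(u, w)\<in>\<Gamma>. norm u = norm w \<and> e u = u \<and> f w = w) \<and>
     (\<forall>B\<in>commutant A. \<forall>(u, w)\<in>\<Gamma>. (B u, B w) \<in> \<Gamma>)" for \<Gamma> :: "('a \<times> 'a) set"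
  have "\<exists>\<Gamma>\<in>Collect ok. \<forall>\<Delta>\<in>Collect ok. \<Gamma> \<subseteq> \<Delta> \<longrightarrow> \<Delta> = \<Gamma>"
  proof (rule subset_Zorn_nonempty)
    have "ok {(0, 0)}" by (simp add: ok_def blinfun.zero_right)
    then show "Collect ok \<noteq> {}" by blast
  next
    fix C assume ne: "C \<noteq> {}" and ch: "subset.chain (Collect ok) C"
    have okC: "ok \<Gamma>" if "\<Gamma> \<in> C" for \<Gamma>
      using ch that unfolding subset.chain_def by blast
    have "p + q \<in> \<Union>C" if pq: "p \<in> \<Union>C" "q \<in> \<Union>C" for p q
    proof -
      obtain \<Gamma> \<Delta> where "p \<in> \<Gamma>" "\<Gamma> \<in> C" "q \<in> \<Delta>" "\<Delta> \<in> C" using pq by blast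
      moreover from this have "\<Gamma> \<subseteq> \<Delta> \<or> \<Delta> \<subseteq> \<Gamma>" using ch unfolding subset.chain_def by blast
      ultimately obtain \<Xi> where \<Xi>: "\<Xi> \<in> C" "p \<in> \<Xi>" "q \<in> \<Xi>" by blast
      then have "p + q \<in> \<Xi>" using okC[OF \<Xi>(1)] unfolding ok_def by blast
      then show ?thesis using \<Xi>(1) by blast
    qed
    moreover have "(0, 0) \<in> \<Union>C" using ne okC unfolding ok_def by blast
    moreover have "(c *\<^sub>C u, c *\<^sub>C w) \<in> \<Union>C" if "(u, w) \<in> \<Union>C" for c u w
      using that okC unfolding ok_def by fast
    moreover have "norm u = norm w \<and> e u = u \<and> f w = w" if "(u, w) \<in> \<Union>C" for u w
      using that okC unfolding ok_def by fast
    moreover have "(B u, B w) \<in> \<Union>C" if "B \<in> commutant A" "(u, w) \<in> \<Union>C" for B :: "'a \<Rightarrow>\<^sub>L 'a" and u w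
      using that okC unfolding ok_def by fast
    ultimately have "ok (\<Union>C)" unfolding ok_def by blast
    then show "\<Union>C \<in> Collect ok" by simp
  qed
  then obtain \<Gamma> where ok: "ok \<Gamma>" and max: "\<And>\<Delta>. ok \<Delta> \<Longrightarrow> \<Gamma> \<subseteq> \<Delta> \<Longrightarrow> \<Delta> = \<Gamma>"
    by blast
  have zero: "(0, 0) \<in> \<Gamma>" using ok by (simp add: ok_def)
  have add: "(u + u', w + w') \<in> \<Gamma>" if "(u, w) \<in> \<Gamma>" "(u', w') \<in> \<Gamma>" for u w u' w'
  proof -
    have "(u, w) + (u', w') \<in> \<Gamma>" using ok that unfolding ok_def by blast
    then show ?thesis by simp
  qed
  have scale: "(c *\<^sub>C u, c *\<^sub>C w) \<in> \<Gamma>" if "(u, w) \<in> \<Gamma>" for c u w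
    using ok that unfolding ok_def by blast
  have iso: "norm u = norm w" and eu: "e u = u" and fw: "f w = w" if "(u, w) \<in> \<Gamma>" for u w
    using ok that unfolding ok_def by blast+
  have inv: "(B u, B w) \<in> \<Gamma>" if "B \<in> commutant A" "(u, w) \<in> \<Gamma>" for B :: "'a \<Rightarrow>\<^sub>L 'a" and u w
    using ok that unfolding ok_def by blast
  have add': "p + q \<in> \<Gamma>" if "p \<in> \<Gamma>" "q \<in> \<Gamma>" for p q
    using ok that unfolding ok_def by blast
  obtain V where V: "V \<in> A" and VV1: "adj V o\<^sub>L V = proj_onto (closure (fst ` \<Gamma>))"
    and VV2: "V o\<^sub>L adj V = proj_onto (closure (snd ` \<Gamma>))" and Vuw: "\<And>u w. (u, w) \<in> \<Gamma> \<Longrightarrow> V u = w"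
    using partial_isometry_of_graph[OF zero add' scale iso inv, of thesis] by blast
  define p where "p = adj V o\<^sub>L V"
  define q where "q = V o\<^sub>L adj V"
  have pA: "p \<in> A" and qA: "q \<in> A" using V by (simp_all add: p_def q_def)
  note sub = csubspace_fst_snd_image[OF zero add' scale]
  have L: "closed (closure (fst ` \<Gamma>))" "csubspace (closure (fst ` \<Gamma>))"
    and R: "closed (closure (snd ` \<Gamma>))" "csubspace (closure (snd ` \<Gamma>))"
    using sub by (simp_all add: csubspace_closure)
  have pp: "proj_op p" and pq: "proj_op q"
    unfolding p_def q_def VV1 VV2 by (intro proj_op_proj_onto L R)+
  have ep: "e (p x) = p x" for x
  proof -
    have "closure (fst ` \<Gamma>) \<subseteq> {u. e u = u}"
      using eu by (intro closure_minimal closed_Collect_eq continuous_intros) auto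
    then show ?thesis using range_proj_onto[OF L] unfolding p_def VV1 by blast
  qed
  have fq: "f (q x) = q x" for x
  proof -
    have "closure (snd ` \<Gamma>) \<subseteq> {u. f u = u}"
      using fw by (intro closure_minimal closed_Collect_eq continuous_intros) auto
    then show ?thesis using range_proj_onto[OF R] unfolding q_def VV2 by blast
  qed
  have pu: "p u = u" if "(u, w) \<in> \<Gamma>" for u w
    unfolding p_def VV1 proj_onto_id_iff[OF L] using closure_subset that by force
  have qw: "q w = w" if "(u, w) \<in> \<Gamma>" for u w
    unfolding q_def VV2 proj_onto_id_iff[OF R] using closure_subset that by force
  define e' where "e' = e - p"
  define f' where "f' = f - q"
  have e'A: "e' \<in> A" and f'A: "f' \<in> A" using eA fA pA qA by (simp_all add: e'_def f'_def)
  have pe': "proj_op e'" unfolding e'_def by (rule proj_op_diff[OF pe pp ep])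
  have pf': "proj_op f'" unfolding f'_def by (rule proj_op_diff[OF pf pq fq])
  have pe'0: "p (e' x) = 0" for x
    using proj_le_commute[OF pe pp ep] pp by (simp add: e'_def blinfun.diff_left blinfun.diff_right)
  have qf'0: "q (f' x) = 0" for x
    using proj_le_commute[OF pf pq fq] pq by (simp add: f'_def blinfun.diff_left blinfun.diff_right)
  have ee': "e (e' x) = e' x" for x
    using pe by (simp add: e'_def blinfun.diff_left blinfun.diff_right ep)
  have ff': "f (f' x) = f' x" for x
    using pf by (simp add: f'_def blinfun.diff_left blinfun.diff_right fq)
  \<comment> \<open>A nonzero \<open>f' a e'\<close> would yield, by polar decomposition, a partial
    isometry \<open>v\<close> from its support \<open>r\<close>, which lies below \<open>e'\<close>,
    into \<open>f'\<close>. Adding the graph of \<open>v\<close> to \<open>\<Gamma>\<close> would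
    contradict maximality.\<close>
  have orth: "f' (a (e' x)) = 0" if a: "a \<in> A" for a :: "'a \<Rightarrow>\<^sub>L 'a" and x
  proof -
    define T where "T = f' o\<^sub>L (a o\<^sub>L e')"
    have TA: "T \<in> A" using a e'A f'A by (simp add: T_def)
    have Tx: "T x = f' (a (e' x))" for x by (simp add: T_def)
    define K where "K = proj_onto {x. T x = 0}"
    have ker: "closed {x. T x = 0}" "csubspace {x. T x = 0}"
      using TA by (auto intro: closed_kernel csubspace_kernel)
    have pK: "proj_op K" unfolding K_def by (rule proj_op_proj_onto[OF ker])
    have K: "K x = x \<longleftrightarrow> T x = 0" for x
      unfolding K_def proj_onto_id_iff[OF ker] by simp
    obtain v where vA: "v \<in> A" and vv: "adj v o\<^sub>L v = id_blinfun - K"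
      and v'v: "v o\<^sub>L adj v = proj_onto (closure (range T))"
      using support_equivalence[OF TA] unfolding K_def by metis
    define r where "r = id_blinfun - K"
    have pr: "proj_op r" unfolding r_def by (rule proj_op_compl[OF pK])
    have rA: "r \<in> A" using vv vA unfolding r_def by (metis A_adj A_compose)
    have "r (e' x) = r x" for x
    proof -
      have "T (x - e' x) = 0" using pe' by (simp add: Tx blinfun.diff_right blinfun.zero_right)
      then have "K (x - e' x) = x - e' x" by (simp add: K)
      then show ?thesis by (simp add: r_def blinfun.diff_left blinfun.diff_right algebra_simps)
    qed
    then have e'r: "e' (r x) = r x" for x
      by (intro inner_eqI[of "e' (r x)"]) (simp add: inner_proj[OF pr] inner_proj[OF pe'])
    have f'v: "f' (v x) = v x" for x
    proof -
      have "closure (range T) \<subseteq> {u. f' u = u}"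
        using pf' by (intro closure_minimal closed_Collect_eq continuous_intros) (auto simp: Tx)
      moreover have "v x \<in> closure (range T)"
        using partial_isometry_range[OF A_bounded_ops[OF vA] pr vv[folded r_def]]
          range_proj_onto[OF closed_closure csubspace_closure[OF csubspace_range[OF A_bounded_ops[OF TA]]]]
        unfolding v'v by blast
      ultimately show ?thesis by blast
    qed
    have nrv: "norm (r x) = norm (v x)" for x
    proof -
      have "adj v (v x) = r x" using vv by (metis blinfun_apply_blinfun_compose r_def)
      then have "inner (v x) (v x) = inner (r x) (r x)"
        using inner_adj[OF A_bounded_ops[OF vA], of x "v x"] pr by (simp add: inner_proj)
      then show ?thesis by (simp add: norm_eq_sqrt_inner)
    qed
    define \<Delta> where "\<Delta> = {(u + r x, w + v x) |u w x. (u, w) \<in> \<Gamma>}"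
    have \<Delta>I: "(u + r x, w + v x) \<in> \<Delta>" if "(u, w) \<in> \<Gamma>" for u w x
      using that by (auto simp: \<Delta>_def)
    have "ok \<Delta>"
      unfolding ok_def
    proof (intro conjI ballI allI)
      show "(0, 0) \<in> \<Delta>" using \<Delta>I[OF zero, of 0] by (simp add: blinfun.zero_right)
    next
      fix s t assume "s \<in> \<Delta>" "t \<in> \<Delta>"
      then obtain u w x u' w' x' where *: "s = (u + r x, w + v x)" "(u, w) \<in> \<Gamma>"
        "t = (u' + r x', w' + v x')" "(u', w') \<in> \<Gamma>" by (auto simp: \<Delta>_def)
      have "s + t = ((u + u') + r (x + x'), (w + w') + v (x + x'))"
        using * by (simp add: blinfun.add_right algebra_simps)
      also have "\<dots> \<in> \<Delta>" by (rule \<Delta>I[OF add[OF *(2,4)]])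
      finally show "s + t \<in> \<Delta>" .
    next
      fix c s assume "s \<in> \<Delta>"
      then obtain u w x where *: "s = (u + r x, w + v x)" "(u, w) \<in> \<Gamma>" by (auto simp: \<Delta>_def)
      have "(c *\<^sub>C (u + r x), c *\<^sub>C (w + v x)) = (c *\<^sub>C u + r (c *\<^sub>C x), c *\<^sub>C w + v (c *\<^sub>C x))"
        using rA vA by (simp add: scaleC_add_right bounded_opsD)
      also have "\<dots> \<in> \<Delta>" by (rule \<Delta>I[OF scale[OF *(2)]])
      finally show "case s of (u, w) \<Rightarrow> (c *\<^sub>C u, c *\<^sub>C w) \<in> \<Delta>" using * by simp
    next
      fix s assume "s \<in> \<Delta>"
      then obtain u w x where *: "s = (u + r x, w + v x)" "(u, w) \<in> \<Gamma>" by (auto simp: \<Delta>_def)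
      have "inner u (r x) = inner (p u) (e' (r x))" using pu[OF *(2)] by (simp add: e'r)
      then have "inner u (r x) = 0" by (simp add: inner_proj[OF pp] pe'0)
      moreover have "inner w (v x) = inner (q w) (f' (v x))" using qw[OF *(2)] by (simp add: f'v)
      then have "inner w (v x) = 0" by (simp add: inner_proj[OF pq] qf'0)
      moreover have "inner u u = inner w w" "inner (r x) (r x) = inner (v x) (v x)"
        using iso[OF *(2)] nrv[of x] by (simp_all add: norm_eq_sqrt_inner)
      ultimately have "norm (u + r x) = norm (w + v x)"
        by (simp add: norm_eq_sqrt_inner inner_add_left inner_add_right inner_commute)
      moreover have "e (u + r x) = u + r x"
        using ee'[of "r x"] eu[OF *(2)] by (simp add: e'r blinfun.add_right)
      moreover have "f (w + v x) = w + v x"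
        using ff'[of "v x"] fw[OF *(2)] by (simp add: f'v blinfun.add_right)
      ultimately show "case s of (u, w) \<Rightarrow> norm u = norm w \<and> e u = u \<and> f w = w" using * by simp
    next
      fix B s assume B: "B \<in> commutant A" and "s \<in> \<Delta>"
      then obtain u w x where *: "s = (u + r x, w + v x)" "(u, w) \<in> \<Gamma>" by (auto simp: \<Delta>_def)
      have "(B (u + r x), B (w + v x)) = (B u + r (B x), B w + v (B x))"
        using A_commute[OF rA B] A_commute[OF vA B] by (simp add: blinfun.add_right)
      also have "\<dots> \<in> \<Delta>" by (rule \<Delta>I[OF inv[OF B *(2)]])
      finally show "case s of (u, w) \<Rightarrow> (B u, B w) \<in> \<Delta>" using * by simp
    qed
    moreover have "\<Gamma> \<subseteq> \<Delta>"
      using \<Delta>I[of _ _ 0] by (auto simp: blinfun.zero_right)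
    \<comment> \<open>Equality puts \<open>r\<close> below \<open>p\<close>; but \<open>r\<close>
      lies below \<open>e'\<close>, which is orthogonal to \<open>p\<close>, so
      \<open>r = 0\<close>.\<close>
    ultimately have "\<Delta> = \<Gamma>" by (rule max)
    then have "(r x, v x) \<in> \<Gamma>" for x using \<Delta>I[OF zero, of x] by simp
    then have "p (r x) = r x" for x by (rule pu)
    then have "r x = 0" for x using pe'0[of "r x"] by (simp add: e'r)
    then have "K x = x" for x by (simp add: r_def blinfun.diff_left)
    then show ?thesis using K Tx by simp
  qed
  obtain Z where ZA: "Z \<in> A" and pZ: "proj_op Z"
    and Z: "\<And>x. Z x = x \<longleftrightarrow> (\<forall>T\<in>(\<lambda>a. e' o\<^sub>L a) ` A. blinfun_apply T x = 0)"
    using common_kernel[of "(\<lambda>a. e' o\<^sub>L a) ` A"] e'A by (metis (no_types, lifting) A_compose image_subsetI)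
  have Z: "Z x = x \<longleftrightarrow> (\<forall>a\<in>A. e' (a x) = 0)" for x using Z[of x] by auto
  \<comment> \<open>\<open>A\<close> is closed under products, so the common kernel of
    \<open>e' A\<close> is invariant under \<open>A\<close>; closure under adjoints turns this into
    commutation.\<close>
  have Zinv: "Z (T (Z x)) = T (Z x)" if "T \<in> A" for T :: "'a \<Rightarrow>\<^sub>L 'a" and x
  proof -
    have "Z (Z x) = Z x" using pZ by simp
    then have *: "\<forall>a\<in>A. e' (a (Z x)) = 0" by (simp only: Z)
    have "e' (a (T (Z x))) = 0" if "a \<in> A" for a
      using *[rule_format, of "a o\<^sub>L T"] that \<open>T \<in> A\<close> by simp
    then show ?thesis by (simp only: Z) blast
  qed
  have Zc: "Z (T x) = T (Z x)" if "T \<in> A" for T :: "'a \<Rightarrow>\<^sub>L 'a" and x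
    by (rule proj_commute_if_invariant[OF pZ]) (use that Zinv in auto)
  have e'Z: "e' (Z x) = 0" for x
  proof -
    have "Z (Z x) = Z x" using pZ by simp
    then have "\<forall>a\<in>A. e' (a (Z x)) = 0" by (simp only: Z)
    then show ?thesis using A_id by fastforce
  qed
  have Ze': "Z (e x) = Z (p x)" for x
    using e'Z[of x] Zc[OF e'A, of x] by (simp add: e'_def blinfun.diff_left blinfun.diff_right)
  have Zf': "Z (f' x) = f' x" for x
  proof -
    have "e' (a (f' x)) = 0" if "a \<in> A" for a
    proof (rule inner_eqI)
      show "inner (e' (a (f' x))) z = inner 0 z" for z
        using orth[OF A_adj[OF that], of z]
        by (simp add: inner_proj[OF pe'] inner_proj[OF pf'] inner_adj[OF A_bounded_ops[OF that]])
    qed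
    then show ?thesis unfolding Z by blast
  qed
  have Zf: "f x - Z (f x) = q x - Z (q x)" for x
    using Zf'[of x] by (simp add: f'_def blinfun.diff_left blinfun.diff_right algebra_simps)
  have px: "adj V (V x) = p x" and qx: "V (adj V x) = q x" for x
    by (simp_all add: p_def q_def)
  have Vp: "V (p x) = V x" for x
    using partial_isometry_initial[OF A_bounded_ops[OF V] pp] by (simp add: p_def)
  have V'q: "adj V (q x) = adj V x" for x
    using partial_isometry_initial[of "adj V" q x] V pq by (simp add: q_def)
  \<comment> \<open>On the part cut out by \<open>Z\<close>, \<open>e\<close> agrees with
    \<open>p\<close> and is carried into \<open>f\<close> by \<open>V\<close>; on the complementary
    part, \<open>f\<close> agrees with \<open>q\<close> and is carried back into \<open>e\<close> by
    \<open>adj V\<close>.\<close>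
  show ?thesis
  proof (rule that[OF ZA pZ Zc])
    show "V o\<^sub>L Z \<in> A" using V ZA by simp
    have *: "adj (V o\<^sub>L Z) = Z o\<^sub>L adj V" using V ZA pZ by (simp add: adj_compose)
    show "adj (V o\<^sub>L Z) ((V o\<^sub>L Z) x) = Z (e x)" for x
      using pZ by (simp add: * px Ze' Zc[OF pA, symmetric])
    show "f ((V o\<^sub>L Z) x) = (V o\<^sub>L Z) x" for x
      using fq[of "V (Z x)"] by (simp add: qx[symmetric] px Vp)
    show "adj V o\<^sub>L (id_blinfun - Z) \<in> A" using V ZA by simp
    have *: "adj (adj V o\<^sub>L (id_blinfun - Z)) = (id_blinfun - Z) o\<^sub>L V"
      using V ZA pZ by (simp add: adj_compose adj_diff)
    show "adj (adj V o\<^sub>L (id_blinfun - Z)) ((adj V o\<^sub>L (id_blinfun - Z)) x) = f x - Z (f x)" for x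
      using pZ unfolding *
      by (simp add: Zf blinfun.diff_left blinfun.diff_right qx Zc[OF qA, symmetric])
    show "e ((adj V o\<^sub>L (id_blinfun - Z)) x) = (adj V o\<^sub>L (id_blinfun - Z)) x" for x
      using ep[of "adj V (x - Z x)"] by (simp add: px[symmetric] qx V'q blinfun.diff_left)
  qed
qed

section \<open>Finiteness of sums and joins of finite projections\<close>

lemma closed_fixed_points: "closed {x. blinfun_apply P x = x}"
  by (intro closed_Collect_eq continuous_intros)

text \<open>Lets a partial isometry from a polar decomposition inherit closed conditions, such as
  \<open>P x = x\<close> or \<open>f x = 0\<close>, from the values of \<open>T\<close>.\<close>

lemma equivalent_range_in_closure:
  fixes v T r :: "'a \<Rightarrow>\<^sub>L 'a"
  assumes T: "T \<in> A" and v: "v \<in> A" and r: "proj_op r" "adj v o\<^sub>L v = r"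
    and vT: "v o\<^sub>L adj v = proj_onto (closure (range T))"
    and S: "closed S" "\<And>x. T x \<in> S"
  shows "v x \<in> S"
proof -
  have "closed (closure (range T))" "csubspace (closure (range T))"
    using T by (simp_all add: csubspace_closure csubspace_range)
  then have "range v = closure (range T)"
    using partial_isometry_range[OF A_bounded_ops[OF v] r] vT by (simp add: range_proj_onto)
  moreover have "closure (range T) \<subseteq> S"
    using S by (intro closure_minimal) auto
  ultimately show ?thesis by blast
qed

text \<open>Polar decomposition makes the support of \<open>T\<close> equivalent to its range
  projection, which lies below \<open>P\<close>.\<close>

lemma support_subprojection:
  fixes T P r :: "'a \<Rightarrow>\<^sub>L 'a"
  assumes T: "T \<in> A" and P: "fin P" "\<And>x. P (T x) = T x"
  shows "fin (id_blinfun - proj_onto {x. T x = 0})"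
proof -
  have ker: "closed {x. T x = 0}" "csubspace {x. T x = 0}"
    using T by (simp_all add: closed_kernel csubspace_kernel)
  note pr = proj_op_compl[OF proj_op_proj_onto[OF ker]]
  obtain v where v: "v \<in> A" "adj v o\<^sub>L v = id_blinfun - proj_onto {x. T x = 0}"
    "v o\<^sub>L adj v = proj_onto (closure (range T))"
    using support_equivalence[OF T] by metis
  have "v x \<in> {x. P x = x}" for x
    by (rule equivalent_range_in_closure[OF T v(1) pr v(2,3) closed_fixed_points]) (simp add: P)
  moreover have "adj v (v x) = (id_blinfun - proj_onto {x. T x = 0}) x" for x
    by (simp flip: v(2))
  ultimately show ?thesis
    by (intro fin_subequivalent[OF P(1) v(1) pr]) auto
qed

text \<open>The part \<open>G - e\<close> of \<open>G\<close> is carried into \<open>Q\<close>, orthogonally to \<open>f\<close>, by Kaplansky's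
  equivalence \<open>G - G \<and> P \<sim> G \<or> P - P\<close>.\<close>

lemma central_part_subequivalent:
  fixes P Q G e f Z U :: "'a \<Rightarrow>\<^sub>L 'a"
  assumes P: "P \<in> A" "proj_op P" and Q: "fin Q" and PQ: "\<And>x. P (Q x) = 0"
    and G: "G \<in> A" "proj_op G" "\<And>x. P (G x) + Q (G x) = G x"
    and e: "e \<in> A" "proj_op e" "\<And>x. e x = x \<longleftrightarrow> G x = x \<and> P x = x"
    and f: "proj_op f" "\<And>x. Q (f x) = f x" "\<And>x. f (G x) = 0"
    and Z: "Z \<in> A" "proj_op Z" "\<And>T x. T \<in> A \<Longrightarrow> Z (blinfun_apply T x) = T (Z x)"
    and U: "U \<in> A" "\<And>x. adj U (U x) = Z (e x)" "\<And>x. f (U x) = U x"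
  shows "fin (Z o\<^sub>L G)"
proof -
  note QA = fin_A[OF Q] and pQ = fin_proj_op[OF Q]
  have Ge: "G (e x) = e x" and Pe: "P (e x) = e x" for x
    using e(3)[of "e x"] e(2) by simp_all
  have eG: "e (G x) = e x" and eP: "e (P x) = e x" for x
    using proj_le_commute[OF G(2) e(2) Ge] proj_le_commute[OF P(2) e(2) Pe] by simp_all
  have fQ: "f (Q x) = f x" for x by (rule proj_le_commute[OF pQ f(1,2)])
  \<comment> \<open>Since \<open>G\<close> lies below \<open>P + Q\<close>, a vector of the range of
    \<open>G\<close> killed by \<open>Q\<close> lies in the range of \<open>P\<close>. So the
    support of \<open>Q G\<close> is \<open>G - e\<close>.\<close>
  define T where "T = Q o\<^sub>L G"
  have TA: "T \<in> A" using QA G by (simp add: T_def)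
  have T0: "T x = 0 \<longleftrightarrow> G x = e x" for x
  proof
    assume "T x = 0"
    then have "P (G x) = G x" using G(3)[of x] by (simp add: T_def)
    then have "e (G x) = G x" using e(3) G(2) by simp
    then show "G x = e x" by (simp add: eG)
  next
    assume "G x = e x"
    then have "Q (G x) = Q (P (e x))" by (simp add: Pe)
    then show "T x = 0" using proj_orth_commute[OF P(2) pQ PQ] by (simp add: T_def)
  qed
  have pGe: "proj_op (G - e)" by (rule proj_op_diff[OF G(2) e(2) Ge])
  have "proj_onto {x. T x = 0} = id_blinfun - (G - e)"
    by (rule proj_ontoI[OF proj_op_compl[OF pGe]])
      (subst range_proj_op[OF proj_op_compl[OF pGe]], auto simp: T0 blinfun.diff_left)
  then obtain v where v: "v \<in> A" "adj v o\<^sub>L v = G - e"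
    "v o\<^sub>L adj v = proj_onto (closure (range T))"
    using support_equivalence[OF TA] by (metis diff_diff_eq2 add_diff_cancel_left')
  have vv: "adj v (v x) = G x - e x" for x
    by (simp flip: v(2) blinfun.diff_left)
  have "v x \<in> {x. Q x = x}" for x
    by (rule equivalent_range_in_closure[OF TA v(1) pGe v(2,3) closed_fixed_points])
      (simp add: T_def pQ)
  then have Qv: "Q (v x) = v x" for x by blast
  have "v x \<in> {x. f x = 0}" for x
    by (rule equivalent_range_in_closure[OF TA v(1) pGe v(2,3) closed_kernel])
      (simp add: T_def fQ f(3))
  then have fv: "f (v x) = 0" for x by blast
  have QU: "Q (U x) = U x" for x using f(2)[of "U x"] by (simp add: U(3))
  have vU: "adj v (U x) = 0" for x
    by (rule inner_eqI) (metis inner_adj'[OF A_bounded_ops[OF v(1)]] inner_proj[OF f(1)] U(3) fv inner_zero_left inner_zero_right)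
  have Uv: "adj U (v x) = 0" for x
    by (rule inner_eqI) (metis inner_adj'[OF A_bounded_ops[OF U(1)]] inner_proj[OF f(1)] U(3) fv inner_zero_left inner_zero_right)
  \<comment> \<open>The two pieces have orthogonal ranges: \<open>U\<close> carries
    \<open>Z e\<close> into \<open>f\<close>, while \<open>v\<close> carries
    \<open>Z (G - e)\<close> into \<open>Q - f\<close>, as \<open>f Q G = f G = 0\<close>. Hence the
    sum is isometric on \<open>Z G\<close> with range inside \<open>Q\<close>.\<close>
  define X where "X = (v o\<^sub>L Z) + U"
  have XA: "X \<in> A" using v U Z by (simp add: X_def)
  have X: "X x = v (Z x) + U x" for x by (simp add: X_def blinfun.add_left)
  have X': "adj X x = Z (adj v x) + adj U x" for x
    using v U Z by (simp add: X_def adj_add adj_compose blinfun.add_left)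
  have pZG: "proj_op (Z o\<^sub>L G)"
    by (rule proj_op_compose[OF Z(2) G(2)]) (rule Z(3)[OF G(1)])
  show ?thesis
  proof (rule fin_subequivalent[OF Q XA pZG])
    have "Z (G (Z x) - e (Z x)) = Z (G x) - Z (e x)" for x
      using Z(2) by (simp add: Z(3)[OF G(1), symmetric] Z(3)[OF e(1), symmetric] blinfun.diff_right)
    then show "adj X (X x) = (Z o\<^sub>L G) x" for x
      by (simp add: X X' blinfun.add_right vv vU Uv U(2) blinfun.zero_right)
    show "Q (X x) = X x" for x by (simp add: X blinfun.add_right Qv QU)
  qed
qed

text \<open>If \<open>W\<^sup>* W = P + Q\<close> and \<open>D = P + Q - W W\<^sup>*\<close>, then the ranges of the \<open>W\<^sup>n D\<close> are pairwise orthogonal.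
  Let \<open>G\<close> project onto the sum of those with even \<open>n\<close> and \<open>G' = W G W\<^sup>*\<close> onto the sum of the odd ones.
  Comparing \<open>G \<and> P\<close> with \<open>G' \<and> Q\<close> splits \<open>G \<sim> G'\<close> centrally into a part below \<open>Q\<close> and a part below
  \<open>P\<close>, hence into finite parts. But the shift \<open>W\<^sup>2\<close> maps \<open>G\<close> onto \<open>G - D\<close>, so \<open>D = 0\<close>.\<close>

lemma fin_add:
  fixes P Q :: "'a \<Rightarrow>\<^sub>L 'a"
  assumes P: "fin P" and Q: "fin Q" and PQ: "\<And>x. P (Q x) = 0"
  shows "fin (P + Q)"
proof -
  note PA = fin_A[OF P] and pP = fin_proj_op[OF P] and QA = fin_A[OF Q] and pQ = fin_proj_op[OF Q]
  note QP = proj_orth_commute[OF pP pQ PQ]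
  define N where "N = P + Q"
  have NA: "N \<in> A" using PA QA by (simp add: N_def)
  have pN: "proj_op N" unfolding N_def by (rule proj_op_add[OF pP pQ PQ])
  have "W (adj W x) = N x"
    if WA: "(W :: 'a \<Rightarrow>\<^sub>L 'a) \<in> A" and NW: "\<forall>x. N (W x) = W x" and WW: "\<forall>x. adj W (W x) = N x" for W x
  proof -
    define W' where "W' = adj W"
    have W'A: "W' \<in> A" using WA by (simp add: W'_def)
    note WB = A_bounded_ops[OF WA]
    have NW: "N (W x) = W x" and WW: "W' (W x) = N x" for x using NW WW by (simp_all add: W'_def)
    have WN: "W (N x) = W x" for x
      by (rule partial_isometry_initial[OF WB pN]) (use WW in \<open>auto intro: blinfun_eqI simp: W'_def\<close>)
    have W'N: "W' (N x) = W' x" for x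
      unfolding W'_def by (rule adj_absorb[OF WB pN NW])
    have NW': "N (W' x) = W' x" for x
      by (rule inner_eqI) (simp add: W'_def inner_proj[OF pN] inner_adj'[OF WB] WN)
    have iW: "inner (W x) z = inner x (W' z)" and iW': "inner (W' x) z = inner x (W z)" for x z
      by (simp_all add: W'_def inner_adj[OF WB] inner_adj'[OF WB])
    define D where "D = N - (W o\<^sub>L W')"
    have DA: "D \<in> A" using NA WA W'A by (simp add: D_def)
    have D: "D x = N x - W (W' x)" for x by (simp add: D_def blinfun.diff_left)
    have pD: "proj_op D"
      unfolding D_def
    proof (rule proj_op_diff[OF pN])
      show "proj_op (W o\<^sub>L W')"
        unfolding W'_def by (rule partial_isometry_proj_op[OF WB pN]) (use WW in \<open>auto intro: blinfun_eqI simp: W'_def\<close>)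
    qed (simp add: NW)
    have DW: "D (W x) = 0" for x by (simp add: D WW WN NW)
    have W'D: "W' (D x) = 0" for x by (simp add: D blinfun.diff_right W'N WW NW')
    have ND: "N (D x) = D x" for x using pN by (simp add: D blinfun.diff_right NW)
    have DN: "D (N x) = D x" for x by (rule proj_le_commute[OF pN pD ND])
    have "\<exists>T\<in>A. \<forall>x. T x = (blinfun_apply W' ^^ n) x" for n
    proof (induction n)
      case (Suc n)
      then obtain T where "T \<in> A" "\<forall>x. T x = (blinfun_apply W' ^^ n) x" by blast
      then show ?case using W'A by (intro bexI[of _ "W' o\<^sub>L T"]) auto
    qed (auto intro!: bexI[of _ id_blinfun])
    then obtain R where RA: "\<And>n. R n \<in> A" and R: "\<And>n x. R n x = (blinfun_apply W' ^^ n) x" by metis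
    have RS: "R (Suc n) x = R n (W' x)" for n x by (simp add: R funpow_swap1)
    have RS': "R (Suc n) x = W' (R n x)" for n x by (simp add: R)
    have R0: "R 0 x = x" for x by (simp add: R)
    define L where "L n = adj (R n)" for n
    have LS: "L (Suc n) x = W (L n x)" for n x
      unfolding L_def
      by (rule inner_eqI) (simp add: inner_adj'[OF A_bounded_ops[OF RA]] RS iW)
    have L0: "L 0 x = x" for x
      unfolding L_def
      by (rule inner_eqI) (simp add: inner_adj'[OF A_bounded_ops[OF RA]] R0)
    have NL: "N (L n (D x)) = L n (D x)" for n x
      by (cases n) (simp_all add: L0 LS ND NW)
    have R_zero: "R n 0 = 0" for n by (simp add: blinfun.zero_right)
    \<comment> \<open>Orthogonality of the ranges of \<open>W\<^sup>a D\<close> and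
      \<open>W\<^sup>b D\<close>: cancelling \<open>W' W = N\<close> lowers both exponents until one
      is 0, and then \<open>D W = 0\<close> or \<open>W' D = 0\<close> applies.\<close>
    have DRLD: "D (R a (L b (D x))) = 0" if "a \<noteq> b" for a b x
      using that
    proof (induction a arbitrary: b)
      case 0
      then show ?case by (cases b) (simp_all add: R0 LS DW)
    next
      case (Suc a)
      then show ?case
        by (cases b) (simp_all add: L0 LS RS W'D R_zero blinfun.zero_right WW NL)
    qed
    \<comment> \<open>The complement of the span of the even ranges is the common kernel of the
      adjoints \<open>D o\<^sub>L R (2 * i)\<close>.\<close>
    obtain K where KA: "K \<in> A" and pK: "proj_op K"
      and K: "\<And>x. K x = x \<longleftrightarrow> (\<forall>T\<in>range (\<lambda>i. D o\<^sub>L R (2 * i)). blinfun_apply T x = 0)"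
      using common_kernel[of "range (\<lambda>i. D o\<^sub>L R (2 * i))" thesis] DA RA by (auto simp: image_subset_iff)
    have K: "K x = x \<longleftrightarrow> (\<forall>i. D (R (2 * i) x) = 0)" for x using K[of x] by auto
    have KK: "D (R (2 * i) (K x)) = 0" for i x
      using K[of "K x"] pK by simp
    define G where "G = id_blinfun - K"
    have GA: "G \<in> A" using KA by (simp add: G_def)
    have pG: "proj_op G" unfolding G_def by (rule proj_op_compl[OF pK])
    have G: "G x = x - K x" for x by (simp add: G_def blinfun.diff_left)
    have G0: "G x = 0 \<longleftrightarrow> (\<forall>i. D (R (2 * i) x) = 0)" for x
      unfolding G using K by (metis eq_iff_diff_eq_0)
    have DG: "D (G x) = D x" for x
      using KK[of 0 x] by (simp add: G R0 blinfun.diff_right)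
    have "G (x - N x) = 0" for x
    proof -
      have "R n (x - N x) = (if n = 0 then x - N x else 0)" for n
        by (cases n) (simp_all add: R0 RS blinfun.diff_right W'N blinfun.zero_right)
      then show ?thesis unfolding G0 by (simp add: blinfun.diff_right DN blinfun.zero_right)
    qed
    then have GN: "G (N x) = G x" for x by (simp add: blinfun.diff_right)
    then have NG: "N (G x) = G x" for x
      by (intro inner_eqI[of "N (G x)"]) (simp add: inner_proj[OF pG] inner_proj[OF pN])
    have "G (W' (W' (K x))) = 0" for x
      unfolding G0
    proof
      fix i
      have "R (2 * i) (W' (W' (K x))) = R (2 * Suc i) (K x)" by (simp add: RS)
      then show "D (R (2 * i) (W' (W' (K x)))) = 0" using KK[of "Suc i" x] by simp
    qed
    \<comment> \<open>The adjoint of the preceding fact: \<open>W' W'\<close> preserves the range of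
      \<open>K\<close>, so \<open>W W\<close> preserves that of \<open>G\<close>.\<close>
    then have "K (W (W (G x))) = 0" for x
      by (intro inner_eqI[of "K (W (W (G x)))"]) (simp add: inner_proj[OF pG] inner_proj[OF pK] iW)
    then have GWWG: "G (W (W (G x))) = W (W (G x))" for x by (simp add: G[of "W (W (G x))"])
    have GLD: "G (L (Suc (2 * j)) (D x)) = 0" for j x
      unfolding G0
    proof
      fix i
      have "2 * i \<noteq> Suc (2 * j)" by presburger
      then show "D (R (2 * i) (L (Suc (2 * j)) (D x))) = 0" by (rule DRLD)
    qed
    have DRG: "D (R (Suc (2 * j)) (G x)) = 0" for j x
    proof (rule inner_eqI)
      fix z
      have "inner (D (R (Suc (2 * j)) (G x))) z = inner x (G (L (Suc (2 * j)) (D z)))"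
        by (simp add: inner_proj[OF pD] inner_proj[OF pG] L_def inner_adj[OF A_bounded_ops[OF RA]])
      then show "inner (D (R (Suc (2 * j)) (G x))) z = inner 0 z" by (simp only: GLD inner_zero_left inner_zero_right)
    qed
    \<comment> \<open>\<open>W\<close> moves the even part to the odd part, so \<open>G'\<close> is
      orthogonal to \<open>G\<close>. For index 0 this is \<open>D W = 0\<close>; for larger indices
      one \<open>W'\<close> cancels and an odd power remains.\<close>
    have GWG: "G (W (G x)) = 0" for x
      unfolding G0
    proof
      fix i
      show "D (R (2 * i) (W (G x))) = 0"
      proof (cases i)
        case (Suc j)
        have "R (2 * i) (W (G x)) = R (Suc (2 * j)) (G x)"
          using Suc by (simp add: RS WW NG)
        then show ?thesis by (simp only: DRG)
      qed (simp add: R0 DW)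
    qed
    define G' where "G' = W o\<^sub>L (G o\<^sub>L W')"
    have G'A: "G' \<in> A" using WA W'A GA by (simp add: G'_def)
    have G': "G' x = W (G (W' x))" for x by (simp add: G'_def)
    have pG': "proj_op G'"
      using G'A pG by (intro proj_opI) (simp_all add: G' WW NG iW iW' inner_proj)
    have GG': "G (G' x) = 0" for x by (simp add: G' GWG)
    note G'G = proj_orth_commute[OF pG pG' GG']
    have NG': "N (G' x) = G' x" for x by (simp add: G' NW)
    have fixed: "\<exists>K\<in>A. proj_op K \<and> (\<forall>x. K x = x \<longleftrightarrow> S x = x \<and> T x = x)"
      if "S \<in> A" "T \<in> A" for S T :: "'a \<Rightarrow>\<^sub>L 'a"
    proof -
      have "{id_blinfun - S, id_blinfun - T} \<subseteq> A" using that by simp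
      then obtain K where K: "K \<in> A" "proj_op K"
        "\<And>x. K x = x \<longleftrightarrow> (\<forall>T\<in>{id_blinfun - S, id_blinfun - T}. blinfun_apply T x = 0)"
        using common_kernel[of "{id_blinfun - S, id_blinfun - T}" thesis] by blast
      have "K x = x \<longleftrightarrow> S x = x \<and> T x = x" for x
        using K(3)[of x] by (simp add: blinfun.diff_left eq_commute[of x])
      then show ?thesis using K(1,2) by blast
    qed
    obtain e where e: "e \<in> A" "proj_op e" "\<And>x. e x = x \<longleftrightarrow> G x = x \<and> P x = x"
      using fixed[OF GA PA] by blast
    obtain f where f: "f \<in> A" "proj_op f" "\<And>x. f x = x \<longleftrightarrow> G' x = x \<and> Q x = x"
      using fixed[OF G'A QA] by blast
    have Ge: "G (e x) = e x" "P (e x) = e x" for x using e(3)[of "e x"] e(2) by simp_all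
    have G'f: "G' (f x) = f x" "Q (f x) = f x" for x using f(3)[of "f x"] f(2) by simp_all
    obtain Z U U' where Z: "Z \<in> A" "proj_op Z" "\<And>T x. T \<in> A \<Longrightarrow> Z (blinfun_apply T x) = T (Z x)"
      and U: "U \<in> A" "\<And>x. adj U (U x) = Z (e x)" "\<And>x. f (blinfun_apply U x) = U x"
      and U': "U' \<in> A" "\<And>x. adj U' (U' x) = f x - Z (f x)" "\<And>x. e (blinfun_apply U' x) = U' x"
      using comparison[OF e(1,2) f(1,2), of thesis] by blast
    have PQN: "P x + Q x = N x" for x by (simp add: N_def blinfun.add_left)
    have f_G: "f (G x) = 0" for x
      using proj_le_commute[OF pG' f(2) G'f(1), of "G x"] by (simp add: G'G blinfun.zero_right)
    have e_G': "e (G' x) = 0" for x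
      using proj_le_commute[OF pG e(2) Ge(1), of "G' x"] by (simp add: GG' blinfun.zero_right)
    have fin1: "fin (Z o\<^sub>L G)"
      using central_part_subequivalent[OF PA pP Q PQ GA pG _ e f(2) G'f(2) f_G Z U]
      by (simp add: PQN NG)
    define Z1 where "Z1 = id_blinfun - Z"
    have Z1A: "Z1 \<in> A" using Z by (simp add: Z1_def)
    have pZ1: "proj_op Z1" unfolding Z1_def by (rule proj_op_compl[OF Z(2)])
    have Z1: "Z1 x = x - Z x" for x by (simp add: Z1_def blinfun.diff_left)
    have Z1c: "Z1 (T x) = T (Z1 x)" if "T \<in> A" for T :: "'a \<Rightarrow>\<^sub>L 'a" and x
      by (simp add: Z1 Z(3)[OF that] blinfun.diff_right)
    \<comment> \<open>The same argument with \<open>P\<close> and \<open>Q\<close>, \<open>G\<close>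
      and \<open>G'\<close>, \<open>e\<close> and \<open>f\<close> interchanged, on the
      complementary central part, where \<open>U'\<close> carries \<open>f\<close> into
      \<open>e\<close>.\<close>
    have fin2: "fin (Z1 o\<^sub>L G')"
      using central_part_subequivalent[OF QA pQ P QP G'A pG' _ f e(2) Ge(2) e_G' Z1A pZ1 Z1c U'(1) _ U'(3)]
      by (simp add: PQN add.commute[of "Q _"] NG' Z1 U'(2))
    \<comment> \<open>Because \<open>Z1\<close> is central, \<open>W\<close> carries
      \<open>Z1 G\<close> isometrically into \<open>Z1 G'\<close>.\<close>
    have fin3: "fin (Z1 o\<^sub>L G)"
    proof (rule fin_subequivalent[OF fin2])
      show "W o\<^sub>L (Z1 o\<^sub>L G) \<in> A" using WA Z1A GA by simp
      show pZ1G: "proj_op (Z1 o\<^sub>L G)" by (rule proj_op_compose[OF pZ1 pG Z1c[OF GA]])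
      have "adj (W o\<^sub>L (Z1 o\<^sub>L G)) = (Z1 o\<^sub>L G) o\<^sub>L W'"
        using WA Z1A GA pZ1G by (simp add: adj_compose W'_def)
      then show "adj (W o\<^sub>L (Z1 o\<^sub>L G)) ((W o\<^sub>L (Z1 o\<^sub>L G)) x) = (Z1 o\<^sub>L G) x" for x
        using pG pZ1 by (simp add: WW Z1c[OF GA] Z1c[OF NA] NG)
      show "(Z1 o\<^sub>L G') ((W o\<^sub>L (Z1 o\<^sub>L G)) x) = (W o\<^sub>L (Z1 o\<^sub>L G)) x" for x
        using pG pZ1 by (simp add: G' WW Z1c[OF GA] Z1c[OF NA] Z1c[OF WA] NG)
    qed
    have central: "C (D x) = 0"
      if C: "C \<in> A" "proj_op C" "\<And>T x. T \<in> A \<Longrightarrow> C (blinfun_apply T x) = T (C x)" and fin: "fin (C o\<^sub>L G)"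
      for C :: "'a \<Rightarrow>\<^sub>L 'a" and x
    proof -
      \<comment> \<open>The shift by two cut down to \<open>C G\<close>. Finiteness makes it onto,
        yet its adjoint kills the range of \<open>D\<close>, which lies below \<open>G\<close>; so
        \<open>C D = 0\<close>.\<close>
      define V where "V = W o\<^sub>L (W o\<^sub>L (C o\<^sub>L G))"
      have VA: "V \<in> A" using WA C GA by (simp add: V_def)
      have "adj V = (C o\<^sub>L G) o\<^sub>L (W' o\<^sub>L W')"
        using WA C(1) GA fin_proj_op[OF fin]
        by (simp add: V_def adj_compose W'_def) (rule blinfun_eqI, simp add: C(3)[OF GA] C(2) pG C(1))
      then have V': "adj V x = C (G (W' (W' x)))" for x by simp
      have V: "V x = W (W (C (G x)))" for x by (simp add: V_def)
      have "V (adj V x) = (C o\<^sub>L G) x" for x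
      proof (rule fin_D[OF fin VA])
        show "(C o\<^sub>L G) (V x) = V x" for x
          using C(2) pG by (simp add: V C(3)[OF GA] C(3)[OF WA] GWWG)
        show "adj V (V x) = (C o\<^sub>L G) x" for x
          using C(2) pG by (simp add: V V' WW NW C(3)[OF GA] C(3)[OF NA] NG)
      qed
      from this[of "D x"] have "V (adj V (D x)) = C (G (D x))" by simp
      moreover have "V (adj V (D x)) = 0"
        by (simp add: V' W'D blinfun.zero_right)
      moreover have "G (D x) = D x"
        by (rule inner_eqI) (simp add: inner_proj[OF pG] inner_proj[OF pD] DG)
      ultimately show ?thesis by simp
    qed
    have "Z (D x) = 0" by (rule central[OF Z fin1])
    moreover have "Z1 (D x) = 0" by (rule central[OF Z1A pZ1 Z1c fin3])
    ultimately have "D x = 0" by (simp add: Z1)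
    then show ?thesis by (simp add: D W'_def)
  qed
  then show ?thesis using NA pN by (auto simp: fin_def N_def)
qed

text \<open>The complement of a common kernel is the join of the supports, each of them finite
  because \<open>X k\<close> maps into \<open>E\<close>. The induction adds one support at a time in
  orthogonal form, so that \<open>fin_add\<close> applies.\<close>

lemma fin_common_kernel_compl:
  fixes E K :: "'a \<Rightarrow>\<^sub>L 'a" and X :: "nat \<Rightarrow> 'a \<Rightarrow>\<^sub>L 'a"
  assumes E: "fin E" and X: "\<And>k. X k \<in> A" "\<And>k x. E (X k x) = X k x"
    and K: "K \<in> A" "proj_op K" "\<And>x. (\<forall>k<n. X k x = 0) \<Longrightarrow> K x = x"
  shows "fin (id_blinfun - K)"
  using K
proof (induction n arbitrary: K)
  case 0
  then have "id_blinfun - K = 0" by (intro blinfun_eqI) (simp add: blinfun.diff_left)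
  then show ?case using fin_zero[OF E] by simp
next
  case (Suc n)
  have "X ` {..<n} \<subseteq> A" using X by auto
  then obtain K0 where K0A: "K0 \<in> A" and pK0: "proj_op K0"
    and K0: "\<And>x. K0 x = x \<longleftrightarrow> (\<forall>T\<in>X ` {..<n}. blinfun_apply T x = 0)"
    using common_kernel[of "X ` {..<n}" thesis] by blast
  have K0: "K0 x = x \<longleftrightarrow> (\<forall>k<n. X k x = 0)" for x using K0[of x] by auto
  define P where "P = id_blinfun - K0"
  have P: "fin P" unfolding P_def by (rule Suc.IH[OF K0A pK0]) (simp add: K0)
  \<comment> \<open>Restricting \<open>X n\<close> to the common kernel of its predecessors makes
    the new support orthogonal to \<open>P\<close>.\<close>
  define T where "T = X n o\<^sub>L K0"
  have TA: "T \<in> A" using X K0A by (simp add: T_def)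
  have ker: "closed {x. T x = 0}" "csubspace {x. T x = 0}"
    using TA by (simp_all add: closed_kernel csubspace_kernel)
  define r where "r = id_blinfun - proj_onto {x. T x = 0}"
  have r: "fin r" unfolding r_def by (rule support_subprojection[OF TA E]) (simp add: T_def X)
  have r0: "r x = 0 \<longleftrightarrow> T x = 0" for x
    using proj_onto_id_iff[OF ker, of x] by (auto simp: r_def blinfun.diff_left)
  have "T (P x) = 0" for x
    using pK0 by (simp add: T_def P_def blinfun.diff_left blinfun.diff_right blinfun.zero_right)
  then have "r (P x) = 0" for x by (simp only: r0)
  then have Pr: "P (r x) = 0" for x
    by (rule proj_orth_commute[OF fin_proj_op[OF r] fin_proj_op[OF P]])
  have sum: "fin (P + r)" by (rule fin_add[OF P r Pr])
  \<comment> \<open>A vector orthogonal to both \<open>P\<close> and \<open>r\<close> lies in all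
    the kernels, hence in the range of \<open>K\<close>. So \<open>id_blinfun - K\<close> lies below
    the finite projection \<open>P + r\<close>.\<close>
  define S where "S = id_blinfun - (P + r)"
  have pS: "proj_op S" unfolding S_def by (rule proj_op_compl[OF fin_proj_op[OF sum]])
  have S: "S x = x - (P x + r x)" for x by (simp add: S_def blinfun.diff_left blinfun.add_left)
  have "K (S x) = S x" for x
  proof -
    have "P (S x) + r (S x) = 0" using S[of "S x"] pS by (simp add: algebra_simps)
    moreover from this have "P (P (S x) + r (S x)) = 0" by (simp add: blinfun.zero_right)
    then have P0: "P (S x) = 0" using fin_proj_op[OF P] by (simp add: blinfun.add_right Pr)
    ultimately have "T (S x) = 0" by (simp add: r0)
    moreover have K0S: "K0 (S x) = S x" using P0 by (simp add: P_def blinfun.diff_left)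
    ultimately have "X n (S x) = 0" by (simp add: T_def)
    then have "\<forall>k<Suc n. X k (S x) = 0" using K0S K0 by (simp add: less_Suc_eq)
    then show ?thesis by (rule Suc.prems(3))
  qed
  note SK = proj_le_commute[OF Suc.prems(2) pS this]
  show ?case
  proof (rule fin_mono[OF sum])
    show "id_blinfun - K \<in> A" using Suc.prems by simp
    show "proj_op (id_blinfun - K)" by (rule proj_op_compl[OF Suc.prems(2)])
    have "S (x - K x) = 0" for x by (simp add: blinfun.diff_right SK)
    then show "(P + r) ((id_blinfun - K) x) = (id_blinfun - K) x" for x
      using S[of "x - K x"] by (simp add: blinfun.diff_left blinfun.add_left)
  qed
qed

end

section \<open>Uniform boundedness\<close>

text \<open>If \<open>U\<close> were unbounded, one could choose \<open>u n\<close> in \<open>U\<close> with norm at least \<open>4 ^ n\<close>; the series of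
  the vectors \<open>\<plusminus> sgn (u n) / 3 ^ n\<close>, with signs chosen so that nothing cancels, then converges to a
  point at which \<open>U\<close> is not bounded.\<close>

lemma bounded_if_weakly_bounded:
  fixes U :: "'a::{real_inner,banach} set"
  assumes weak: "\<And>y. \<exists>M. \<forall>u\<in>U. \<bar>inner y u\<bar> \<le> M"
  shows "\<exists>C. \<forall>u\<in>U. norm u \<le> C"
proof (rule ccontr)
  assume "\<not> ?thesis"
  then have "\<exists>u\<in>U. norm u \<ge> 4 ^ n" for n :: nat by (meson less_imp_le not_le)
  then obtain u where uU: "\<And>n. u n \<in> U" and un: "\<And>n::nat. norm (u n) \<ge> 4 ^ n" by metis
  define s where "s n y = (if inner y (u n) \<ge> 0 then 1 else (-1::real))" for n y
  define z where "z = rec_nat 0 (\<lambda>n y. y + (s (Suc n) y * (1/3) ^ Suc n) *\<^sub>R sgn (u (Suc n)))"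
  have zS: "z (Suc n) = z n + (s (Suc n) (z n) * (1/3) ^ Suc n) *\<^sub>R sgn (u (Suc n))" for n
    by (simp add: z_def)
  have u0: "u n \<noteq> 0" for n using un[of n] by (metis norm_zero not_le zero_less_numeral zero_less_power)
  have step: "norm (z (Suc n) - z n) \<le> (1/3) ^ Suc n" for n
    using u0[of "Suc n"] by (simp add: zS s_def norm_sgn)
  have big: "\<bar>inner (z (Suc n)) (u (Suc n))\<bar> \<ge> (1/3) ^ Suc n * norm (u (Suc n))" for n
  proof -
    have "inner (sgn (u (Suc n))) (u (Suc n)) = norm (u (Suc n))"
      using u0[of "Suc n"] by (simp add: sgn_div_norm norm_eq_sqrt_inner field_simps)
    then have "inner (z (Suc n)) (u (Suc n)) =
        inner (z n) (u (Suc n)) + s (Suc n) (z n) * ((1/3) ^ Suc n * norm (u (Suc n)))"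
      by (simp add: zS inner_add_left)
    moreover have "(1/3) ^ Suc n * norm (u (Suc n)) \<ge> 0" by simp
    moreover have "s (Suc n) (z n) = 1 \<and> inner (z n) (u (Suc n)) \<ge> 0 \<or>
        s (Suc n) (z n) = -1 \<and> inner (z n) (u (Suc n)) < 0"
      by (auto simp: s_def)
    moreover have "t \<le> \<bar>a + c * t\<bar>" if "t \<ge> 0" "c = 1 \<and> a \<ge> 0 \<or> c = -1 \<and> a < 0" for a c t :: real
      using that by auto
    ultimately show ?thesis by presburger
  qed
  have steps: "norm (z (n + k) - z n) \<le> (1/2) * (1/3) ^ n * (1 - (1/3) ^ k)" for n k
  proof (induction k)
    case (Suc k)
    have "norm (z (n + Suc k) - z n) \<le> norm (z (Suc (n + k)) - z (n + k)) + norm (z (n + k) - z n)"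
      using norm_triangle_ineq[of "z (Suc (n + k)) - z (n + k)" "z (n + k) - z n"] by simp
    also have "\<dots> \<le> (1/3) ^ Suc (n + k) + (1/2) * (1/3) ^ n * (1 - (1/3) ^ k)"
      by (intro add_mono step Suc)
    also have "\<dots> = (1/2) * (1/3) ^ n * (1 - (1/3) ^ Suc k)"
      by (simp add: power_add field_simps)
    finally show ?case .
  qed simp
  have steps': "norm (z m - z n) \<le> (1/2) * (1/3) ^ n" if "n \<le> m" for m n
  proof -
    have "(1/2) * (1/3) ^ n * (1 - (1/3) ^ (m - n)) \<le> (1/2) * (1/3::real) ^ n * 1"
      by (intro mult_left_mono) auto
    with steps[of n "m - n"] have "norm (z (n + (m - n)) - z n) \<le> (1/2) * (1/3) ^ n * 1"
      by (rule order_trans)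
    then show ?thesis using that by simp
  qed
  have "Cauchy z"
  proof (rule metric_CauchyI)
    fix e :: real assume "e > 0"
    then obtain N where N: "(1/3) ^ N < e" using real_arch_pow_inv[of e "1/3"] by auto
    have "dist (z m) (z n) < e" if "m \<ge> N" "n \<ge> N" for m n
      using norm_triangle_ineq4[of "z m - z N" "z n - z N"] steps'[OF that(1)] steps'[OF that(2)] N
      by (simp add: dist_norm)
    then show "\<exists>M. \<forall>m\<ge>M. \<forall>n\<ge>M. dist (z m) (z n) < e" by blast
  qed
  then obtain y where y: "z \<longlonglongrightarrow> y" using Cauchy_convergent_iff convergent_def by blast
  have yz: "norm (y - z n) \<le> (1/2) * (1/3) ^ n" for n
  proof (rule Lim_bounded)
    show "(\<lambda>m. norm (z m - z n)) \<longlonglongrightarrow> norm (y - z n)" by (intro tendsto_intros y)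
    show "\<forall>m\<ge>n. norm (z m - z n) \<le> (1/2) * (1/3) ^ n" using steps' by simp
  qed
  obtain M where M: "\<And>n. \<bar>inner y (u n)\<bar> \<le> M" using weak[of y] uU by blast
  \<comment> \<open>The terms after index \<open>Suc n\<close> have total norm at most half that of
    the term at \<open>Suc n\<close>, so they cancel at most half of its contribution. The other
    half grows like \<open>(4/3) ^ Suc n\<close>, because 4 exceeds 3.\<close>
  have le: "(1/2) * (4/3) ^ Suc n \<le> M" for n
  proof -
    have "\<bar>inner (y - z (Suc n)) (u (Suc n))\<bar> \<le> norm (y - z (Suc n)) * norm (u (Suc n))"
      by (rule Cauchy_Schwarz_ineq2)
    also have "\<dots> \<le> ((1/2) * (1/3) ^ Suc n) * norm (u (Suc n))"
      by (intro mult_right_mono yz) simp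
    finally have "\<bar>inner y (u (Suc n)) - inner (z (Suc n)) (u (Suc n))\<bar>
        \<le> (1/2) * ((1/3) ^ Suc n * norm (u (Suc n)))"
      by (simp only: inner_diff_left mult.assoc)
    moreover have "(1/2) * t \<le> \<bar>b\<bar>" if "\<bar>b - a\<bar> \<le> (1/2) * t" "t \<le> \<bar>a\<bar>" for a b t :: real
      using that by linarith
    ultimately have "(1/2) * ((1/3) ^ Suc n * norm (u (Suc n))) \<le> \<bar>inner y (u (Suc n))\<bar>"
      using big[of n] by blast
    moreover have "(1/3) ^ Suc n * 4 ^ Suc n \<le> (1/3) ^ Suc n * norm (u (Suc n))"
      by (intro mult_left_mono un) simp
    moreover have "(1/3::real) ^ Suc n * 4 ^ Suc n = (4/3) ^ Suc n"
      by (simp only: power_mult_distrib[symmetric]) simp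
    ultimately show ?thesis using M[of "Suc n"] by linarith
  qed
  obtain n where "2 * M < (4/3) ^ n" using real_arch_pow[of "4/3" "2 * M"] by auto
  moreover have "(4/3::real) ^ n \<le> (4/3) ^ Suc n" by (intro power_increasing) auto
  ultimately show False using le[of n] by linarith
qed

text \<open>Solving \<open>T s = y - E y\<close> gives
  \<open>inner y (x - E x) = inner s (adj T x)\<close>. So the vectors \<open>x - E x\<close> with
  \<open>adj T x\<close> in the unit ball are weakly bounded, and homogeneity removes the
  restriction on \<open>x\<close>.\<close>

lemma adjoint_bounded_below_modulo_projection:
  fixes T E :: "'a::complex_hilbert_space \<Rightarrow>\<^sub>L 'a"
  assumes T: "T \<in> bounded_ops" and E: "proj_op E" and ran: "range (id_blinfun - E) \<subseteq> range T"
  shows "\<exists>C>0. \<forall>x. norm (x - E x) \<le> C * norm (adj T x)"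
proof -
  define U where "U = {x - E x |x. norm (adj T x) \<le> 1}"
  have "\<exists>M. \<forall>u\<in>U. \<bar>inner y u\<bar> \<le> M" for y
  proof -
    have "y - E y = (id_blinfun - E) y" by (simp add: blinfun.diff_left)
    moreover have "(id_blinfun - E) y \<in> range T" using ran by blast
    ultimately obtain s where s: "y - E y = T s" by auto
    have "\<bar>inner y (x - E x)\<bar> \<le> norm s" if "norm (adj T x) \<le> 1" for x
    proof -
      have "inner y (x - E x) = inner (T s) x"
        by (simp add: s[symmetric] inner_diff_left inner_diff_right inner_proj[OF E])
      also have "\<dots> = inner s (adj T x)" by (rule inner_adj[OF T])
      finally have "\<bar>inner y (x - E x)\<bar> \<le> norm s * norm (adj T x)"
        by (simp add: Cauchy_Schwarz_ineq2)
      also have "\<dots> \<le> norm s * 1" using that by (intro mult_left_mono) auto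
      finally show ?thesis by simp
    qed
    then show ?thesis by (auto simp: U_def)
  qed
  then obtain C where C: "\<And>u. u \<in> U \<Longrightarrow> norm u \<le> C" using bounded_if_weakly_bounded[of U] by blast
  have le: "norm (x - E x) \<le> C" if "norm (adj T x) \<le> 1" for x
    by (rule C) (use that in \<open>auto simp: U_def\<close>)
  have scaled: "\<bar>t\<bar> * norm (x - E x) \<le> C" if "\<bar>t\<bar> * norm (adj T x) \<le> 1" for t x
    using le[of "t *\<^sub>R x"] that by (simp add: blinfun.scaleR_right flip: scaleR_diff_right)
  have C0: "C \<ge> 0" using le[of 0] by (simp add: blinfun.zero_right)
  \<comment> \<open>The added 1 makes the constant positive. If \<open>adj T x = 0\<close>, every
    multiple of \<open>x\<close> is admissible, which forces \<open>x - E x = 0\<close>.\<close>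
  have "norm (x - E x) \<le> (C + 1) * norm (adj T x)" for x
  proof (cases "adj T x = 0")
    case True
    have "x - E x = 0"
    proof (rule ccontr)
      assume "x - E x \<noteq> 0"
      then show False using scaled[of "(C + 1) / norm (x - E x)" x] C0 True by simp
    qed
    then show ?thesis using True by simp
  next
    case False
    then have "norm (x - E x) \<le> C * norm (adj T x)"
      using scaled[of "1 / norm (adj T x)" x] by (simp add: field_simps)
    also have "\<dots> \<le> (C + 1) * norm (adj T x)" by (simp add: mult_right_mono)
    finally show ?thesis .
  qed
  then show ?thesis using C0 by (intro exI[of _ "C + 1"]) auto
qed

section \<open>Resolvents and Riesz projections\<close>

text \<open>The value of the inverse at \<open>y\<close> is the unique fixed point of the
  contraction sending \<open>x\<close> to \<open>y + X x\<close>; uniqueness makes it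
  linear.\<close>

lemma neumann_inverse:
  fixes X :: "'a::complex_hilbert_space \<Rightarrow>\<^sub>L 'a"
  assumes X: "X \<in> bounded_ops" and lt: "norm X < 1"
  shows "\<exists>Y\<in>bounded_ops. (\<forall>x. Y (x - X x) = x) \<and> (\<forall>x. Y x - X (Y x) = x)"
proof -
  have ex1: "\<exists>!x. y + X x = x" for y
  proof (rule banach_fix_type[of "norm X"])
    show "\<forall>a b. dist (y + X a) (y + X b) \<le> norm X * dist a b"
      using norm_blinfun[of X] by (simp add: dist_norm flip: blinfun.diff_right)
  qed (use lt in auto)
  then obtain g where g: "\<And>y. y + X (g y) = g y" by metis
  have uniq: "g y = x" if "y = x - X x" for x y
  proof -
    have "y + X x = x" using that by simp
    then show ?thesis using ex1[of y] g[of y] by blast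
  qed
  have gx: "y = g y - X (g y)" for y using g[of y] by (metis add_diff_cancel)
  have add: "g (x + y) = g x + g y" for x y
    by (rule uniq) (subst (1) gx[of x], subst (1) gx[of y], simp add: blinfun.add_right)
  have sC: "g (c *\<^sub>C x) = c *\<^sub>C g x" for c x
    by (rule uniq) (subst (1) gx[of x], simp add: bounded_opsD[OF X] scaleC_diff_right)
  have "norm (g y) \<le> norm y * inverse (1 - norm X)" for y
  proof -
    have "norm (g y) \<le> norm y + norm (X (g y))" by (metis g norm_triangle_ineq)
    also have "\<dots> \<le> norm y + norm X * norm (g y)" by (intro add_left_mono norm_blinfun)
    finally show ?thesis using lt by (simp add: field_simps)
  qed
  then have "bounded_linear g"
    using sC[of "of_real _"] by (intro bounded_linear_intro[where K = "inverse (1 - norm X)"] add)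
      (auto simp: scaleC_of_real)
  then have G: "blinfun_apply (Blinfun g) = g" by (rule bounded_linear_Blinfun_apply)
  show ?thesis
    using sC gx uniq by (intro bexI[of _ "Blinfun g"] bounded_opsI) (auto simp: G)
qed

section \<open>The resolvent and its analyticity\<close>

locale resolvent_op =
  fixes F :: "'a::complex_hilbert_space \<Rightarrow>\<^sub>L 'a"
  assumes F: "F \<in> bounded_ops"
begin

abbreviation R :: "complex \<Rightarrow> 'a \<Rightarrow>\<^sub>L 'a" where
  "R \<equiv> resolvent F"

text \<open>Spectrum and resolvent are defined through \<open>F - z\<close> and \<open>z - F\<close>
  respectively; this bridges the sign.\<close>

lemma not_in_op_spectrumI:
  assumes "S \<in> bounded_ops" "\<And>x. blinfun_apply S (z *\<^sub>C x - F x) = x" "\<And>x. z *\<^sub>C S x - F (S x) = x"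
  shows "z \<notin> op_spectrum F"
proof -
  have "is_op_inverse (F - scalar_op z) (0 - S)"
    unfolding is_op_inverse_def
  proof (intro conjI blinfun_eqI)
    show "0 - S \<in> bounded_ops" using assms(1) by (intro bounded_ops_diff) auto
    show "((0 - S) o\<^sub>L (F - scalar_op z)) x = id_blinfun x" for x
      using assms(2)[of x] by (simp add: blinfun.diff_left blinfun.diff_right blinfun.minus_left)
    show "((F - scalar_op z) o\<^sub>L (0 - S)) x = id_blinfun x" for x
      using assms(3)[of x] by (simp add: blinfun.diff_left blinfun.minus_left blinfun.minus_right scaleC_minus_right)
  qed
  then show ?thesis by (auto simp: op_spectrum_def)
qed

lemma
  assumes z: "z \<notin> op_spectrum F"
  shows R_bounded_ops: "R z \<in> bounded_ops"
    and R_left: "R z (z *\<^sub>C x - F x) = x"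
    and R_right: "z *\<^sub>C R z x - F (R z x) = x"
proof -
  obtain S where S: "is_op_inverse (F - scalar_op z) S" using z by (auto simp: op_spectrum_def)
  have Sl: "S (F x - z *\<^sub>C x) = x" and Sr: "F (S x) - z *\<^sub>C S x = x" for x
  proof -
    have "(S o\<^sub>L (F - scalar_op z)) x = x" "((F - scalar_op z) o\<^sub>L S) x = x"
      using S by (simp_all add: is_op_inverse_def)
    then show "S (F x - z *\<^sub>C x) = x" "F (S x) - z *\<^sub>C S x = x"
      by (simp_all add: blinfun.diff_left)
  qed
  have inv: "is_op_inverse (scalar_op z - F) (0 - S)"
    unfolding is_op_inverse_def
  proof (intro conjI blinfun_eqI)
    show "0 - S \<in> bounded_ops" using S by (intro bounded_ops_diff) (auto simp: is_op_inverse_def)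
    show "((0 - S) o\<^sub>L (scalar_op z - F)) x = id_blinfun x" for x
      using Sl[of x] by (simp add: blinfun.diff_left blinfun.diff_right blinfun.minus_left)
    show "((scalar_op z - F) o\<^sub>L (0 - S)) x = id_blinfun x" for x
      using Sr[of x] by (simp add: blinfun.diff_left blinfun.minus_left blinfun.minus_right scaleC_minus_right)
  qed
  have "S' = 0 - S" if "is_op_inverse (scalar_op z - F) S'" for S'
  proof -
    have "S' = S' o\<^sub>L ((scalar_op z - F) o\<^sub>L (0 - S))"
      using inv by (auto simp: is_op_inverse_def intro: blinfun_eqI)
    also have "\<dots> = (S' o\<^sub>L (scalar_op z - F)) o\<^sub>L (0 - S)"
      by (simp add: blinfun_eqI)
    also have "\<dots> = 0 - S" using that by (auto simp: is_op_inverse_def intro: blinfun_eqI)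
    finally show ?thesis .
  qed
  then have "is_op_inverse (scalar_op z - F) (R z)"
    unfolding resolvent_def using inv by (rule theI[rotated])
  then have R: "R z \<in> bounded_ops" "R z o\<^sub>L (scalar_op z - F) = id_blinfun"
    "(scalar_op z - F) o\<^sub>L R z = id_blinfun"
    by (auto simp: is_op_inverse_def)
  show "R z \<in> bounded_ops" by fact
  show "R z (z *\<^sub>C x - F x) = x"
    using arg_cong[OF R(2), of "\<lambda>T. blinfun_apply T x"] by (simp add: blinfun.diff_left)
  show "z *\<^sub>C R z x - F (R z x) = x"
    using arg_cong[OF R(3), of "\<lambda>T. blinfun_apply T x"] by (simp add: blinfun.diff_left)
qed

lemma R_commute:
  fixes B :: "'a \<Rightarrow>\<^sub>L 'a"
  assumes z: "z \<notin> op_spectrum F" and B: "B \<in> bounded_ops" "\<And>x. B (F x) = F (B x)"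
  shows "R z (B x) = B (R z x)"
proof -
  have "R z (B x) = R z (B (z *\<^sub>C R z x - F (R z x)))" by (simp add: R_right[OF z])
  also have "\<dots> = R z (z *\<^sub>C B (R z x) - F (B (R z x)))"
    by (simp add: blinfun.diff_right bounded_opsD[OF B(1)] B(2))
  also have "\<dots> = B (R z x)" by (rule R_left[OF z])
  finally show ?thesis .
qed

lemma resolvent_identity:
  assumes z: "z \<notin> op_spectrum F" and w: "w \<notin> op_spectrum F"
  shows "R w x - R z x = (z - w) *\<^sub>C R w (R z x)"
proof -
  have "R w x - R z x = R w (z *\<^sub>C R z x - F (R z x)) - R w (w *\<^sub>C R z x - F (R z x))"
    by (simp add: R_right[OF z] R_left[OF w])
  also have "\<dots> = R w ((z - w) *\<^sub>C R z x)"
    using scaleC_add_left[of "z - w" w "R z x"] by (simp flip: blinfun.diff_right)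
  finally show ?thesis by (simp add: bounded_opsD[OF R_bounded_ops[OF w]])
qed

text \<open>\<open>w - F\<close> factors as \<open>z - F\<close> times \<open>1 - X\<close> with
  \<open>X = (z - w) R z\<close>, and the radius keeps the norm of \<open>X\<close> below 1.\<close>

lemma open_resolvent_set: "open (- op_spectrum F)"
  unfolding open_dist
proof
  fix z assume "z \<in> - op_spectrum F"
  then have z: "z \<notin> op_spectrum F" by simp
  define e where "e = inverse (norm (R z) + 1)"
  have e: "e > 0" unfolding e_def by (simp add: add_nonneg_pos)
  have "w \<notin> op_spectrum F" if w: "dist w z < e" for w
  proof -
    define X where "X = scalar_op (z - w) o\<^sub>L R z"
    have XB: "X \<in> bounded_ops" using R_bounded_ops[OF z] by (simp add: X_def)
    have Xx: "X x = (z - w) *\<^sub>C R z x" for x by (simp add: X_def)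
    have "norm X \<le> cmod (z - w) * norm (R z)"
      by (rule norm_blinfun_bound)
        (simp_all add: Xx norm_scaleC mult.assoc mult_left_mono norm_blinfun)
    also have "\<dots> \<le> e * norm (R z)"
      using w by (intro mult_right_mono) (auto simp: dist_norm norm_minus_commute)
    also have "\<dots> < 1" unfolding e_def using norm_ge_zero[of "R z"] by (simp add: field_simps add_pos_nonneg)
    finally obtain Y where Y: "Y \<in> bounded_ops" "\<And>x. Y (x - X x) = x" "\<And>x. Y x - X (Y x) = x"
      using neumann_inverse[OF XB] by blast
    have fact: "w *\<^sub>C x - F x = (z *\<^sub>C x - F x) - (z - w) *\<^sub>C x" for x
      using scaleC_add_left[of "z - w" w x] by (simp add: algebra_simps)
    have RF: "R z (F x) = F (R z x)" for x by (rule R_commute[OF z F]) simp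
    show ?thesis
    proof (rule not_in_op_spectrumI[of "Y o\<^sub>L R z"])
      show "Y o\<^sub>L R z \<in> bounded_ops" using Y R_bounded_ops[OF z] by simp
      show "(Y o\<^sub>L R z) (w *\<^sub>C x - F x) = x" for x
      proof -
        have "R z (w *\<^sub>C x - F x) = x - X x"
          by (simp only: fact blinfun.diff_right[of _ "_ - _"] R_left[OF z])
            (simp add: Xx bounded_opsD[OF R_bounded_ops[OF z]])
        then show ?thesis by (simp add: Y(2))
      qed
      show "w *\<^sub>C (Y o\<^sub>L R z) x - F ((Y o\<^sub>L R z) x) = x" for x
      proof -
        \<comment> \<open>For the right inverse, both sides are compared after applying
          \<open>R z\<close>, which \<open>z - F\<close> undoes.\<close>
        let ?y = "Y (R z x)"
        have "R z (w *\<^sub>C ?y - F ?y) = ?y - X ?y"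
          by (simp only: fact blinfun.diff_right[of _ "_ - _"] R_left[OF z])
            (simp add: Xx bounded_opsD[OF R_bounded_ops[OF z]])
        then have eq: "R z (w *\<^sub>C ?y - F ?y) = R z x" by (simp add: Y(3))
        have "w *\<^sub>C ?y - F ?y = z *\<^sub>C R z (w *\<^sub>C ?y - F ?y) - F (R z (w *\<^sub>C ?y - F ?y))"
          by (rule R_right[OF z, symmetric])
        also have "\<dots> = x" unfolding eq by (rule R_right[OF z])
        finally show ?thesis by simp
      qed
    qed
  qed
  then show "\<exists>e>0. \<forall>y. dist y z < e \<longrightarrow> y \<in> - op_spectrum F" using e by blast
qed

text \<open>By the resolvent identity the norm of \<open>R w - R z\<close> is at most
  \<open>cmod (w - z) * norm (R w) * norm (R z)\<close>. Near \<open>z\<close> this is at most half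
  of \<open>norm (R w)\<close>, which bounds \<open>R w\<close> by twice \<open>norm (R z)\<close>;
  then the same estimate tends to 0.\<close>

lemma continuous_on_R: "continuous_on (- op_spectrum F) R"
proof -
  have "\<forall>z\<in>- op_spectrum F. isCont R z"
  proof
    fix z assume "z \<in> - op_spectrum F"
    then have z: "z \<notin> op_spectrum F" by simp
    define K where "K = 2 * norm (R z) * norm (R z)"
    have ev: "\<forall>\<^sub>F w in at z. norm (R w - R z) \<le> cmod (w - z) * K"
    proof -
      have "\<forall>\<^sub>F w in at z. w \<in> - op_spectrum F"
        by (rule eventually_at_in_open'[OF open_resolvent_set \<open>z \<in> - _\<close>])
      moreover have "\<forall>\<^sub>F w in at z. dist w z < inverse (2 * (norm (R z) + 1))"
        by (rule eventually_at_ball'[THEN eventually_mono]) (auto simp: dist_commute add_nonneg_pos)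
      ultimately show ?thesis
      proof eventually_elim
        case (elim w)
        then have w: "w \<notin> op_spectrum F" by simp
        have diff: "norm (R w - R z) \<le> cmod (w - z) * norm (R w) * norm (R z)"
        proof (rule norm_blinfun_bound)
          fix x
          have "norm ((R w - R z) x) = cmod (w - z) * norm (R w (R z x))"
            by (simp add: blinfun.diff_left resolvent_identity[OF z w] norm_scaleC norm_minus_commute)
          also have "\<dots> \<le> cmod (w - z) * (norm (R w) * (norm (R z) * norm x))"
            by (intro mult_left_mono order_trans[OF norm_blinfun] norm_blinfun) simp_all
          finally show "norm ((R w - R z) x) \<le> cmod (w - z) * norm (R w) * norm (R z) * norm x"
            by (simp add: mult.assoc)
        qed simp
        have small: "cmod (w - z) * norm (R z) \<le> 1/2"
        proof -
          have "cmod (w - z) * norm (R z) \<le> inverse (2 * (norm (R z) + 1)) * (norm (R z) + 1)"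
            using elim(2) by (intro mult_mono) (auto simp: dist_norm)
          also have "\<dots> = 1/2" using norm_ge_zero[of "R z"] by (simp add: field_simps add_nonneg_eq_0_iff)
          finally show ?thesis .
        qed
        have "norm (R w) \<le> 2 * norm (R z)"
        proof -
          have "norm (R w) \<le> norm (R z) + norm (R w - R z)"
            by (metis norm_triangle_sub)
          also have "\<dots> \<le> norm (R z) + (cmod (w - z) * norm (R z)) * norm (R w)"
            using diff by (simp add: ac_simps)
          also have "\<dots> \<le> norm (R z) + 1/2 * norm (R w)"
            by (intro add_left_mono mult_right_mono small) simp
          finally show ?thesis by simp
        qed
        then have "norm (R w - R z) \<le> cmod (w - z) * (2 * norm (R z)) * norm (R z)"
          by (intro order_trans[OF diff] mult_right_mono mult_left_mono) simp_all
        then show ?case by (simp add: K_def ac_simps)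
      qed
    qed
    have "((\<lambda>w. cmod (w - z) * K) \<longlongrightarrow> cmod (z - z) * K) (at z)"
      by (intro tendsto_intros)
    then have "((\<lambda>w. cmod (w - z) * K) \<longlongrightarrow> 0) (at z)" by simp
    then have "((\<lambda>w. R w - R z) \<longlongrightarrow> 0) (at z)"
      by (rule Lim_null_comparison[OF ev])
    then show "isCont R z"
      unfolding isCont_def by (rule LIM_zero_cancel)
  qed
  then show ?thesis by (simp add: continuous_on_eq_continuous_at[OF open_resolvent_set])
qed

lemma tendsto_cinner_left:
  assumes "(f \<longlongrightarrow> l) G"
  shows "((\<lambda>w. cinner (f w) y) \<longlongrightarrow> cinner l (y::'a)) G"
  unfolding cinner_eq_Complex by (intro tendsto_intros assms)

text \<open>Testing with \<open>x\<close> and \<open>y\<close> reduces analyticity to scalar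
  functions. The resolvent identity gives the difference quotient, and continuity of
  \<open>R\<close> its limit.\<close>

lemma holomorphic_cinner_R: "(\<lambda>z. cinner (R z x) y) holomorphic_on - op_spectrum F"
  unfolding holomorphic_on_open[OF open_resolvent_set]
proof (intro ballI exI)
  fix z assume zc: "z \<in> - op_spectrum F"
  then have z: "z \<notin> op_spectrum F" by simp
  have "isCont R z"
    using continuous_on_R zc by (simp add: continuous_on_eq_continuous_at[OF open_resolvent_set])
  then have "((\<lambda>w. - cinner (R w (R z x)) y) \<longlongrightarrow> - cinner (R z (R z x)) y) (at z)"
    unfolding isCont_def by (intro tendsto_minus tendsto_cinner_left blinfun.tendsto tendsto_const)
  moreover have "\<forall>\<^sub>F w in at z. - cinner (R w (R z x)) y = (cinner (R w x) y - cinner (R z x) y) / (w - z)"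
  proof -
    have "\<forall>\<^sub>F w in at z. w \<in> - op_spectrum F"
      by (rule eventually_at_in_open'[OF open_resolvent_set zc])
    moreover have "\<forall>\<^sub>F w in at z. w \<noteq> z" by (simp add: eventually_at_filter)
    ultimately show ?thesis
    proof eventually_elim
      case (elim w)
      then have "cinner (R w x) y - cinner (R z x) y = (z - w) * cinner (R w (R z x)) y"
        by (simp add: resolvent_identity[OF z] cinner_scaleC_left flip: cinner_diff_left)
      then show ?case using elim(2) by (simp add: field_simps)
    qed
  qed
  ultimately show "((\<lambda>z. cinner (R z x) y) has_field_derivative - cinner (R z (R z x)) y) (at z)"
    unfolding has_field_derivative_iff by (rule Lim_transform_eventually)
qed

end

text \<open>Cauchy's formula for the n-th derivative of the constant function
  \<open>c\<close>.\<close>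

lemma has_contour_integral_inverse_power:
  assumes "r > 0"
  shows "((\<lambda>z. inverse (z - \<alpha>) ^ Suc n * c) has_contour_integral
    (if n = 0 then 2 * of_real pi * \<i> * c else 0)) (circlepath \<alpha> r)"
proof -
  have "(\<lambda>z. inverse (z - \<alpha>) ^ Suc n * c) = (\<lambda>u. c / (u - \<alpha>) ^ Suc n)"
    by (rule ext) (simp add: divide_inverse power_inverse)
  then show ?thesis
    using Cauchy_has_contour_integral_higher_derivative_circlepath[of \<alpha> r "\<lambda>_. c" \<alpha> n] assms
    by (cases "n = 0") simp_all
qed

section \<open>The Riesz projection through its matrix coefficients\<close>

locale riesz_circle = resolvent_op F for F :: "'a::complex_hilbert_space \<Rightarrow>\<^sub>L 'a" +
  fixes \<alpha> :: complex and r :: real and I P\<^sub>0 :: "'a \<Rightarrow>\<^sub>L 'a"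
  assumes r: "r > 0" and isolated: "op_spectrum F \<inter> cball \<alpha> r = {\<alpha>}"
    and I: "has_op_contour_integral (resolvent F) I (circlepath \<alpha> r)"
    and P\<^sub>0_def: "P\<^sub>0 = scalar_op (1 / (2 * of_real pi * \<i>)) o\<^sub>L I"
begin

lemma circle_resolvent_set: "0 < \<rho> \<Longrightarrow> \<rho> \<le> r \<Longrightarrow> cmod (z - \<alpha>) = \<rho> \<Longrightarrow> z \<notin> op_spectrum F"
  using isolated by (auto simp: dist_norm norm_minus_commute)

text \<open>A bounded linear functional of the operator passes through the integral, so scalar
  Cauchy theory becomes available.\<close>

lemma integral_R: "((\<lambda>z. cinner (R z x) y) has_contour_integral cinner (I x) y) (circlepath \<alpha> r)"
proof -
  have "bounded_linear (\<lambda>B :: 'a \<Rightarrow>\<^sub>L 'a. cinner (B x) y)"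
  proof (rule bounded_linear_intro[where K = "norm x * norm y"])
    show "cinner ((B + C) x) y = cinner (B x) y + cinner (C x) y" for B C :: "'a \<Rightarrow>\<^sub>L 'a"
      by (simp add: blinfun.add_left cinner_add_left)
    show "cinner ((s *\<^sub>R B) x) y = s *\<^sub>R cinner (B x) y" for s and B :: "'a \<Rightarrow>\<^sub>L 'a"
      by (simp add: blinfun.scaleR_left cinner_scaleC_left scaleR_conv_of_real flip: scaleC_of_real)
    show "norm (cinner (B x) y) \<le> norm B * (norm x * norm y)" for B :: "'a \<Rightarrow>\<^sub>L 'a"
      using cinner_norm_le[of "B x" y] mult_right_mono[OF norm_blinfun[of B x] norm_ge_zero[of y]]
      by (simp add: mult.assoc)
  qed
  from has_integral_linear[OF I[unfolded has_op_contour_integral_def] this]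
  show ?thesis
    by (simp add: has_contour_integral_def o_def cinner_scaleC_left mult.commute)
qed

lemma cinner_P\<^sub>0: "2 * of_real pi * \<i> * cinner (P\<^sub>0 x) y = cinner (I x) y"
  by (simp add: P\<^sub>0_def cinner_scaleC_left)

lemma integral_P\<^sub>0:
  "((\<lambda>z. cinner (R z x) y) has_contour_integral 2 * of_real pi * \<i> * cinner (P\<^sub>0 x) y) (circlepath \<alpha> r)"
  unfolding cinner_P\<^sub>0 by (rule integral_R)

text \<open>Identities for \<open>P\<^sub>0\<close> are proved by comparing scalar integrals;
  \<open>circle_eq\<close> supplies the rewriting of the integrand on the circle.\<close>

lemma cinner_P\<^sub>0_eqI:
  assumes "((\<lambda>z. cinner (R z x) y) has_contour_integral 2 * of_real pi * \<i> * c) (circlepath \<alpha> r)"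
  shows "cinner (P\<^sub>0 x) y = c"
  using contour_integral_unique[OF assms] contour_integral_unique[OF integral_P\<^sub>0, of x y] by simp

lemma circle_eq:
  assumes "(f has_contour_integral i) (circlepath \<alpha> r)"
    and "\<And>z. z \<notin> op_spectrum F \<Longrightarrow> z \<noteq> \<alpha> \<Longrightarrow> f z = g z"
  shows "(g has_contour_integral i) (circlepath \<alpha> r)"
proof (rule has_contour_integral_eq[OF assms(1)])
  fix z assume "z \<in> path_image (circlepath \<alpha> r)"
  then have "cmod (z - \<alpha>) = r" using r by (simp add: dist_norm norm_minus_commute)
  then show "f z = g z" using r circle_resolvent_set[of r z] by (intro assms(2)) auto
qed

lemma P\<^sub>0_bounded_ops: "P\<^sub>0 \<in> bounded_ops"
proof (rule bounded_opsI, rule cinner_eqI)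
  fix c x y
  show "cinner (P\<^sub>0 (c *\<^sub>C x)) y = cinner (c *\<^sub>C P\<^sub>0 x) y"
  proof (rule cinner_P\<^sub>0_eqI, rule circle_eq)
    show "((\<lambda>z. c * cinner (R z x) y) has_contour_integral 2 * of_real pi * \<i> * cinner (c *\<^sub>C P\<^sub>0 x) y)
        (circlepath \<alpha> r)"
      using has_contour_integral_lmul[OF integral_P\<^sub>0[of x y], of c] by (simp add: cinner_scaleC_left ac_simps)
    show "c * cinner (R z x) y = cinner (R z (c *\<^sub>C x)) y" if "z \<notin> op_spectrum F" for z
      by (simp add: bounded_opsD[OF R_bounded_ops[OF that]] cinner_scaleC_left)
  qed
qed

lemma P\<^sub>0_commute:
  fixes B :: "'a \<Rightarrow>\<^sub>L 'a"
  assumes B: "B \<in> bounded_ops" "\<And>x. B (F x) = F (B x)"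
  shows "P\<^sub>0 (B x) = B (P\<^sub>0 x)"
proof (rule cinner_eqI)
  fix y
  show "cinner (P\<^sub>0 (B x)) y = cinner (B (P\<^sub>0 x)) y"
  proof (rule cinner_P\<^sub>0_eqI, rule circle_eq)
    show "((\<lambda>z. cinner (R z x) (adj B y)) has_contour_integral 2 * of_real pi * \<i> * cinner (B (P\<^sub>0 x)) y)
        (circlepath \<alpha> r)"
      using integral_P\<^sub>0[of x "adj B y"] by (simp add: cinner_adj[OF B(1)])
    show "cinner (R z x) (adj B y) = cinner (R z (B x)) y" if "z \<notin> op_spectrum F" for z
      by (simp add: R_commute[OF that B] cinner_adj[OF B(1)])
  qed
qed

definition T :: "'a \<Rightarrow>\<^sub>L 'a" where
  "T = F - scalar_op \<alpha>"

lemma T_bounded_ops: "T \<in> bounded_ops"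
  using F by (simp add: T_def)

lemma T_F_commute: "T (F x) = F (T x)"
  by (simp add: T_def blinfun.diff_left blinfun.diff_right bounded_opsD[OF F])

lemma TR: "z \<notin> op_spectrum F \<Longrightarrow> T (R z x) = (z - \<alpha>) *\<^sub>C R z x - x"
  using R_right[of z x] scaleC_add_left[of "z - \<alpha>" \<alpha> "R z x"]
  by (simp add: T_def blinfun.diff_left algebra_simps)

lemma P\<^sub>0_T: "P\<^sub>0 (T x) = T (P\<^sub>0 x)"
  by (rule P\<^sub>0_commute[OF T_bounded_ops T_F_commute])

definition Tn :: "nat \<Rightarrow> 'a \<Rightarrow>\<^sub>L 'a" where
  "Tn n = ((o\<^sub>L) T ^^ n) id_blinfun"

lemma Tn_0 [simp]: "Tn 0 x = x" and Tn_Suc: "Tn (Suc n) x = T (Tn n x)"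
  by (simp_all add: Tn_def)

lemma Tn_bounded_ops: "Tn n \<in> bounded_ops"
  by (induction n) (simp_all add: Tn_def T_bounded_ops)

lemma Tn_Suc': "Tn (Suc n) x = Tn n (T x)"
  by (induction n) (simp_all add: Tn_Suc)

text \<open>\<open>T (R z x)\<close> is \<open>(z - \<alpha>) *\<^sub>C R z x\<close> up to the
  constant vector \<open>x\<close>, whose contribution is a polynomial in \<open>z\<close> and
  integrates to 0.\<close>

lemma integral_Tn:
  "((\<lambda>z. (z - \<alpha>) ^ n * cinner (R z x) y) has_contour_integral
    2 * of_real pi * \<i> * cinner (Tn n (P\<^sub>0 x)) y) (circlepath \<alpha> r)"
proof (induction n arbitrary: x)
  case 0
  show ?case using integral_P\<^sub>0[of x y] by simp
next
  case (Suc n)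
  have "((\<lambda>z. (z - \<alpha>) ^ n * cinner x y) has_contour_integral 0) (circlepath \<alpha> r)"
    by (rule Cauchy_theorem_convex_simple[where S = UNIV]) (auto intro!: holomorphic_intros)
  from has_contour_integral_diff[OF Suc[of "T x"] has_contour_integral_neg[OF this]]
  have "((\<lambda>z. (z - \<alpha>) ^ n * cinner (R z (T x)) y - - ((z - \<alpha>) ^ n * cinner x y)) has_contour_integral
      2 * of_real pi * \<i> * cinner (Tn (Suc n) (P\<^sub>0 x)) y) (circlepath \<alpha> r)"
    by (simp add: P\<^sub>0_T Tn_Suc')
  then show ?case
  proof (rule circle_eq)
    show "(z - \<alpha>) ^ n * cinner (R z (T x)) y - - ((z - \<alpha>) ^ n * cinner x y)
        = (z - \<alpha>) ^ Suc n * cinner (R z x) y" if z: "z \<notin> op_spectrum F" for z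
      by (simp add: R_commute[OF z T_bounded_ops T_F_commute] TR[OF z] cinner_diff_left
          cinner_scaleC_left algebra_simps)
  qed
qed

lemma R_bounded_on_circle:
  assumes "0 < \<rho>" "\<rho> \<le> r"
  obtains M where "M \<ge> 0" "\<And>z. cmod (z - \<alpha>) = \<rho> \<Longrightarrow> norm (R z) \<le> M"
proof -
  have sub: "sphere \<alpha> \<rho> \<subseteq> - op_spectrum F"
    using circle_resolvent_set[OF assms] by (auto simp: dist_norm norm_minus_commute)
  have "compact (R ` sphere \<alpha> \<rho>)"
    by (intro compact_continuous_image continuous_on_subset[OF continuous_on_R sub]) simp
  then obtain M where M: "\<And>z. z \<in> sphere \<alpha> \<rho> \<Longrightarrow> norm (R z) \<le> M"
    using compact_imp_bounded bounded_iff by (metis imageI)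
  show ?thesis
  proof (rule that[of "max M 0"])
    show "norm (R z) \<le> max M 0" if "cmod (z - \<alpha>) = \<rho>" for z
      using M[of z] that by (simp add: dist_norm norm_minus_commute)
  qed simp
qed

text \<open>Quasinilpotence of \<open>T\<close> on the range of \<open>P\<^sub>0\<close>: the circle
  may be shrunk to a radius \<open>\<rho> \<le> \<epsilon>\<close>, where the factor
  \<open>(z - \<alpha>) ^ n\<close> has modulus \<open>\<rho> ^ n\<close>.\<close>

lemma Tn_P\<^sub>0_small:
  assumes "\<epsilon> > 0"
  obtains C where "C \<ge> 0" "\<And>n x. norm (Tn n (P\<^sub>0 x)) \<le> C * \<epsilon> ^ n * norm x"
proof -
  define \<rho> where "\<rho> = min \<epsilon> r"
  have \<rho>: "0 < \<rho>" "\<rho> \<le> r" "\<rho> \<le> \<epsilon>" using assms r by (auto simp: \<rho>_def)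
  obtain M where M: "M \<ge> 0" "\<And>z. cmod (z - \<alpha>) = \<rho> \<Longrightarrow> norm (R z) \<le> M"
    using R_bounded_on_circle[OF \<rho>(1,2), of thesis] by blast
  \<comment> \<open>In this open set only \<open>\<alpha>\<close> can be singular, so the integrals
    over all the circles involved equal the same residue up to \<open>2 * pi * \<i>\<close>.\<close>
  define S where "S = - op_spectrum F \<union> ball \<alpha> r"
  have oS: "open S" unfolding S_def by (intro open_Un open_resolvent_set open_ball)
  have \<alpha>S: "\<alpha> \<in> S" using r by (simp add: S_def)
  have cS: "cball \<alpha> s \<subseteq> S" if "s \<le> r" for s
  proof -
    have "\<alpha> \<in> ball \<alpha> r" using r by simp
    moreover have "z = \<alpha>" if "z \<in> cball \<alpha> s" "z \<in> op_spectrum F" for z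
      using isolated subset_cball[OF \<open>s \<le> r\<close>, of \<alpha>] that by blast
    ultimately show ?thesis unfolding S_def by blast
  qed
  have S\<alpha>: "S - {\<alpha>} \<subseteq> - op_spectrum F"
    using isolated ball_subset_cball[of \<alpha> r] unfolding S_def by blast
  have "norm (Tn n (P\<^sub>0 x)) \<le> (\<rho> * M) * \<epsilon> ^ n * norm x" for n x
  proof -
    \<comment> \<open>Testing against the vector itself turns the coefficient into the square of its
      norm.\<close>
    define y where "y = Tn n (P\<^sub>0 x)"
    define f where "f z = (z - \<alpha>) ^ n * cinner (R z x) y" for z
    have "f holomorphic_on S - {\<alpha>}"
      unfolding f_def by (intro holomorphic_intros holomorphic_on_subset[OF holomorphic_cinner_R S\<alpha>])
    then have res: "(f has_contour_integral 2 * pi * \<i> * residue f \<alpha>) (circlepath \<alpha> s)"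
      if "0 < s" "s \<le> r" for s
      using base_residue[OF oS \<alpha>S that(1) _ cS[OF that(2)]] by simp
    have "contour_integral (circlepath \<alpha> r) f = contour_integral (circlepath \<alpha> \<rho>) f"
      using contour_integral_unique[OF res] r \<rho> by simp
    then have "(f has_contour_integral 2 * of_real pi * \<i> * cinner (Tn n (P\<^sub>0 x)) y) (circlepath \<alpha> \<rho>)"
      using integral_Tn[of n x y] res[OF \<rho>(1,2)] unfolding f_def[symmetric]
      by (metis contour_integral_unique)
    then have "norm (2 * of_real pi * \<i> * cinner (Tn n (P\<^sub>0 x)) y) \<le> (\<rho> ^ n * (M * norm x * norm y)) * (2 * pi * \<rho>)"
    proof (rule has_contour_integral_bound_circlepath)
      fix z assume z: "cmod (z - \<alpha>) = \<rho>"
      have "cmod (cinner (R z x) y) \<le> norm (R z x) * norm y" by (rule cinner_norm_le)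
      also have "\<dots> \<le> (norm (R z) * norm x) * norm y" by (intro mult_right_mono norm_blinfun) simp
      also have "\<dots> \<le> (M * norm x) * norm y" by (intro mult_right_mono M z) simp_all
      finally show "norm (f z) \<le> \<rho> ^ n * (M * norm x * norm y)"
        using \<rho> by (simp add: f_def norm_mult norm_power z mult_left_mono)
    qed (use \<rho> M in auto)
    then have "norm y * norm y \<le> (\<rho> ^ n * (M * norm x) * \<rho>) * norm y"
      by (simp add: y_def[symmetric] norm_mult cinner_self power2_eq_square ac_simps)
    then have "norm y \<le> \<rho> ^ n * (M * norm x) * \<rho>"
      using \<rho> M by (cases "y = 0") auto
    also have "\<dots> \<le> \<epsilon> ^ n * (M * norm x) * \<rho>"
      using \<rho> M by (intro mult_right_mono power_mono) auto
    finally show ?thesis by (simp add: y_def ac_simps)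
  qed
  then show ?thesis using that[of "\<rho> * M"] \<rho> M by simp
qed

text \<open>The integrals of \<open>(z - \<alpha>)\<^sup>-\<^sup>n T\<^sup>n P\<^sub>0 R(z)\<close> do not depend on \<open>n \<ge> 1\<close>, and they tend to \<open>0\<close>;
  for \<open>n = 1\<close> the value is \<open>P\<^sub>0\<^sup>2 - P\<^sub>0\<close> up to a factor.\<close>

lemma integral_negative_powers:
  "((\<lambda>z. inverse (z - \<alpha>) ^ n * cinner (Tn n (P\<^sub>0 (R z x))) y) has_contour_integral
    2 * of_real pi * \<i> * (cinner (P\<^sub>0 (P\<^sub>0 x)) y - (if n = 0 then 0 else cinner (P\<^sub>0 x) y))) (circlepath \<alpha> r)"
proof (induction n)
  case 0
  show ?case
    using integral_P\<^sub>0[of x "adj P\<^sub>0 y"] by (simp add: cinner_adj[OF P\<^sub>0_bounded_ops])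
next
  case (Suc n)
  \<comment> \<open>The subtracted power has a nonzero integral only for \<open>n = 0\<close>; this
    is where the term with \<open>P\<^sub>0\<close> enters.\<close>
  from has_contour_integral_diff[OF this
      has_contour_integral_inverse_power[OF r, of \<alpha> n "cinner (Tn n (P\<^sub>0 x)) y"]]
  have "((\<lambda>z. inverse (z - \<alpha>) ^ n * cinner (Tn n (P\<^sub>0 (R z x))) y
        - inverse (z - \<alpha>) ^ Suc n * cinner (Tn n (P\<^sub>0 x)) y) has_contour_integral
      2 * of_real pi * \<i> * (cinner (P\<^sub>0 (P\<^sub>0 x)) y - (if Suc n = 0 then 0 else cinner (P\<^sub>0 x) y)))
    (circlepath \<alpha> r)"
    by (cases "n = 0") (simp_all add: algebra_simps)
  then show ?case
  proof (rule circle_eq)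
    fix z assume z: "z \<notin> op_spectrum F" "z \<noteq> \<alpha>"
    have eq: "Tn (Suc n) (P\<^sub>0 (R z x)) = (z - \<alpha>) *\<^sub>C Tn n (P\<^sub>0 (R z x)) - Tn n (P\<^sub>0 x)"
      by (simp add: Tn_Suc' P\<^sub>0_T[symmetric] TR[OF z(1)] blinfun.diff_right
          bounded_opsD[OF P\<^sub>0_bounded_ops] bounded_opsD[OF Tn_bounded_ops])
    have inv: "inverse (z - \<alpha>) * (z - \<alpha>) = 1" using z(2) by simp
    have "inverse (z - \<alpha>) ^ Suc n * ((z - \<alpha>) * a - b) = inverse (z - \<alpha>) ^ n * (inverse (z - \<alpha>) * (z - \<alpha>)) * a
        - inverse (z - \<alpha>) ^ Suc n * b" for a b
      by (simp add: algebra_simps)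
    then show "inverse (z - \<alpha>) ^ n * cinner (Tn n (P\<^sub>0 (R z x))) y
        - inverse (z - \<alpha>) ^ Suc n * cinner (Tn n (P\<^sub>0 x)) y
      = inverse (z - \<alpha>) ^ Suc n * cinner (Tn (Suc n) (P\<^sub>0 (R z x))) y"
      unfolding eq inv cinner_diff_left cinner_scaleC_left by simp
  qed
qed

lemma P\<^sub>0_idem: "P\<^sub>0 (P\<^sub>0 x) = P\<^sub>0 x"
proof (rule cinner_eqI)
  fix y
  let ?d = "cinner (P\<^sub>0 (P\<^sub>0 x)) y - cinner (P\<^sub>0 x) y"
  \<comment> \<open>With rate \<open>r / 2\<close> the decay beats the growth of the negative powers
    on the circle of radius \<open>r\<close> by a factor of \<open>(1/2) ^ n\<close>.\<close>
  obtain C where C: "C \<ge> 0" "\<And>n x. norm (Tn n (P\<^sub>0 x)) \<le> C * (r / 2) ^ n * norm x"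
    using Tn_P\<^sub>0_small[of "r / 2"] r by auto
  obtain M where M: "M \<ge> 0" "\<And>z. cmod (z - \<alpha>) = r \<Longrightarrow> norm (R z) \<le> M"
    using R_bounded_on_circle[OF r order_refl, of thesis] by blast
  define L where "L = C * M * norm x * norm y * (2 * pi * r)"
  have "norm (2 * of_real pi * \<i> * ?d) \<le> L * (1/2) ^ n" if "n > 0" for n :: nat
  proof -
    have "norm (2 * of_real pi * \<i> * ?d) \<le> ((1/2) ^ n * (C * M * norm x * norm y)) * (2 * pi * r)"
    proof (rule has_contour_integral_bound_circlepath)
      show "((\<lambda>z. inverse (z - \<alpha>) ^ n * cinner (Tn n (P\<^sub>0 (R z x))) y) has_contour_integral
          2 * of_real pi * \<i> * ?d) (circlepath \<alpha> r)"
        using integral_negative_powers[of n x y] that by simp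
      fix z assume z: "cmod (z - \<alpha>) = r"
      have "cmod (cinner (Tn n (P\<^sub>0 (R z x))) y) \<le> norm (Tn n (P\<^sub>0 (R z x))) * norm y"
        by (rule cinner_norm_le)
      also have "\<dots> \<le> (C * (r / 2) ^ n * norm (R z x)) * norm y" by (intro mult_right_mono C) simp
      also have "\<dots> \<le> (C * (r / 2) ^ n * (M * norm x)) * norm y"
        using C(1) r by (intro mult_right_mono mult_left_mono order_trans[OF norm_blinfun] M z) simp_all
      finally have "inverse r ^ n * cmod (cinner (Tn n (P\<^sub>0 (R z x))) y)
          \<le> inverse r ^ n * ((C * (r / 2) ^ n * (M * norm x)) * norm y)"
        using r by (intro mult_left_mono) auto
      also have "\<dots> = (inverse r * (r / 2)) ^ n * (C * M * norm x * norm y)"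
        by (simp only: power_mult_distrib) (simp only: ac_simps)
      also have "inverse r * (r / 2) = 1/2" using r by simp
      finally show "norm (inverse (z - \<alpha>) ^ n * cinner (Tn n (P\<^sub>0 (R z x))) y)
          \<le> (1/2) ^ n * (C * M * norm x * norm y)"
        by (simp add: norm_mult norm_power norm_inverse z)
    qed (use r C M in auto)
    then show ?thesis by (simp add: L_def ac_simps)
  qed
  moreover have "(\<lambda>n. L * (1/2) ^ n) \<longlonglongrightarrow> L * 0"
    by (intro tendsto_intros LIMSEQ_realpow_zero) auto
  ultimately have "norm (2 * of_real pi * \<i> * ?d) \<le> 0"
    by (intro LIMSEQ_le_const[of "\<lambda>n. L * (1/2) ^ n"]) (auto intro!: exI[of _ 1])
  then show "cinner (P\<^sub>0 (P\<^sub>0 x)) y = cinner (P\<^sub>0 x) y" by simp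
qed

end

section \<open>Finiteness of the Riesz projection\<close>

theorem corollary4p3:
  fixes A :: "('a::complex_hilbert_space \<Rightarrow>\<^sub>L 'a) set"
    and F P\<^sub>0 :: "'a \<Rightarrow>\<^sub>L 'a" and \<alpha> :: complex
  assumes "von_neumann_algebra A" and "properly_infinite A"
    and "F \<in> A" and "\<alpha> isolated_in op_spectrum F"
    and "fredholm A (F - scalar_op \<alpha>)"
    and "is_riesz_projection F \<alpha> P\<^sub>0"
  shows "finite_operator A P\<^sub>0"
proof -
  interpret vn_algebra A by unfold_locales fact
  have FB: "F \<in> bounded_ops" using \<open>F \<in> A\<close> by simp
  obtain r I where rI: "r > 0" "op_spectrum F \<inter> cball \<alpha> r = {\<alpha>}"
    "has_op_contour_integral (resolvent F) I (circlepath \<alpha> r)"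
    "P\<^sub>0 = scalar_op (1 / (2 * of_real pi * \<i>)) o\<^sub>L I"
    using \<open>is_riesz_projection F \<alpha> P\<^sub>0\<close> unfolding is_riesz_projection_def by blast
  interpret riesz_circle F \<alpha> r I P\<^sub>0
    by unfold_locales (use FB rI in auto)
  have TA: "T \<in> A" and "\<exists>E. finite_projection A E \<and> range (id_blinfun - E) \<subseteq> range T"
    using \<open>fredholm A (F - scalar_op \<alpha>)\<close> unfolding fredholm_def T_def by blast+
  then obtain E where E: "fin E" and ran: "range (id_blinfun - E) \<subseteq> range T"
    by (auto simp: finite_projection_iff)
  note EA = fin_A[OF E] and pE = fin_proj_op[OF E]
  obtain C where C: "C > 0" "\<And>x. norm (x - E x) \<le> C * norm (adj T x)"
    using adjoint_bounded_below_modulo_projection[OF T_bounded_ops pE ran] by blast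
  have P0A: "P\<^sub>0 \<in> A"
  proof (rule A_memI[OF P\<^sub>0_bounded_ops])
    show "P\<^sub>0 (B x) = B (P\<^sub>0 x)" if "B \<in> commutant A" for B x
      by (rule P\<^sub>0_commute[OF commutant_bounded_ops[OF that] A_commute[OF \<open>F \<in> A\<close> that]])
  qed
  have TnA: "Tn n \<in> A" for n
    by (induction n) (simp_all add: Tn_def TA)
  define L where "L n = adj (Tn n)" for n
  have LA: "L n \<in> A" for n unfolding L_def using TnA by simp
  have L0: "L 0 x = x" for x
    unfolding L_def
    by (rule inner_eqI) (simp add: inner_adj'[OF Tn_bounded_ops])
  have LS: "L (Suc n) x = adj T (L n x)" for n x
    unfolding L_def
    by (rule inner_eqI) (simp add: inner_adj'[OF Tn_bounded_ops] inner_adj'[OF T_bounded_ops] Tn_Suc')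
  define K where "K = proj_onto {x. P\<^sub>0 x = 0}"
  have ker: "closed {x. P\<^sub>0 x = 0}" "csubspace {x. P\<^sub>0 x = 0}"
    by (simp_all add: closed_kernel csubspace_kernel P\<^sub>0_bounded_ops)
  have KA: "K \<in> A" unfolding K_def by (rule proj_onto_kernel_in_A[OF P0A])
  have pK: "proj_op K" unfolding K_def by (rule proj_op_proj_onto[OF ker])
  \<comment> \<open>The orthogonal projection onto the closed range of \<open>adj P\<^sub>0\<close>,
    as the complement of the kernel of \<open>P\<^sub>0\<close>.\<close>
  define Q where "Q = id_blinfun - K"
  have QA: "Q \<in> A" using KA by (simp add: Q_def)
  have Q: "Q x = x - K x" for x by (simp add: Q_def blinfun.diff_left)
  \<comment> \<open>\<open>y - P\<^sub>0 y\<close> lies in the kernel of \<open>P\<^sub>0\<close>,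
    so \<open>Q P\<^sub>0 = Q\<close>, and the claim is the adjoint of this. It transfers the decay
    of the powers of \<open>T\<close> on the range of \<open>P\<^sub>0\<close> to
    \<open>L n Q\<close>.\<close>
  have adjQ: "adj P\<^sub>0 (Q x) = Q x" for x
  proof -
    have "P\<^sub>0 (y - P\<^sub>0 y) = 0" for y by (simp add: blinfun.diff_right P\<^sub>0_idem)
    then have "K (y - P\<^sub>0 y) = y - P\<^sub>0 y" for y
      unfolding K_def by (simp add: proj_onto_id_iff[OF ker])
    then have QP: "Q (P\<^sub>0 y) = Q y" for y
      by (simp add: Q blinfun.diff_right algebra_simps)
    have pQ: "proj_op Q" unfolding Q_def by (rule proj_op_compl[OF pK])
    show ?thesis
      by (rule inner_eqI) (simp add: inner_adj'[OF P\<^sub>0_bounded_ops] inner_proj[OF pQ] QP)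
  qed
  \<comment> \<open>The rate compensates the \<open>n\<close> factors \<open>C\<close> lost in the
    iteration and leaves \<open>M / 2 ^ n\<close>, which the choice of \<open>n\<close> makes less
    than 1.\<close>
  obtain M where M: "M \<ge> 0" "\<And>n x. norm (Tn n (P\<^sub>0 x)) \<le> M * (1 / (2 * C)) ^ n * norm x"
    using Tn_P\<^sub>0_small[of "1 / (2 * C)" thesis] C(1) by auto
  obtain n where n: "M < 2 ^ n" using real_arch_pow[of 2 M] by auto
  have small: "norm (L n (Q x)) \<le> M * (1 / (2 * C)) ^ n * norm (Q x)" for x
  proof -
    have eq: "L n (Q x) = adj (Tn n o\<^sub>L P\<^sub>0) (Q x)"
    proof (rule inner_eqI)
      fix z
      have "inner (L n (Q x)) z = inner (adj P\<^sub>0 (Q x)) (Tn n z)"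
        by (simp add: L_def inner_adj'[OF Tn_bounded_ops] adjQ)
      also have "\<dots> = inner (Q x) (P\<^sub>0 (Tn n z))" by (rule inner_adj'[OF P\<^sub>0_bounded_ops])
      also have "P\<^sub>0 (Tn n z) = Tn n (P\<^sub>0 z)"
        by (induction n arbitrary: z) (simp_all add: Tn_Suc P\<^sub>0_T)
      finally show "inner (L n (Q x)) z = inner (adj (Tn n o\<^sub>L P\<^sub>0) (Q x)) z"
        by (simp add: inner_adj' Tn_bounded_ops P\<^sub>0_bounded_ops)
    qed
    have "norm (adj (Tn n o\<^sub>L P\<^sub>0)) \<le> M * (1 / (2 * C)) ^ n"
    proof (rule order_trans[OF norm_adj_le norm_blinfun_bound])
      show "Tn n o\<^sub>L P\<^sub>0 \<in> bounded_ops" by (simp add: Tn_bounded_ops P\<^sub>0_bounded_ops)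
    qed (use M C(1) in auto)
    then show ?thesis
      unfolding eq by (intro order_trans[OF norm_blinfun] mult_right_mono) simp_all
  qed
  have "fin Q"
    unfolding Q_def
  proof (rule fin_common_kernel_compl[OF E, of "\<lambda>k. E o\<^sub>L (L k o\<^sub>L Q)" K n])
    show "E o\<^sub>L (L k o\<^sub>L Q) \<in> A" for k using EA LA QA by simp
    show "E ((E o\<^sub>L (L k o\<^sub>L Q)) x) = (E o\<^sub>L (L k o\<^sub>L Q)) x" for k x using pE by simp
    fix x assume "\<forall>k<n. (E o\<^sub>L (L k o\<^sub>L Q)) x = 0"
    then have EL: "E (L k (Q x)) = 0" if "k < n" for k using that by simp
    \<comment> \<open>As \<open>E\<close> kills \<open>L k (Q x)\<close>, its norm is at most
      \<open>C\<close> times that of the next iterate.\<close>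
    have "norm (Q x) \<le> C ^ k * norm (L k (Q x))" if "k \<le> n" for k
      using that
    proof (induction k)
      case (Suc k)
      have "norm (L k (Q x)) \<le> C * norm (L (Suc k) (Q x))"
        using C(2)[of "L k (Q x)"] EL[of k] Suc.prems by (simp add: LS)
      then have "C ^ k * norm (L k (Q x)) \<le> C ^ k * (C * norm (L (Suc k) (Q x)))"
        using C(1) by (intro mult_left_mono) auto
      then show ?case using Suc by (simp add: ac_simps)
    qed (simp add: L0)
    then have "norm (Q x) \<le> C ^ n * norm (L n (Q x))" by simp
    also have "\<dots> \<le> C ^ n * (M * (1 / (2 * C)) ^ n * norm (Q x))"
      using C(1) by (intro mult_left_mono small) auto
    also have "\<dots> = M / 2 ^ n * norm (Q x)"
      using C(1) by (simp add: power_divide power_mult_distrib)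
    finally have "(1 - M / 2 ^ n) * norm (Q x) \<le> 0" by (simp add: algebra_simps)
    moreover have "1 - M / 2 ^ n > 0" using n by simp
    ultimately have "norm (Q x) = 0"
      by (metis mult_le_0_iff norm_ge_zero order_antisym not_le)
    then show "K x = x" by (simp add: Q)
  qed (use KA pK in auto)
  moreover obtain V where V: "V \<in> A" "adj V o\<^sub>L V = Q" "V o\<^sub>L adj V = proj_onto (closure (range P\<^sub>0))"
    using support_equivalence[OF P0A, of thesis] unfolding Q_def K_def by blast
  have pN: "proj_op (proj_onto (closure (range P\<^sub>0)))"
    using P\<^sub>0_bounded_ops by (intro proj_op_proj_onto) (simp_all add: csubspace_closure csubspace_range)
  have "fin (proj_onto (closure (range P\<^sub>0)))"
  proof (rule fin_subequivalent[OF \<open>fin Q\<close> A_adj[OF V(1)] pN])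
    show "adj (adj V) (adj V x) = proj_onto (closure (range P\<^sub>0)) x" for x
      using V(1) by (simp flip: V(3))
    have VQ: "V (Q x) = V x" for x
      by (rule partial_isometry_initial[OF _ fin_proj_op[OF \<open>fin Q\<close>] V(2)]) (use V in simp)
    show "Q (adj V x) = adj V x" for x
      by (rule inner_eqI)
        (simp add: inner_proj[OF fin_proj_op[OF \<open>fin Q\<close>]] inner_adj'[OF A_bounded_ops[OF V(1)]] VQ)
  qed
  then show ?thesis
    using P0A by (simp add: finite_operator_def finite_projection_iff)
qed

end
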